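(* Let $\mathbb{F}$ be a field of characteristic different from $2$ and $3$, and let $L$ be a non-abelian nilpotent Lie superalgebra over $\mathbb{F}$ of (finite) superdimension $(k\mid l)$ whose derived subalgebra $L^2=[L,L]$ has superdimension $(r\mid s)$. Then the non-abelian tensor square $L\otimes L$ satisfies $$\dim (L\otimes L)\leq (k+l-(r+s))(k+l-1)+2 .$$ In particular, when $r=1$ and $s=0$, the equality holds if and only if $L\cong H(1,0)\oplus A(k-3\mid l)$.
   Context: A Lie superalgebra over $\mathbb{F}$ is a $\mathbb{Z}_2$-graded vector space $L=L_{\bar 0}\oplus L_{\bar 1}$ with a bilinear bracket satisfying $[L_\alpha,L_\beta]\subseteq L_{\alpha+\beta}$, $[x,y]=-(-1)^{|x||y|}[y,x]$, and the graded Jacobi identity $(-1)^{|x||z|}[x,[y,z]]+(-1)^{|y||x|}[y,[z,x]]+(-1)^{|z||y|}[z,[x,y]]=0$ for homogeneous $x,y,z$, where $|x|\in\mathbb{Z}_2$ is the degree of $x$. Superdimension $(m\mid n)$ means $\dim L_{\bar 0}=m$ and $\dim L_{\bar 1}=n$. In the inequality, $\dim(L\otimes L)$ is the total dimension (the sum of the dimensions of the even and odd parts). Non-abelian tensor square: $L\otimes L$ is the Lie superalgebra generated by the symbols $m\otimes n$ with $m,n\in L$ homogeneous, of degree $|m\otimes n|=|m|+|n|$, subject to the relations, for $\lambda\in\mathbb{F}$ and homogeneous $m,m',n,n'\in L$: (1) $\lambda(m\otimes n)=\lambda m\otimes n=m\otimes\lambda n$; (2) $(m+m')\otimes n=m\otimes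 n+m'\otimes n$ when $|m|=|m'|$, and $m\otimes(n+n')=m\otimes n+m\otimes n'$ when $|n|=|n'|$; (3) $[m,m']\otimes n=m\otimes[m',n]-(-1)^{|m||m'|}\,m'\otimes[m,n]$, and $m\otimes[n,n']=(-1)^{|n'|(|m|+|n|)}\,[n',m]\otimes n-(-1)^{|m||n|}\,[n,m]\otimes n'$; (4) $[m\otimes n,m'\otimes n']=-(-1)^{|m||n|}\,[n,m]\otimes[m',n']$. $A(m\mid n)$ denotes the abelian Lie superalgebra (zero bracket) of superdimension $(m\mid n)$. $H(1,0)$ is the Heisenberg Lie (super)algebra of superdimension $(3\mid 0)$ with even basis $x_1,x_2,z$ and only nonzero bracket (up to skew-symmetry) $[x_1,x_2]=z$. Direct sums are direct sums of Lie superalgebras; isomorphisms of Lie superalgebras are even (degree-preserving). *)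

theory Defs
  imports
    "HOL-Computational_Algebra.Computational_Algebra"
    "HOL-Library.Z2"
    "HOL-Library.Product_Plus"
    "HOL-Library.Poly_Mapping"
begin

section \<open>Superalgebras\<close>

text \<open>
  A superalgebra over the field \<open>'k\<close> lives on two subspaces \<open>part A 0\<close> (even) and \<open>part A 1\<close>
  (odd) of an ambient vector space \<open>'v\<close> with scalar multiplication \<open>scl A\<close>; degrees are
  elements of the two-element field \<^typ>\<open>bit\<close>.  The values of \<open>brk A\<close> off the carrier are
  irrelevant.  Subspaces are used, rather than whole types, so that algebras of superdimension
  \<open>(m | n)\<close> for variable \<open>m\<close>, \<open>n\<close> and derived subalgebras are objects of the same kind.
\<close>

record ('k, 'v) superalg =
  scl :: "'k \<Rightarrow> 'v \<Rightarrow> 'v"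
  part :: "bit \<Rightarrow> 'v set"
  brk :: "'v \<Rightarrow> 'v \<Rightarrow> 'v"

definition carr :: "('k, 'v::ab_group_add) superalg \<Rightarrow> 'v set" where
  "carr A = {x + y | x y. x \<in> part A 0 \<and> y \<in> part A 1}"

text \<open>The sign \<open>(-1)^a\<close>, used with exponents computed in \<^typ>\<open>bit\<close>.\<close>

definition psign :: "bit \<Rightarrow> 'k::field" where
  "psign a = (if a = 0 then 1 else - 1)"

locale superalgebra = vector_space "scl A"
  for A :: "('k::field, 'v::ab_group_add) superalg" +
  assumes part_subspace: "subspace (part A \<alpha>)"
    and part_Int: "part A 0 \<inter> part A 1 = {0}"
    and brk_part: "\<lbrakk>x \<in> part A \<alpha>; y \<in> part A \<beta>\<rbrakk> \<Longrightarrow> brk A x y \<in> part A (\<alpha> + \<beta>)"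
    and brk_add_left: "\<lbrakk>x \<in> carr A; y \<in> carr A; z \<in> carr A\<rbrakk> \<Longrightarrow>
      brk A (x + y) z = brk A x z + brk A y z"
    and brk_add_right: "\<lbrakk>x \<in> carr A; y \<in> carr A; z \<in> carr A\<rbrakk> \<Longrightarrow>
      brk A x (y + z) = brk A x y + brk A x z"
    and brk_scl_left: "\<lbrakk>x \<in> carr A; y \<in> carr A\<rbrakk> \<Longrightarrow> brk A (scl A c x) y = scl A c (brk A x y)"
    and brk_scl_right: "\<lbrakk>x \<in> carr A; y \<in> carr A\<rbrakk> \<Longrightarrow> brk A x (scl A c y) = scl A c (brk A x y)"

definition jacobiator :: "('k::field, 'v::ab_group_add) superalg \<Rightarrow>
    bit \<Rightarrow> 'v \<Rightarrow> bit \<Rightarrow> 'v \<Rightarrow> bit \<Rightarrow> 'v \<Rightarrow> 'v" where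
  "jacobiator A \<alpha> x \<beta> y \<gamma> z =
     scl A (psign (\<alpha> * \<gamma>)) (brk A x (brk A y z))
   + scl A (psign (\<beta> * \<alpha>)) (brk A y (brk A z x))
   + scl A (psign (\<gamma> * \<beta>)) (brk A z (brk A x y))"

text \<open>
  For characteristic different from 2 and 3 the following two identities are the full definition
  of a Lie superalgebra; in particular \<open>[x, [x, x]] = 0\<close> for odd \<open>x\<close> is a consequence.
\<close>

locale lie_superalgebra = superalgebra +
  assumes skew: "\<lbrakk>x \<in> part A \<alpha>; y \<in> part A \<beta>\<rbrakk> \<Longrightarrow>
      brk A x y = - scl A (psign (\<alpha> * \<beta>)) (brk A y x)"
    and jacobi: "\<lbrakk>x \<in> part A \<alpha>; y \<in> part A \<beta>; z \<in> part A \<gamma>\<rbrakk> \<Longrightarrow>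
      jacobiator A \<alpha> x \<beta> y \<gamma> z = 0"

definition finite_dim :: "('k::field, 'v::ab_group_add) superalg \<Rightarrow> bool" where
  "finite_dim A \<longleftrightarrow> (\<exists>B. finite B \<and> carr A \<subseteq> module.span (scl A) B)"

definition has_superdim :: "('k::field, 'v::ab_group_add) superalg \<Rightarrow> nat \<Rightarrow> nat \<Rightarrow> bool" where
  "has_superdim A m n \<longleftrightarrow> finite_dim A \<and>
     vector_space.dim (scl A) (part A 0) = m \<and> vector_space.dim (scl A) (part A 1) = n"

text \<open>Only meaningful together with \<^const>\<open>finite_dim\<close>: the library's \<open>dim\<close> is 0 on
  infinite-dimensional spaces.\<close>

definition total_dim :: "('k::field, 'v::ab_group_add) superalg \<Rightarrow> nat" where
  "total_dim A = vector_space.dim (scl A) (part A 0) + vector_space.dim (scl A) (part A 1)"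

definition abelian :: "('k, 'v::ab_group_add) superalg \<Rightarrow> bool" where
  "abelian A \<longleftrightarrow> (\<forall>x\<in>carr A. \<forall>y\<in>carr A. brk A x y = 0)"

definition brk_span ::
    "('k::field, 'v::ab_group_add) superalg \<Rightarrow> 'v set \<Rightarrow> 'v set \<Rightarrow> 'v set" where
  "brk_span A X Y = module.span (scl A) {brk A x y | x y. x \<in> X \<and> y \<in> Y}"

definition derived_subalgebra ::
    "('k::field, 'v::ab_group_add) superalg \<Rightarrow> ('k, 'v) superalg" where
  "derived_subalgebra A = A\<lparr>part := \<lambda>\<alpha>. part A \<alpha> \<inter> brk_span A (carr A) (carr A)\<rparr>"

primrec lower_central :: "('k::field, 'v::ab_group_add) superalg \<Rightarrow> nat \<Rightarrow> 'v set" where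
  "lower_central A 0 = carr A"
| "lower_central A (Suc n) = brk_span A (carr A) (lower_central A n)"

definition nilpotent :: "('k::field, 'v::ab_group_add) superalg \<Rightarrow> bool" where
  "nilpotent A \<longleftrightarrow> (\<exists>n. lower_central A n = {0})"

definition superalg_hom :: "('k, 'v::ab_group_add) superalg \<Rightarrow>
    ('k, 'w::ab_group_add) superalg \<Rightarrow> ('v \<Rightarrow> 'w) \<Rightarrow> bool" where
  "superalg_hom A B f \<longleftrightarrow>
     (\<forall>\<alpha>. f ` part A \<alpha> \<subseteq> part B \<alpha>) \<and>
     (\<forall>x\<in>carr A. \<forall>y\<in>carr A. f (x + y) = f x + f y) \<and>
     (\<forall>c. \<forall>x\<in>carr A. f (scl A c x) = scl B c (f x)) \<and>
     (\<forall>x\<in>carr A. \<forall>y\<in>carr A. f (brk A x y) = brk B (f x) (f y))"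

definition superalg_iso :: "('k, 'v::ab_group_add) superalg \<Rightarrow>
    ('k, 'w::ab_group_add) superalg \<Rightarrow> bool" (infix \<open>\<cong>\<^sub>s\<close> 50) where
  "A \<cong>\<^sub>s B \<longleftrightarrow> (\<exists>f. superalg_hom A B f \<and> bij_betw f (carr A) (carr B))"

definition direct_sum :: "('k, 'v) superalg \<Rightarrow> ('k, 'w) superalg \<Rightarrow> ('k, 'v \<times> 'w) superalg"
    (infixr \<open>\<oplus>\<^sub>s\<close> 65) where
  "A \<oplus>\<^sub>s B = \<lparr>scl = \<lambda>c (x, y). (scl A c x, scl B c y),
              part = \<lambda>\<alpha>. part A \<alpha> \<times> part B \<alpha>,
              brk = \<lambda>(x, y) (x', y'). (brk A x x', brk B y y')\<rparr>"


section \<open>The algebras \<open>H(1,0)\<close> and \<open>A(m | n)\<close>\<close>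

text \<open>The triple \<open>(a, b, c)\<close> stands for \<open>a x\<^sub>1 + b x\<^sub>2 + c z\<close>.\<close>

definition heisenberg_1_0 :: "('k::field, 'k \<times> 'k \<times> 'k) superalg" where
  "heisenberg_1_0 =
     \<lparr>scl = \<lambda>t (a, b, c). (t * a, t * b, t * c),
      part = \<lambda>\<alpha>. if \<alpha> = 0 then UNIV else {0},
      brk = \<lambda>(a, b, c) (a', b', c'). (0, 0, a * b' - b * a')\<rparr>"

definition pm_scale :: "'k::field \<Rightarrow> ('x \<Rightarrow>\<^sub>0 'k) \<Rightarrow> ('x \<Rightarrow>\<^sub>0 'k)" where
  "pm_scale c p = Poly_Mapping.map ((*) c) p"

text \<open>The even basis vectors are the indices \<open>(0, i)\<close> with \<open>i < m\<close>, the odd ones the indices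
  \<open>(1, i)\<close> with \<open>i < n\<close>.\<close>

definition abelian_superalg :: "nat \<Rightarrow> nat \<Rightarrow> ('k::field, bit \<times> nat \<Rightarrow>\<^sub>0 'k) superalg" where
  "abelian_superalg m n =
     \<lparr>scl = pm_scale,
      part = \<lambda>\<alpha>. {p. Poly_Mapping.keys p \<subseteq> {\<alpha>} \<times> {..<(if \<alpha> = 0 then m else n)}},
      brk = \<lambda>_ _. 0\<rparr>"


section \<open>Lie superalgebras given by generators and relations\<close>

datatype 'x monomial = Gen 'x | Br "'x monomial" "'x monomial"

primrec monomial_deg :: "('x \<Rightarrow> bit) \<Rightarrow> 'x monomial \<Rightarrow> bit" where
  "monomial_deg d (Gen x) = d x"
| "monomial_deg d (Br s t) = monomial_deg d s + monomial_deg d t"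

text \<open>The free non-associative superalgebra on a set \<open>X\<close> of generators with degrees \<open>d\<close>: formal
  linear combinations of bracketed monomials in \<open>X\<close>.\<close>

definition free_superalg ::
    "'x set \<Rightarrow> ('x \<Rightarrow> bit) \<Rightarrow> ('k::field, 'x monomial \<Rightarrow>\<^sub>0 'k) superalg" where
  "free_superalg X d =
     \<lparr>scl = pm_scale,
      part = \<lambda>\<alpha>. {p. Poly_Mapping.keys p \<subseteq> {t. set_monomial t \<subseteq> X \<and> monomial_deg d t = \<alpha>}},
      brk = \<lambda>p q. \<Sum>s\<in>Poly_Mapping.keys p. \<Sum>t\<in>Poly_Mapping.keys q.
        Poly_Mapping.single (Br s t) (Poly_Mapping.lookup p s * Poly_Mapping.lookup q t)\<rparr>"

definition is_ideal :: "('k::field, 'v::ab_group_add) superalg \<Rightarrow> 'v set \<Rightarrow> bool" where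
  "is_ideal A I \<longleftrightarrow> I \<subseteq> carr A \<and> module.subspace (scl A) I \<and>
     (\<forall>x\<in>carr A. \<forall>y\<in>I. brk A x y \<in> I \<and> brk A y x \<in> I)"

definition ideal_gen :: "('k::field, 'v::ab_group_add) superalg \<Rightarrow> 'v set \<Rightarrow> 'v set" where
  "ideal_gen A R = \<Inter>{I. is_ideal A I \<and> R \<subseteq> I}"

definition lie_relators :: "('k::field, 'v::ab_group_add) superalg \<Rightarrow> 'v set" where
  "lie_relators A =
     {brk A x y + scl A (psign (\<alpha> * \<beta>)) (brk A y x) | \<alpha> x \<beta> y. x \<in> part A \<alpha> \<and> y \<in> part A \<beta>} \<union>
     {jacobiator A \<alpha> x \<beta> y \<gamma> z | \<alpha> x \<beta> y \<gamma> z. x \<in> part A \<alpha> \<and> y \<in> part A \<beta> \<and> z \<in> part A \<gamma>}"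

text \<open>\<open>T\<close> is isomorphic to the quotient \<open>A / I\<close>.\<close>

definition is_quotient :: "('k::field, 'v::ab_group_add) superalg \<Rightarrow> 'v set \<Rightarrow>
    ('k, 'w::ab_group_add) superalg \<Rightarrow> bool" where
  "is_quotient A I T \<longleftrightarrow> (\<exists>\<pi>. superalg_hom A T \<pi> \<and> \<pi> ` carr A = carr T \<and>
     {x \<in> carr A. \<pi> x = 0} = I)"

text \<open>\<open>T\<close> is (isomorphic to) the Lie superalgebra generated by the symbols \<open>X\<close> of degrees \<open>d\<close>
  subject to the relations \<open>u = v\<close> for \<open>(u, v) \<in> R\<close>.\<close>

definition is_presented :: "'x set \<Rightarrow> ('x \<Rightarrow> bit) \<Rightarrow>
    (('x monomial \<Rightarrow>\<^sub>0 'k) \<times> ('x monomial \<Rightarrow>\<^sub>0 'k)) set \<Rightarrow>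
    ('k::field, 'w::ab_group_add) superalg \<Rightarrow> bool" where
  "is_presented X d R T \<longleftrightarrow> lie_superalgebra T \<and>
     is_quotient (free_superalg X d)
       (ideal_gen (free_superalg X d)
          (lie_relators (free_superalg X d) \<union> {u - v | u v. (u, v) \<in> R})) T"


section \<open>The non-abelian tensor square\<close>

text \<open>
  The symbol \<open>Tens \<mu> m \<nu> n\<close> is \<open>m \<otimes> n\<close> together with the degrees \<open>\<mu> = |m|\<close> and \<open>\<nu> = |n|\<close>.
  Recording the degrees only matters if \<open>m\<close> or \<open>n\<close> is 0, the one homogeneous element without a
  unique degree; these symbols vanish in the tensor square by \<open>scl_left\<close> or \<open>scl_right\<close> below,
  with scalar 0.
\<close>

datatype 'v symbol = Tens bit 'v bit 'v

fun symbol_deg :: "'v symbol \<Rightarrow> bit" where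
  "symbol_deg (Tens \<mu> m \<nu> n) = \<mu> + \<nu>"

definition tensor_symbols :: "('k, 'v) superalg \<Rightarrow> 'v symbol set" where
  "tensor_symbols L = {Tens \<mu> m \<nu> n | \<mu> m \<nu> n. m \<in> part L \<mu> \<and> n \<in> part L \<nu>}"

definition tens :: "bit \<Rightarrow> 'v \<Rightarrow> bit \<Rightarrow> 'v \<Rightarrow> ('v symbol monomial \<Rightarrow>\<^sub>0 'k::field)" where
  "tens \<mu> m \<nu> n = Poly_Mapping.single (Gen (Tens \<mu> m \<nu> n)) 1"

abbreviation tensor_free ::
    "('k::field, 'v) superalg \<Rightarrow> ('k, 'v symbol monomial \<Rightarrow>\<^sub>0 'k) superalg" where
  "tensor_free L \<equiv> free_superalg (tensor_symbols L) symbol_deg"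

inductive_set tensor_relations :: "('k::field, 'v::ab_group_add) superalg \<Rightarrow>
    (('v symbol monomial \<Rightarrow>\<^sub>0 'k) \<times> ('v symbol monomial \<Rightarrow>\<^sub>0 'k)) set"
  for L :: "('k::field, 'v::ab_group_add) superalg" where
  scl_left: "\<lbrakk>m \<in> part L \<mu>; n \<in> part L \<nu>\<rbrakk> \<Longrightarrow>
    (pm_scale c (tens \<mu> m \<nu> n), tens \<mu> (scl L c m) \<nu> n) \<in> tensor_relations L"
| scl_right: "\<lbrakk>m \<in> part L \<mu>; n \<in> part L \<nu>\<rbrakk> \<Longrightarrow>
    (pm_scale c (tens \<mu> m \<nu> n), tens \<mu> m \<nu> (scl L c n)) \<in> tensor_relations L"
| add_left: "\<lbrakk>m \<in> part L \<mu>; m' \<in> part L \<mu>; n \<in> part L \<nu>\<rbrakk> \<Longrightarrow>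
    (tens \<mu> (m + m') \<nu> n, tens \<mu> m \<nu> n + tens \<mu> m' \<nu> n) \<in> tensor_relations L"
| add_right: "\<lbrakk>m \<in> part L \<mu>; n \<in> part L \<nu>; n' \<in> part L \<nu>\<rbrakk> \<Longrightarrow>
    (tens \<mu> m \<nu> (n + n'), tens \<mu> m \<nu> n + tens \<mu> m \<nu> n') \<in> tensor_relations L"
| brk_left: "\<lbrakk>m \<in> part L \<mu>; m' \<in> part L \<mu>'; n \<in> part L \<nu>\<rbrakk> \<Longrightarrow>
    (tens (\<mu> + \<mu>') (brk L m m') \<nu> n,
     tens \<mu> m (\<mu>' + \<nu>) (brk L m' n)
       - pm_scale (psign (\<mu> * \<mu>')) (tens \<mu>' m' (\<mu> + \<nu>) (brk L m n))) \<in> tensor_relations L"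
| brk_right: "\<lbrakk>m \<in> part L \<mu>; n \<in> part L \<nu>; n' \<in> part L \<nu>'\<rbrakk> \<Longrightarrow>
    (tens \<mu> m (\<nu> + \<nu>') (brk L n n'),
     pm_scale (psign (\<nu>' * (\<mu> + \<nu>))) (tens (\<nu>' + \<mu>) (brk L n' m) \<nu> n)
       - pm_scale (psign (\<mu> * \<nu>)) (tens (\<nu> + \<mu>) (brk L n m) \<nu>' n')) \<in> tensor_relations L"
| brk_brk: "\<lbrakk>m \<in> part L \<mu>; n \<in> part L \<nu>; m' \<in> part L \<mu>'; n' \<in> part L \<nu>'\<rbrakk> \<Longrightarrow>
    (brk (tensor_free L) (tens \<mu> m \<nu> n) (tens \<mu>' m' \<nu>' n'),
     - pm_scale (psign (\<mu> * \<nu>)) (tens (\<nu> + \<mu>) (brk L n m) (\<mu>' + \<nu>') (brk L m' n')))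
       \<in> tensor_relations L"

definition is_tensor_square :: "('k::field, 'v::ab_group_add) superalg \<Rightarrow>
    ('k, 'w::ab_group_add) superalg \<Rightarrow> bool" where
  "is_tensor_square L T \<longleftrightarrow>
     is_presented (tensor_symbols L) symbol_deg (tensor_relations L) T"


section \<open>Existence of the tensor square\<close>

lemma lookup_pm_scale [simp]: "Poly_Mapping.lookup (pm_scale c p) t = c * Poly_Mapping.lookup p t"
  unfolding pm_scale_def by (simp add: Poly_Mapping.map.rep_eq when_def)

lemma vector_space_pm_scale: "vector_space pm_scale"
  by unfold_locales (auto intro!: poly_mapping_eqI simp: lookup_add algebra_simps)

context superalgebra
begin

lemma carrI: "\<lbrakk>x \<in> part A 0; y \<in> part A 1\<rbrakk> \<Longrightarrow> x + y \<in> carr A"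
  unfolding carr_def by blast

lemma zero_part: "0 \<in> part A \<alpha>"
  using part_subspace subspace_0 by blast

lemma part_carr: "x \<in> part A \<alpha> \<Longrightarrow> x \<in> carr A"
  using carrI[of x 0] carrI[of 0 x] zero_part by (cases \<alpha>) auto

lemma subspace_carr: "subspace (carr A)"
  unfolding carr_def by (rule subspace_sums[OF part_subspace part_subspace])

lemma brk_carr:
  assumes "x \<in> carr A" "y \<in> carr A" shows "brk A x y \<in> carr A"
proof -
  obtain a b where x: "x = a + b" and a: "a \<in> part A 0" and b: "b \<in> part A 1"
    using assms(1) unfolding carr_def by blast
  obtain c d where y: "y = c + d" and c: "c \<in> part A 0" and d: "d \<in> part A 1"
    using assms(2) unfolding carr_def by blast
  note C = a[THEN part_carr] b[THEN part_carr] c[THEN part_carr] d[THEN part_carr]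
  have "brk A x y = brk A a c + brk A a d + (brk A b c + brk A b d)"
    unfolding x y using C by (simp add: brk_add_left brk_add_right subspace_add[OF subspace_carr])
  then show ?thesis
    using brk_part[OF a c] brk_part[OF a d] brk_part[OF b c] brk_part[OF b d]
    by (auto intro!: subspace_add[OF subspace_carr] intro: part_carr)
qed

text \<open>Homogeneous components: \<open>x = hcomp 0 x + hcomp 1 x\<close> on the carrier.\<close>

definition hcomp :: "bit \<Rightarrow> 'v \<Rightarrow> 'v" where
  "hcomp \<alpha> x = (THE y. y \<in> part A \<alpha> \<and> x - y \<in> part A (1 + \<alpha>))"

lemma part_Int': "\<lbrakk>x \<in> part A \<alpha>; x \<in> part A (1 + \<alpha>)\<rbrakk> \<Longrightarrow> x = 0"
  using part_Int by (cases \<alpha>) auto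

lemma hcomp_eqI:
  assumes "y \<in> part A \<alpha>" "x - y \<in> part A (1 + \<alpha>)" shows "hcomp \<alpha> x = y"
  unfolding hcomp_def
proof (rule the_equality)
  fix z assume z: "z \<in> part A \<alpha> \<and> x - z \<in> part A (1 + \<alpha>)"
  have "z - y \<in> part A \<alpha>" using z assms subspace_diff[OF part_subspace] by blast
  moreover have "z - y = (x - y) - (x - z)" by simp
  then have "z - y \<in> part A (1 + \<alpha>)" using z assms subspace_diff[OF part_subspace] by metis
  ultimately have "z - y = 0" by (rule part_Int')
  then show "z = y" by simp
qed (use assms in auto)

lemma hcomp_sum: "\<lbrakk>a \<in> part A 0; b \<in> part A 1\<rbrakk> \<Longrightarrow> hcomp 0 (a + b) = a \<and> hcomp 1 (a + b) = b"
  by (auto intro!: hcomp_eqI)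

lemma hcomp_part: "x \<in> carr A \<Longrightarrow> hcomp \<alpha> x \<in> part A \<alpha>"
  unfolding carr_def using hcomp_sum by (cases \<alpha>) auto

lemma hcomp_decomp: "x \<in> carr A \<Longrightarrow> hcomp 0 x + hcomp 1 x = x"
  unfolding carr_def using hcomp_sum by auto

lemma hcomp_same: "x \<in> part A \<alpha> \<Longrightarrow> hcomp \<alpha> x = x"
  by (rule hcomp_eqI) (auto simp: zero_part)

lemma hcomp_other: "x \<in> part A \<alpha> \<Longrightarrow> \<alpha> \<noteq> \<beta> \<Longrightarrow> hcomp \<beta> x = 0"
  by (rule hcomp_eqI) (cases \<alpha>; cases \<beta>; auto simp: zero_part)+

lemma hcomp_add: "\<lbrakk>x \<in> carr A; y \<in> carr A\<rbrakk> \<Longrightarrow> hcomp \<alpha> (x + y) = hcomp \<alpha> x + hcomp \<alpha> y"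
proof (rule hcomp_eqI)
  assume x: "x \<in> carr A" and y: "y \<in> carr A"
  show "hcomp \<alpha> x + hcomp \<alpha> y \<in> part A \<alpha>"
    using x y by (intro subspace_add[OF part_subspace] hcomp_part)
  have "x + y - (hcomp \<alpha> x + hcomp \<alpha> y) = hcomp (1 + \<alpha>) x + hcomp (1 + \<alpha>) y"
    using hcomp_decomp[OF x] hcomp_decomp[OF y] by (cases \<alpha>) (auto simp: algebra_simps)
  then show "x + y - (hcomp \<alpha> x + hcomp \<alpha> y) \<in> part A (1 + \<alpha>)"
    using x y by (simp add: subspace_add[OF part_subspace] hcomp_part)
qed

lemma hcomp_scl: "x \<in> carr A \<Longrightarrow> hcomp \<alpha> (scl A c x) = scl A c (hcomp \<alpha> x)"
proof (rule hcomp_eqI)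
  assume x: "x \<in> carr A"
  show "scl A c (hcomp \<alpha> x) \<in> part A \<alpha>"
    using x by (intro subspace_scale[OF part_subspace] hcomp_part)
  have "x - hcomp \<alpha> x = hcomp (1 + \<alpha>) x"
    using hcomp_decomp[OF x] by (cases \<alpha>) (auto simp: algebra_simps)
  then have "scl A c x - scl A c (hcomp \<alpha> x) = scl A c (hcomp (1 + \<alpha>) x)"
    by (simp flip: scale_right_diff_distrib)
  then show "scl A c x - scl A c (hcomp \<alpha> x) \<in> part A (1 + \<alpha>)"
    using x by (simp add: subspace_scale[OF part_subspace] hcomp_part)
qed

lemma hcomp_brk:
  assumes x: "x \<in> carr A" and y: "y \<in> carr A"
  shows "hcomp \<alpha> (brk A x y) = brk A (hcomp 0 x) (hcomp \<alpha> y) + brk A (hcomp 1 x) (hcomp (1 + \<alpha>) y)"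
proof -
  have C: "hcomp \<beta> x \<in> carr A" "hcomp \<beta> y \<in> carr A" for \<beta>
    using hcomp_part[OF x] hcomp_part[OF y] part_carr by blast+
  have e: "brk A x y = (brk A (hcomp 0 x) (hcomp \<alpha> y) + brk A (hcomp 1 x) (hcomp (1 + \<alpha>) y))
     + (brk A (hcomp 0 x) (hcomp (1 + \<alpha>) y) + brk A (hcomp 1 x) (hcomp \<alpha> y))"
  proof -
    have "x = hcomp 0 x + hcomp 1 x" "y = hcomp \<alpha> y + hcomp (1 + \<alpha>) y"
      using hcomp_decomp[OF x] hcomp_decomp[OF y] by (cases \<alpha>; simp add: add.commute)+
    then have "brk A x y = brk A (hcomp 0 x + hcomp 1 x) (hcomp \<alpha> y + hcomp (1 + \<alpha>) y)"
      by (rule arg_cong2)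
    also have "\<dots> = brk A (hcomp 0 x) (hcomp \<alpha> y) + brk A (hcomp 0 x) (hcomp (1 + \<alpha>) y)
      + (brk A (hcomp 1 x) (hcomp \<alpha> y) + brk A (hcomp 1 x) (hcomp (1 + \<alpha>) y))"
      using C by (simp only: brk_add_left brk_add_right subspace_add[OF subspace_carr] ac_simps)
    finally show ?thesis by (simp only: ac_simps)
  qed
  have 1: "brk A (hcomp 0 x) (hcomp \<beta> y) \<in> part A \<beta>" "brk A (hcomp 1 x) (hcomp (1 + \<beta>) y) \<in> part A \<beta>" for \<beta>
    using brk_part[OF hcomp_part[OF x] hcomp_part[OF y], of 0 \<beta>]
      brk_part[OF hcomp_part[OF x] hcomp_part[OF y], of 1 "1 + \<beta>"] by (cases \<beta>; simp)+
  show ?thesis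
    apply (rule hcomp_eqI)
    using 1[of \<alpha>] apply (simp add: subspace_add[OF part_subspace])
    unfolding e using 1[of "1 + \<alpha>"]
    by (cases \<alpha>) (simp_all add: subspace_add[OF part_subspace])
qed

lemma is_ideal_carr: "is_ideal A (carr A)"
  unfolding is_ideal_def using subspace_carr brk_carr by blast

lemma ideal_gen_ideal:
  assumes "R \<subseteq> carr A" shows "is_ideal A (ideal_gen A R)" "R \<subseteq> ideal_gen A R"
proof -
  have "carr A \<in> {I. is_ideal A I \<and> R \<subseteq> I}" using is_ideal_carr assms by blast
  then show "is_ideal A (ideal_gen A R)"
    unfolding is_ideal_def ideal_gen_def
    by (auto intro!: subspace_Inter)
  show "R \<subseteq> ideal_gen A R" unfolding ideal_gen_def by blast
qed

lemma ideal_gen_graded: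
  assumes R: "R \<subseteq> (\<Union>\<alpha>. part A \<alpha>)" and x: "x \<in> ideal_gen A R"
  shows "hcomp \<alpha> x \<in> ideal_gen A R"
proof -
  let ?I = "ideal_gen A R"
  have RC: "R \<subseteq> carr A" using R part_carr by blast
  note I = ideal_gen_ideal[OF RC]
  have IC: "?I \<subseteq> carr A" and IS: "subspace ?I"
    and Ib: "\<And>x y. x \<in> carr A \<Longrightarrow> y \<in> ?I \<Longrightarrow> brk A x y \<in> ?I \<and> brk A y x \<in> ?I"
    using I(1) unfolding is_ideal_def by blast+
  define J where "J = {x \<in> ?I. \<forall>\<alpha>. hcomp \<alpha> x \<in> ?I}"
  have C: "hcomp \<beta> x \<in> carr A" if "x \<in> carr A" for \<beta> x
    using hcomp_part[OF that] part_carr by blast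
  have "is_ideal A J"
    unfolding is_ideal_def
  proof (intro conjI ballI)
    show "J \<subseteq> carr A" using IC J_def by blast
    show "subspace J"
    proof (rule subspaceI)
      show "0 \<in> J" using hcomp_same[OF zero_part] hcomp_other[OF zero_part] subspace_0[OF IS]
        unfolding J_def by auto
      fix x y assume "x \<in> J" "y \<in> J"
      then show "x + y \<in> J" using IC subspace_add[OF IS]
        unfolding J_def by (auto simp: subset_iff hcomp_add)
    next
      fix c x assume "x \<in> J"
      then show "scl A c x \<in> J" using IC subspace_scale[OF IS]
        unfolding J_def by (auto simp: subset_iff hcomp_scl)
    qed
    fix x y assume x: "x \<in> carr A" and y: "y \<in> J"
    then have yC: "y \<in> carr A" using IC J_def by blast
    show "brk A x y \<in> J" "brk A y x \<in> J"
      unfolding J_def using x y yC Ib[OF C[OF x]] Ib[OF x] unfolding J_def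
      by (auto simp: hcomp_brk intro!: subspace_add[OF IS])
  qed
  moreover have "R \<subseteq> J"
  proof
    fix x assume "x \<in> R"
    then obtain \<beta> where "x \<in> part A \<beta>" using R by blast
    then show "x \<in> J" using \<open>x \<in> R\<close> I(2) subspace_0[OF IS]
      unfolding J_def using hcomp_same[of x \<beta>] hcomp_other[of x \<beta>] by (auto, metis subsetD)
  qed
  ultimately have "?I \<subseteq> J" unfolding ideal_gen_def by blast
  then show ?thesis using x J_def by blast
qed

lemma projection_exists:
  assumes "subspace S" "subspace U" "U \<subseteq> S"
  obtains P where "Vector_Spaces.linear (scl A) (scl A) P" "P ` S \<subseteq> S" "\<And>x. x \<in> S \<Longrightarrow> P x = 0 \<longleftrightarrow> x \<in> U"
    "\<And>x. x \<in> S \<Longrightarrow> x - P x \<in> U"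
proof -
  interpret vp: vector_space_pair "scl A" "scl A" by unfold_locales
  obtain B where B: "B \<subseteq> U" "independent B" "U \<subseteq> span B"
    using maximal_independent_subset by blast
  obtain C where C: "B \<subseteq> C" "C \<subseteq> S" "independent C" "S \<subseteq> span C"
    using maximal_independent_subset_extend[of B S] B assms(3) by (metis order_trans)
  define P where "P = vp.construct C (\<lambda>c. if c \<in> B then 0 else c)"
  have lin: "Vector_Spaces.linear (scl A) (scl A) P" unfolding P_def by (rule vp.linear_construct[OF C(3)])
  interpret P: Vector_Spaces.linear "scl A" "scl A" P by (rule lin)
  have PC: "P c = (if c \<in> B then 0 else c)" if "c \<in> C" for c
    unfolding P_def using vp.construct_basis[OF C(3) that] by simp
  have spU: "span B = U" using B assms(2) by (meson span_minimal subset_antisym)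
  have spS: "span C = S" using C assms(1) by (meson span_minimal subset_antisym)
  have ker: "P x = 0" if "x \<in> U" for x
  proof -
    have "x \<in> span B" using that spU by simp
    then show ?thesis
      by (rule span_induct) (use PC C(1) in \<open>auto simp: subspace_def P.add P.scale\<close>)
  qed
  have diff: "x - P x \<in> U" if "x \<in> S" for x
  proof -
    have "x \<in> span C" using that spS by simp
    then show ?thesis
    proof (rule span_induct)
      have *: "subspace {x. x - P x \<in> U}"
        using assms(2) by (auto simp: subspace_def P.add P.scale add_diff_add
          scale_right_diff_distrib[symmetric])
      show "subspace {x. x - P x \<in> U}" by (rule *)
      fix x assume "x \<in> C"
      then show "x - P x \<in> U" using PC B(1) subspace_0[OF assms(2)] by auto
    qed
  qed
  have im: "P ` S \<subseteq> S"
  proof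
    fix y assume "y \<in> P ` S"
    then obtain x where x: "x \<in> S" "y = P x" by blast
    have "P x = x - (x - P x)" by simp
    then show "y \<in> S" using x diff[of x] assms subspace_diff by (metis subsetD)
  qed
  show ?thesis
    by (rule that[OF lin im]) (use ker diff in force)+
qed


lemma quotient_exists:
  assumes R: "R \<subseteq> (\<Union>\<alpha>. part A \<alpha>)" and lie: "lie_relators A \<subseteq> ideal_gen A R"
  shows "\<exists>T :: ('k, 'v) superalg. lie_superalgebra T \<and> is_quotient A (ideal_gen A R) T"
proof -
  define I where "I = ideal_gen A R"
  have RC: "R \<subseteq> carr A" using R part_carr by blast
  have IC: "I \<subseteq> carr A" and IS: "subspace I"
    and Ib: "\<And>x y. x \<in> carr A \<Longrightarrow> y \<in> I \<Longrightarrow> brk A x y \<in> I \<and> brk A y x \<in> I"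
    using ideal_gen_ideal(1)[OF RC] unfolding is_ideal_def I_def by blast+
  have Ig: "x \<in> I \<Longrightarrow> hcomp \<alpha> x \<in> I" for x \<alpha>
    using ideal_gen_graded[OF R] I_def by blast
  have "\<exists>P. Vector_Spaces.linear (scl A) (scl A) P \<and> P ` part A \<alpha> \<subseteq> part A \<alpha> \<and>
     (\<forall>x\<in>part A \<alpha>. (P x = 0 \<longleftrightarrow> x \<in> I) \<and> x - P x \<in> I)" for \<alpha>
  proof -
    obtain P where "Vector_Spaces.linear (scl A) (scl A) P" "P ` part A \<alpha> \<subseteq> part A \<alpha>"
      "\<And>x. x \<in> part A \<alpha> \<Longrightarrow> P x = 0 \<longleftrightarrow> x \<in> I \<inter> part A \<alpha>"
      "\<And>x. x \<in> part A \<alpha> \<Longrightarrow> x - P x \<in> I \<inter> part A \<alpha>"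
      using projection_exists[OF part_subspace[of \<alpha>] subspace_inter[OF IS part_subspace[of \<alpha>]]]
      by blast
    then show ?thesis by (intro exI[of _ P]) auto
  qed
  then obtain P where P: "\<And>\<alpha>. Vector_Spaces.linear (scl A) (scl A) (P \<alpha>)"
    and Pp: "\<And>\<alpha> x. x \<in> part A \<alpha> \<Longrightarrow> P \<alpha> x \<in> part A \<alpha>"
    and Pk: "\<And>\<alpha> x. x \<in> part A \<alpha> \<Longrightarrow> P \<alpha> x = 0 \<longleftrightarrow> x \<in> I"
    and Pd: "\<And>\<alpha> x. x \<in> part A \<alpha> \<Longrightarrow> x - P \<alpha> x \<in> I"
    by (metis image_subset_iff)
  have Padd: "P \<alpha> (x + y) = P \<alpha> x + P \<alpha> y" and Pscl: "P \<alpha> (scl A c x) = scl A c (P \<alpha> x)"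
    and P0: "P \<alpha> 0 = 0" for \<alpha> x y c
  proof -
    interpret Vector_Spaces.linear "scl A" "scl A" "P \<alpha>" by (rule P)
    show "P \<alpha> (x + y) = P \<alpha> x + P \<alpha> y" "P \<alpha> (scl A c x) = scl A c (P \<alpha> x)" "P \<alpha> 0 = 0"
      by (rule add scale zero)+
  qed
  define p where "p x = P 0 (hcomp 0 x) + P 1 (hcomp 1 x)" for x
  have p_part: "p x = P \<alpha> x" if "x \<in> part A \<alpha>" for x \<alpha>
    unfolding p_def using that hcomp_same[OF that] hcomp_other[OF that] P0 by (cases \<alpha>) auto
  have p_in: "p x \<in> part A \<alpha>" if "x \<in> part A \<alpha>" for x \<alpha>
    using p_part[OF that] Pp[OF that] by simp
  have p_carr: "p x \<in> carr A" if "x \<in> carr A" for x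
    unfolding p_def using Pp hcomp_part[OF that] by (intro carrI) auto
  have p_add: "p (x + y) = p x + p y" if "x \<in> carr A" "y \<in> carr A" for x y
    unfolding p_def using that by (simp add: hcomp_add Padd)
  have p_scl: "p (scl A c x) = scl A c (p x)" if "x \<in> carr A" for x c
    unfolding p_def using that by (simp add: hcomp_scl Pscl scale_right_distrib)
  have p_diff: "x - p x \<in> I" if x: "x \<in> carr A" for x
  proof -
    have "x - p x = (hcomp 0 x - P 0 (hcomp 0 x)) + (hcomp 1 x - P 1 (hcomp 1 x))"
      unfolding p_def using hcomp_decomp[OF x] by (simp add: algebra_simps)
    then show ?thesis using Pd hcomp_part[OF x] subspace_add[OF IS] by metis
  qed
  have p_ker: "p x = 0 \<longleftrightarrow> x \<in> I" if x: "x \<in> carr A" for x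
  proof
    assume "p x = 0" then show "x \<in> I" using p_diff[OF x] by simp
  next
    assume "x \<in> I"
    then show "p x = 0" unfolding p_def using Pk[OF hcomp_part[OF x]] Ig by simp
  qed
  have p_minus: "p (- x) = - p x" if "x \<in> carr A" for x
    using p_scl[OF that, of "-1"] by simp
  have p_eq: "p x = p y" if "x \<in> carr A" "y \<in> carr A" "x - y \<in> I" for x y
  proof -
    have "p (x - y) = 0" using that p_ker[of "x - y"] IC by blast
    moreover have "p (x - y) = p x - p y"
      using p_add[of x "- y"] p_minus[of y] that subspace_neg[OF subspace_carr] by simp
    ultimately show ?thesis by simp
  qed
  have p_idem: "p (p x) = p x" if "x \<in> carr A" for x
  proof -
    have "p x - x \<in> I" using subspace_neg[OF IS p_diff[OF that]] by simp
    then show ?thesis using p_eq p_carr that by blast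
  qed
  have p_brk: "p (brk A (p x) (p y)) = p (brk A x y)" if x: "x \<in> carr A" and y: "y \<in> carr A" for x y
  proof (rule sym, rule p_eq)
    have m: "p x - x \<in> carr A" "p y - y \<in> carr A"
      using x y p_carr subspace_diff[OF subspace_carr] by blast+
    have i: "p x - x \<in> I" "p y - y \<in> I"
      using subspace_neg[OF IS p_diff[OF x]] subspace_neg[OF IS p_diff[OF y]] by simp_all
    have "brk A (p x) (p y) = brk A (x + (p x - x)) (p y)" by simp
    also have "\<dots> = brk A x (y + (p y - y)) + brk A (p x - x) (p y)"
      using x m p_carr[OF y] by (subst brk_add_left) auto
    also have "\<dots> = brk A x y + brk A x (p y - y) + brk A (p x - x) (p y)"
      using x y m by (subst brk_add_right) auto
    finally have "brk A x y - brk A (p x) (p y) = - (brk A x (p y - y) + brk A (p x - x) (p y))"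
      by (simp add: algebra_simps)
    moreover have "brk A x (p y - y) + brk A (p x - x) (p y) \<in> I"
      using Ib[OF x i(2)] Ib[OF p_carr[OF y] i(1)] subspace_add[OF IS] by blast
    ultimately show "brk A x y - brk A (p x) (p y) \<in> I"
      by (metis subspace_neg[OF IS])
  qed (use x y p_carr brk_carr in auto)
  define T where "T = A\<lparr>part := \<lambda>\<alpha>. p ` part A \<alpha>, brk := \<lambda>x y. p (brk A x y)\<rparr>"
  have T [simp]: "scl T = scl A" "part T \<alpha> = p ` part A \<alpha>" "brk T x y = p (brk A x y)" for \<alpha> x y
    by (simp_all add: T_def)
  have carrT: "carr T = p ` carr A"
  proof -
    have "carr T = {p x + p y | x y. x \<in> part A 0 \<and> y \<in> part A 1}"
      unfolding carr_def T by blast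
    also have "\<dots> = {p (x + y) | x y. x \<in> part A 0 \<and> y \<in> part A 1}"
      using p_add part_carr by metis
    finally show ?thesis unfolding carr_def by blast
  qed
  have TA: "x \<in> carr A" "p x = x" if "x \<in> carr T" for x
    using that p_carr p_idem unfolding carrT by auto
  have TpA: "x \<in> part A \<alpha>" "p x = x" if "x \<in> part T \<alpha>" for x \<alpha>
    using that p_in p_idem part_carr by auto
  have lie0: "p x = 0" if "x \<in> lie_relators A" for x
    using that lie IC p_ker unfolding I_def[symmetric] by blast
  have "lie_superalgebra T"
  proof
    show "module.subspace (scl T) (part T \<alpha>)" for \<alpha>
      unfolding T
    proof (rule subspaceI)
      show "0 \<in> p ` part A \<alpha>"
        using zero_part[of \<alpha>] p_part[OF zero_part[of \<alpha>]] P0 by (metis imageI)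
      fix x y c assume "x \<in> p ` part A \<alpha>"
      then obtain x' where x': "x' \<in> part A \<alpha>" "x = p x'" by blast
      have "scl A c x = p (scl A c x')" using x' p_scl part_carr by simp
      then show "scl A c x \<in> p ` part A \<alpha>"
        using subspace_scale[OF part_subspace x'(1)] by blast
      assume "y \<in> p ` part A \<alpha>"
      then obtain y' where y': "y' \<in> part A \<alpha>" "y = p y'" by blast
      have "x + y = p (x' + y')" using x' y' p_add part_carr by simp
      then show "x + y \<in> p ` part A \<alpha>"
        using subspace_add[OF part_subspace x'(1) y'(1)] by blast
    qed
    have "0 \<in> p ` part A \<alpha>" for \<alpha>
      using zero_part[of \<alpha>] p_part[OF zero_part[of \<alpha>]] P0 by (metis imageI)
    moreover have "p ` part A \<alpha> \<subseteq> part A \<alpha>" for \<alpha> using p_in by blast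
    ultimately show "part T 0 \<inter> part T 1 = {0}" unfolding T using part_Int by blast
  next
    fix x \<alpha> y \<beta> assume "x \<in> part T \<alpha>" "y \<in> part T \<beta>"
    note x = TpA[OF \<open>x \<in> part T \<alpha>\<close>] and y = TpA[OF \<open>y \<in> part T \<beta>\<close>]
    show "brk T x y \<in> part T (\<alpha> + \<beta>)" using brk_part[OF x(1) y(1)] by simp
    have "brk A x y + scl A (psign (\<alpha> * \<beta>)) (brk A y x) \<in> lie_relators A"
      unfolding lie_relators_def using x y by blast
    then have "p (brk A x y + scl A (psign (\<alpha> * \<beta>)) (brk A y x)) = 0" by (rule lie0)
    then have "p (brk A x y) + scl A (psign (\<alpha> * \<beta>)) (p (brk A y x)) = 0"
      using x y part_carr by (simp add: p_add p_scl brk_carr subspace_scale[OF subspace_carr])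
    then show "brk T x y = - scl T (psign (\<alpha> * \<beta>)) (brk T y x)"
      by (simp add: eq_neg_iff_add_eq_0)
    fix z \<gamma> assume "z \<in> part T \<gamma>"
    note z = TpA[OF \<open>z \<in> part T \<gamma>\<close>]
    note C = part_carr[OF x(1)] part_carr[OF y(1)] part_carr[OF z(1)]
    have pp: "p (brk A u (p (brk A v w))) = p (brk A u (brk A v w))"
      if "u \<in> carr A" "v \<in> carr A" "w \<in> carr A" "p u = u" for u v w
      using p_brk[OF that(1) brk_carr[OF that(2,3)]] that(4) by simp
    have "jacobiator A \<alpha> x \<beta> y \<gamma> z \<in> lie_relators A"
      unfolding lie_relators_def using x y z by blast
    then have "p (jacobiator A \<alpha> x \<beta> y \<gamma> z) = 0" by (rule lie0)
    then show "jacobiator T \<alpha> x \<beta> y \<gamma> z = 0"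
      unfolding jacobiator_def using C x(2) y(2) z(2)
      by (simp add: pp p_add p_scl brk_carr subspace_scale[OF subspace_carr] subspace_add[OF subspace_carr])
  next
    fix x y assume "x \<in> carr T" "y \<in> carr T"
    note x = TA[OF \<open>x \<in> carr T\<close>] and y = TA[OF \<open>y \<in> carr T\<close>]
    show "brk T (scl T c x) y = scl T c (brk T x y)" "brk T x (scl T c y) = scl T c (brk T x y)" for c
      using x y by (simp_all add: brk_scl_left brk_scl_right p_scl brk_carr)
    fix z assume "z \<in> carr T"
    note z = TA[OF \<open>z \<in> carr T\<close>]
    show "brk T (x + y) z = brk T x z + brk T y z" "brk T x (y + z) = brk T x y + brk T x z"
      using x y z by (simp_all add: brk_add_left brk_add_right p_add brk_carr)
  qed (auto simp: algebra_simps)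
  moreover have "is_quotient A I T"
    unfolding is_quotient_def superalg_hom_def
    by (intro exI[of _ p]) (use p_add p_scl p_brk carrT p_ker IC in auto)
  ultimately show ?thesis unfolding I_def by blast
qed

end

lemma keys_pm_scale: "Poly_Mapping.keys (pm_scale c p) \<subseteq> Poly_Mapping.keys p"
  by (auto simp: in_keys_iff)

lemma superalgebra_free: "superalgebra (free_superalg X d :: ('k::field, 'x monomial \<Rightarrow>\<^sub>0 'k) superalg)"
proof -
  let ?F = "free_superalg X d :: ('k, 'x monomial \<Rightarrow>\<^sub>0 'k) superalg"
  interpret vector_space "pm_scale :: 'k \<Rightarrow> ('x monomial \<Rightarrow>\<^sub>0 'k) \<Rightarrow> _" by (rule vector_space_pm_scale)
  have brk_def: "brk ?F p q = (\<Sum>s\<in>S. \<Sum>t\<in>U.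
        Poly_Mapping.single (Br s t) (Poly_Mapping.lookup p s * Poly_Mapping.lookup q t))"
    if "finite S" "finite U" "Poly_Mapping.keys p \<subseteq> S" "Poly_Mapping.keys q \<subseteq> U" for p q S U
  proof -
    have "(\<Sum>t\<in>U. Poly_Mapping.single (Br s t) (Poly_Mapping.lookup p s * Poly_Mapping.lookup q t)) =
      (\<Sum>t\<in>Poly_Mapping.keys q. Poly_Mapping.single (Br s t) (Poly_Mapping.lookup p s * Poly_Mapping.lookup q t))" for s
      using that by (intro sum.mono_neutral_right) (auto simp: in_keys_iff)
    moreover have "(\<Sum>s\<in>S. \<Sum>t\<in>Poly_Mapping.keys q. Poly_Mapping.single (Br s t) (Poly_Mapping.lookup p s * Poly_Mapping.lookup q t))
      = (\<Sum>s\<in>Poly_Mapping.keys p. \<Sum>t\<in>Poly_Mapping.keys q. Poly_Mapping.single (Br s t) (Poly_Mapping.lookup p s * Poly_Mapping.lookup q t))"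
      using that by (intro sum.mono_neutral_right) (auto simp: in_keys_iff)
    ultimately show ?thesis by (simp add: free_superalg_def)
  qed
  have sc: "scl ?F = pm_scale" by (simp add: free_superalg_def)
  have pt: "part ?F \<alpha> = {p. Poly_Mapping.keys p \<subseteq> {t. set_monomial t \<subseteq> X \<and> monomial_deg d t = \<alpha>}}" for \<alpha>
    by (simp add: free_superalg_def)
  show ?thesis
  proof
    show "module.subspace (scl ?F) (part ?F \<alpha>)" for \<alpha>
      unfolding sc pt
    proof (rule subspaceI; clarsimp)
      fix p q :: "'x monomial \<Rightarrow>\<^sub>0 'k" and x
      assume "Poly_Mapping.keys p \<subseteq> {t. set_monomial t \<subseteq> X \<and> monomial_deg d t = \<alpha>}"
        "Poly_Mapping.keys q \<subseteq> {t. set_monomial t \<subseteq> X \<and> monomial_deg d t = \<alpha>}"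
        "x \<in> Poly_Mapping.keys (p + q)"
      then show "set_monomial x \<subseteq> X \<and> monomial_deg d x = \<alpha>"
        using keys_add[of p q] by blast
    next
      fix c and p :: "'x monomial \<Rightarrow>\<^sub>0 'k" and x
      assume "Poly_Mapping.keys p \<subseteq> {t. set_monomial t \<subseteq> X \<and> monomial_deg d t = \<alpha>}"
        "x \<in> Poly_Mapping.keys (pm_scale c p)"
      then show "set_monomial x \<subseteq> X \<and> monomial_deg d x = \<alpha>"
        using keys_pm_scale[of c p] by blast
    qed
    show "part ?F 0 \<inter> part ?F 1 = {0}"
    proof -
      have "p = 0" if "p \<in> part ?F 0" "p \<in> part ?F 1" for p
      proof -
        have "Poly_Mapping.keys p = {}" using that unfolding pt by fastforce
        then show ?thesis by simp
      qed
      moreover have "0 \<in> part ?F \<alpha>" for \<alpha> unfolding pt by simp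
      ultimately show ?thesis by blast
    qed
  next
    fix p q \<alpha> \<beta> assume p: "p \<in> part ?F \<alpha>" and q: "q \<in> part ?F \<beta>"
    show "brk ?F p q \<in> part ?F (\<alpha> + \<beta>)"
      unfolding pt
    proof (intro CollectI subsetI)
      fix u assume "u \<in> Poly_Mapping.keys (brk ?F p q)"
      then have "u \<in> Poly_Mapping.keys (\<Sum>s\<in>Poly_Mapping.keys p. \<Sum>t\<in>Poly_Mapping.keys q.
          Poly_Mapping.single (Br s t) (Poly_Mapping.lookup p s * Poly_Mapping.lookup q t))"
        by (simp only: free_superalg_def superalg.simps)
      then obtain s where s: "s \<in> Poly_Mapping.keys p" and "u \<in> Poly_Mapping.keys (\<Sum>t\<in>Poly_Mapping.keys q.
          Poly_Mapping.single (Br s t) (Poly_Mapping.lookup p s * Poly_Mapping.lookup q t))"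
        using keys_sum by fast
      then obtain t where t: "t \<in> Poly_Mapping.keys q" and "u \<in> Poly_Mapping.keys
          (Poly_Mapping.single (Br s t) (Poly_Mapping.lookup p s * Poly_Mapping.lookup q t))"
        using keys_sum by fast
      then have u: "u = Br s t" by (simp split: if_splits)
      have "set_monomial s \<subseteq> X \<and> monomial_deg d s = \<alpha>" "set_monomial t \<subseteq> X \<and> monomial_deg d t = \<beta>"
        using p q s t unfolding pt by blast+
      then show "set_monomial u \<subseteq> X \<and> monomial_deg d u = \<alpha> + \<beta>"
        unfolding u by simp
    qed
  next
    fix p q c
    have sg: "pm_scale c (Poly_Mapping.single t a) = Poly_Mapping.single t (c * a)"
      for t :: "'x monomial" and a :: 'k
      by (rule poly_mapping_eqI) (simp add: lookup_single when_def)
    note fin = finite_keys[of p] finite_keys[of q]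
    show "brk ?F (scl ?F c p) q = scl ?F c (brk ?F p q)"
      unfolding sc brk_def[OF fin order_refl order_refl] brk_def[OF fin keys_pm_scale order_refl]
      by (simp add: scale_sum_right sg mult.assoc)
    show "brk ?F p (scl ?F c q) = scl ?F c (brk ?F p q)"
      unfolding sc brk_def[OF fin order_refl order_refl] brk_def[OF fin order_refl keys_pm_scale]
      by (simp add: scale_sum_right sg mult.left_commute)
    fix r :: "'x monomial \<Rightarrow>\<^sub>0 'k"
    let ?pq = "Poly_Mapping.keys p \<union> Poly_Mapping.keys q"
      and ?qr = "Poly_Mapping.keys q \<union> Poly_Mapping.keys r"
    have fpq: "finite ?pq" and fqr: "finite ?qr" by simp_all
    show "brk ?F (p + q) r = brk ?F p r + brk ?F q r"
      unfolding brk_def[OF fpq finite_keys keys_add order_refl]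
        brk_def[OF fpq finite_keys Un_upper1 order_refl] brk_def[OF fpq finite_keys Un_upper2 order_refl]
      by (simp only: lookup_add distrib_right single_add sum.distrib)
    show "brk ?F p (q + r) = brk ?F p q + brk ?F p r"
      unfolding brk_def[OF finite_keys fqr order_refl keys_add]
        brk_def[OF finite_keys fqr order_refl Un_upper1] brk_def[OF finite_keys fqr order_refl Un_upper2]
      by (simp only: lookup_add distrib_left single_add sum.distrib)
  qed (simp_all add: sc scale_right_distrib scale_left_distrib)
qed

lemma tens_part:
  "\<lbrakk>m \<in> part L \<mu>; n \<in> part L \<nu>\<rbrakk> \<Longrightarrow> tens \<mu> m \<nu> n \<in> part (tensor_free L) (\<mu> + \<nu>)"
  by (auto simp: tens_def free_superalg_def tensor_symbols_def)

lemma tensor_relations_part: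
  assumes L: "lie_superalgebra L" and uv: "(u, v) \<in> tensor_relations L"
  shows "\<exists>\<alpha>. u - v \<in> part (tensor_free L) \<alpha>"
proof -
  interpret L: lie_superalgebra L by (rule L)
  interpret F: superalgebra "tensor_free L" by (rule superalgebra_free)
  have sc: "scl (tensor_free L) = pm_scale" by (simp add: free_superalg_def)
  have "\<exists>\<alpha>. u \<in> part (tensor_free L) \<alpha> \<and> v \<in> part (tensor_free L) \<alpha>"
    using uv
  proof cases
    note S = F.subspace_scale[OF F.part_subspace, unfolded sc]
      and D = F.subspace_diff[OF F.part_subspace] and N = F.subspace_neg[OF F.part_subspace]
      and Ad = F.subspace_add[OF F.part_subspace]
    {
      case (scl_left m \<mu> n \<nu> c)
      then show ?thesis using L.subspace_scale[OF L.part_subspace] by (auto intro!: S tens_part exI)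
    next
      case (scl_right m \<mu> n \<nu> c)
      then show ?thesis using L.subspace_scale[OF L.part_subspace] by (auto intro!: S tens_part exI)
    next
      case (add_left m \<mu> m' n \<nu>)
      then show ?thesis using L.subspace_add[OF L.part_subspace] by (auto intro!: Ad tens_part exI)
    next
      case (add_right m \<mu> n \<nu> n')
      then show ?thesis using L.subspace_add[OF L.part_subspace] by (auto intro!: Ad tens_part exI)
    next
      case (brk_left m \<mu> m' \<mu>' n \<nu>)
      have "tens (\<mu> + \<mu>') (brk L m m') \<nu> n \<in> part (tensor_free L) (\<mu> + \<mu>' + \<nu>)"
        "tens \<mu> m (\<mu>' + \<nu>) (brk L m' n) \<in> part (tensor_free L) (\<mu> + (\<mu>' + \<nu>))"
        "tens \<mu>' m' (\<mu> + \<nu>) (brk L m n) \<in> part (tensor_free L) (\<mu>' + (\<mu> + \<nu>))"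
        by (intro tens_part L.brk_part brk_left)+
      then show ?thesis unfolding brk_left(1,2)
        by (intro exI[of _ "\<mu> + \<mu>' + \<nu>"] conjI D S) (simp_all only: ac_simps)
    next
      case (brk_right m \<mu> n \<nu> n' \<nu>')
      have "tens \<mu> m (\<nu> + \<nu>') (brk L n n') \<in> part (tensor_free L) (\<mu> + (\<nu> + \<nu>'))"
        "tens (\<nu>' + \<mu>) (brk L n' m) \<nu> n \<in> part (tensor_free L) (\<nu>' + \<mu> + \<nu>)"
        "tens (\<nu> + \<mu>) (brk L n m) \<nu>' n' \<in> part (tensor_free L) (\<nu> + \<mu> + \<nu>')"
        by (intro tens_part L.brk_part brk_right)+
      then show ?thesis unfolding brk_right(1,2)
        by (intro exI[of _ "\<mu> + (\<nu> + \<nu>')"] conjI D S) (simp_all only: ac_simps)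
    next
      case (brk_brk m \<mu> n \<nu> m' \<mu>' n' \<nu>')
      have "brk (tensor_free L) (tens \<mu> m \<nu> n) (tens \<mu>' m' \<nu>' n') \<in> part (tensor_free L) (\<mu> + \<nu> + (\<mu>' + \<nu>'))"
        using brk_brk by (intro F.brk_part tens_part)
      moreover have
        "tens (\<nu> + \<mu>) (brk L n m) (\<mu>' + \<nu>') (brk L m' n') \<in> part (tensor_free L) (\<nu> + \<mu> + (\<mu>' + \<nu>'))"
        by (intro tens_part L.brk_part brk_brk)+
      ultimately show ?thesis unfolding brk_brk(1,2)
        by (intro exI[of _ "\<mu> + \<nu> + (\<mu>' + \<nu>')"] conjI N S) (simp_all only: ac_simps)
    }
  qed
  then show ?thesis using F.subspace_diff[OF F.part_subspace] by blast
qed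

theorem tensor_square_exists:
  fixes L :: "('k::field, 'v::ab_group_add) superalg"
  assumes L: "lie_superalgebra L"
  shows "\<exists>T :: ('k, 'v symbol monomial \<Rightarrow>\<^sub>0 'k) superalg. is_tensor_square L T"
proof -
  interpret F: superalgebra "tensor_free L :: ('k, _) superalg" by (rule superalgebra_free)
  let ?R = "lie_relators (tensor_free L) \<union> {u - v | u v. (u, v) \<in> tensor_relations L}"
  have J: "jacobiator (tensor_free L) \<alpha> x \<beta> y \<gamma> z \<in> part (tensor_free L) (\<alpha> + (\<beta> + \<gamma>))"
    if "x \<in> part (tensor_free L) \<alpha>" "y \<in> part (tensor_free L) \<beta>" "z \<in> part (tensor_free L) \<gamma>"
    for \<alpha> x \<beta> y \<gamma> z
    using F.brk_part[OF that(1) F.brk_part[OF that(2,3)]] F.brk_part[OF that(2) F.brk_part[OF that(3,1)]]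
      F.brk_part[OF that(3) F.brk_part[OF that(1,2)]]
    unfolding jacobiator_def
    by (intro F.subspace_add[OF F.part_subspace] F.subspace_scale[OF F.part_subspace]) (simp_all only: ac_simps)
  have S: "brk (tensor_free L) x y + scl (tensor_free L) (psign (\<alpha> * \<beta>)) (brk (tensor_free L) y x)
      \<in> part (tensor_free L) (\<alpha> + \<beta>)"
    if "x \<in> part (tensor_free L) \<alpha>" "y \<in> part (tensor_free L) \<beta>" for \<alpha> x \<beta> y
    using F.brk_part[OF that] F.brk_part[OF that(2,1)]
    by (intro F.subspace_add[OF F.part_subspace] F.subspace_scale[OF F.part_subspace]) (simp_all only: ac_simps)
  have R: "?R \<subseteq> (\<Union>\<alpha>. part (tensor_free L) \<alpha>)"
  proof (rule subsetI)
    fix w assume "w \<in> ?R"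
    then consider
      (skew) \<alpha> x \<beta> y where "x \<in> part (tensor_free L) \<alpha>" "y \<in> part (tensor_free L) \<beta>"
        "w = brk (tensor_free L) x y + scl (tensor_free L) (psign (\<alpha> * \<beta>)) (brk (tensor_free L) y x)"
    | (jac) \<alpha> x \<beta> y \<gamma> z where "x \<in> part (tensor_free L) \<alpha>" "y \<in> part (tensor_free L) \<beta>"
        "z \<in> part (tensor_free L) \<gamma>" "w = jacobiator (tensor_free L) \<alpha> x \<beta> y \<gamma> z"
    | (rel) u v where "(u, v) \<in> tensor_relations L" "w = u - v"
      unfolding lie_relators_def by fast
    then have "\<exists>\<alpha>. w \<in> part (tensor_free L) \<alpha>"
    proof cases
      case skew
      show ?thesis unfolding skew(3) by (rule exI, rule S[OF skew(1,2)])
    next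
      case jac
      show ?thesis unfolding jac(4) by (rule exI, rule J[OF jac(1-3)])
    next
      case rel
      show ?thesis unfolding rel(2) by (rule tensor_relations_part[OF L rel(1)])
    qed
    then show "w \<in> (\<Union>\<alpha>. part (tensor_free L) \<alpha>)" by blast
  qed
  then have "?R \<subseteq> carr (tensor_free L)" using F.part_carr by blast
  then have "lie_relators (tensor_free L) \<subseteq> ideal_gen (tensor_free L) ?R"
    using F.ideal_gen_ideal(2) by blast
  then show ?thesis
    unfolding is_tensor_square_def is_presented_def using F.quotient_exists[OF R] by blast
qed

end

theory Submission
  imports Defs
begin

text \<open>
  Write \<open>n = k + l\<close> and \<open>d = r + s\<close> for the total dimensions of \<open>L\<close> and \<open>L\<^sup>2\<close>.

  \<^emph>\<open>The bound.\<close>  Since \<open>L\<close> is nilpotent and not abelian, there are homogeneous \<open>a\<close>, \<open>b\<close> such that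
  \<open>w = [a, b]\<close> is not in \<open>L\<^sup>3\<close> (\<open>obtain_homogeneous_bracket\<close>).  Choose graded complements
  \<open>L = V \<oplus> L\<^sup>2\<close> and \<open>L\<^sup>2 = K \<oplus> \<langle>w\<rangle>\<close> with \<open>L\<^sup>3 \<subseteq> K\<close>.  Then \<open>V \<otimes> V\<close>, \<open>V \<otimes> K\<close> and the two tensors
  \<open>a \<otimes> w\<close>, \<open>b \<otimes> w\<close> span \<open>L \<otimes> L\<close> (\<open>spanning_set\<close>), which gives
  \<open>(n - d)\<^sup>2 + (n - d)(d - 1) + 2 = (n - d)(n - 1) + 2\<close>.  To see this, let \<open>S\<close> be the span.  The relation
  \<open>[p, q] \<otimes> x = p \<otimes> [q, x] \<mp> q \<otimes> [p, x]\<close> moves brackets to the right.  It yields \<open>L \<otimes> L\<^sup>i \<subseteq> S\<close> for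
  \<open>i \<ge> 3\<close> by descending induction, then \<open>L \<otimes> K \<subseteq> S\<close>, and then \<open>w \<otimes> v = a \<otimes> [b, v] \<mp> b \<otimes> [a, v] \<in> S\<close>
  for all \<open>v\<close>, because \<open>[a, v]\<close> and \<open>[b, v]\<close> are in \<open>K + \<langle>w\<rangle>\<close>.  Tensors with one factor in \<open>L\<^sup>2\<close> are
  skew (\<open>t_skew_bracket\<close>), so \<open>v \<otimes> w \<in> S\<close> as well.  Hence \<open>L \<otimes> L\<^sup>2 \<subseteq> S\<close>, then \<open>L\<^sup>2 \<otimes> L \<subseteq> S\<close>, and
  finally \<open>L \<otimes> L = S\<close>.

  \<^emph>\<open>Equality, for \<open>L\<^sup>2\<close> of superdimension \<open>(1 | 0)\<close>.\<close>  If the bound is attained then \<open>a \<otimes> w\<close> and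
  \<open>b \<otimes> w\<close> are nonzero and distinct whenever \<open>w = [a, b] \<noteq> 0\<close>.  This forces all odd elements to be
  central and the even elements commuting with \<open>a\<close> and \<open>b\<close> to be central too
  (\<open>heisenberg_abelian_if_bound_attained\<close>), so \<open>a\<close>, \<open>b\<close>, \<open>w\<close> span a direct summand \<open>H(1,0)\<close> with
  abelian complement (\<open>heisenberg_abelian_iso\<close>).  Conversely, for \<open>H(1,0) \<oplus> A(m | n)\<close> there are
  \<open>(m + n + 2)\<^sup>2 + 2\<close> bilinear forms which respect the relations and are dual to tensors of basis
  vectors; these tensors are therefore linearly independent (\<open>total_dim_heisenberg_abelian\<close>).
\<close>

section \<open>Graded linear algebra\<close>

lemma (in vector_space) independent_family:
  assumes fin: "finite P"
    and ind: "\<And>c p. \<lbrakk>(\<Sum>q\<in>P. scale (c q) (v q)) = 0; p \<in> P\<rbrakk> \<Longrightarrow> c p = 0"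
  shows "inj_on v P" and "independent (v ` P)"
proof -
  show inj: "inj_on v P"
  proof (rule inj_onI, rule ccontr)
    fix p q assume pq: "p \<in> P" "q \<in> P" "v p = v q" "p \<noteq> q"
    let ?c = "\<lambda>x. if x = p then 1 else if x = q then - 1 else 0"
    have "(\<Sum>x\<in>P. scale (?c x) (v x)) = (\<Sum>x\<in>{p, q}. scale (?c x) (v x))"
      using pq fin by (intro sum.mono_neutral_right) auto
    also have "\<dots> = 0" using pq by simp
    finally show False using ind[of ?c p] pq(1) by simp
  qed
  show "independent (v ` P)"
  proof
    assume "dependent (v ` P)"
    then obtain u x where x: "x \<in> v ` P" "u x \<noteq> 0" and u: "(\<Sum>x\<in>v ` P. scale (u x) x) = 0"
      unfolding dependent_finite[OF finite_imageI[OF fin]] by blast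
    obtain p where p: "p \<in> P" "x = v p" using x(1) by blast
    have "(\<Sum>q\<in>P. scale (u (v q)) (v q)) = 0" using u by (simp add: sum.reindex[OF inj])
    then show False using ind[of "\<lambda>q. u (v q)" p] p x(2) by simp
  qed
qed

lemma (in vector_space) span_image_finite:
  assumes "finite I" and "x \<in> span (e ` I)"
  obtains c where "x = (\<Sum>i\<in>I. scale (c i) (e i))"
proof -
  let ?S = "range (\<lambda>c. \<Sum>i\<in>I. scale (c i) (e i))"
  have "subspace ?S"
  proof (rule subspaceI)
    show "0 \<in> ?S" by (rule range_eqI[of _ _ "\<lambda>_. 0"]) simp
    show "x + y \<in> ?S" if "x \<in> ?S" "y \<in> ?S" for x y
    proof -
      obtain c d where "x = (\<Sum>i\<in>I. scale (c i) (e i))" "y = (\<Sum>i\<in>I. scale (d i) (e i))"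
        using \<open>x \<in> ?S\<close> \<open>y \<in> ?S\<close> by blast
      then show ?thesis
        by (intro range_eqI[of _ _ "\<lambda>i. c i + d i"]) (simp add: scale_left_distrib sum.distrib)
    qed
    show "scale a x \<in> ?S" if "x \<in> ?S" for a x
    proof -
      obtain c where "x = (\<Sum>i\<in>I. scale (c i) (e i))" using \<open>x \<in> ?S\<close> by blast
      then show ?thesis
        by (intro range_eqI[of _ _ "\<lambda>i. a * c i"]) (simp add: scale_sum_right)
    qed
  qed
  moreover have "e ` I \<subseteq> ?S"
  proof
    fix y assume "y \<in> e ` I"
    then obtain j where j: "j \<in> I" "y = e j" by blast
    have "(\<Sum>i\<in>I. scale (if i = j then 1 else 0) (e i)) = (\<Sum>i\<in>I. if i = j then e j else 0)"
      by (intro sum.cong) auto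
    also have "\<dots> = e j" using j assms(1) by (simp add: sum.delta)
    finally show "y \<in> ?S" unfolding j(2)
      by (intro range_eqI[of _ _ "\<lambda>i. if i = j then 1 else 0"]) (rule sym)
  qed
  ultimately have "span (e ` I) \<subseteq> ?S" by (rule span_minimal[rotated])
  then show ?thesis using assms(2) that by blast
qed

context superalgebra
begin

lemma finite_dim_basis:
  assumes fd: "finite_dim A" and B: "independent B" "B \<subseteq> carr A"
  shows "finite B"
proof -
  obtain C where "finite C" "carr A \<subseteq> span C" using fd unfolding finite_dim_def by blast
  then show ?thesis using independent_span_bound[of C B] B by blast
qed

lemma hcomp_zero: "hcomp \<alpha> 0 = 0"
  by (rule hcomp_same[OF zero_part])

lemma total_dim_le:
  assumes fin: "finite G" and G: "G \<subseteq> part A 0 \<union> part A 1" and sp: "carr A \<subseteq> span G"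
  shows "finite_dim A" and "total_dim A \<le> card (G - {0})"
proof -
  show "finite_dim A" unfolding finite_dim_def using fin sp by blast
  have part_span: "part A \<alpha> \<subseteq> span (G \<inter> part A \<alpha> - {0})" for \<alpha>
  proof
    fix x assume x: "x \<in> part A \<alpha>"
    let ?S = "{x \<in> carr A. hcomp \<alpha> x \<in> span (G \<inter> part A \<alpha>)}"
    have "subspace ?S"
      using subspace_carr
      by (auto simp: subspace_def hcomp_zero hcomp_add hcomp_scl intro: span_zero span_add span_scale)
    moreover have "G \<subseteq> ?S"
    proof
      fix g assume g: "g \<in> G"
      then obtain \<beta> where \<beta>: "g \<in> part A \<beta>" using G by blast
      show "g \<in> ?S"
        using g \<beta> part_carr[OF \<beta>] hcomp_same[OF \<beta>] hcomp_other[OF \<beta>]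
        by (cases "\<beta> = \<alpha>") (auto intro: span_base span_zero)
    qed
    ultimately have "span G \<subseteq> ?S" by (rule span_minimal[rotated])
    then have "hcomp \<alpha> x \<in> span (G \<inter> part A \<alpha>)" using sp part_carr[OF x] by blast
    then show "x \<in> span (G \<inter> part A \<alpha> - {0})" using hcomp_same[OF x] by simp
  qed
  have "total_dim A \<le> card (G \<inter> part A 0 - {0}) + card (G \<inter> part A 1 - {0})"
    unfolding total_dim_def using fin by (intro add_mono dim_le_card part_span) auto
  also have "\<dots> = card ((G \<inter> part A 0 - {0}) \<union> (G \<inter> part A 1 - {0}))"
    using fin part_Int by (intro card_Un_disjoint[symmetric]) auto
  also have "\<dots> \<le> card (G - {0})" using fin by (intro card_mono) auto
  finally show "total_dim A \<le> card (G - {0})" .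
qed

lemma card_le_total_dim:
  assumes fd: "finite_dim A" and S: "independent S" "S \<subseteq> carr A"
  shows "card S \<le> total_dim A"
proof -
  have "\<exists>B. B \<subseteq> part A \<alpha> \<and> independent B \<and> part A \<alpha> \<subseteq> span B \<and> card B = dim (part A \<alpha>)" for \<alpha>
    using basis_exists[of "part A \<alpha>"] by metis
  then obtain B where B: "\<And>\<alpha>. B \<alpha> \<subseteq> part A \<alpha>" "\<And>\<alpha>. independent (B \<alpha>)" "\<And>\<alpha>. part A \<alpha> \<subseteq> span (B \<alpha>)"
    "\<And>\<alpha>. card (B \<alpha>) = dim (part A \<alpha>)"
    by metis
  have "finite (B \<alpha>)" for \<alpha> using finite_dim_basis[OF fd B(2)] B(1) part_carr by blast
  moreover have "carr A \<subseteq> span (B 0 \<union> B 1)"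
    unfolding carr_def using B(3) span_mono[of "B 0" "B 0 \<union> B 1"] span_mono[of "B 1" "B 0 \<union> B 1"]
    by (auto intro!: span_add)
  ultimately have "card S \<le> card (B 0 \<union> B 1)"
    using independent_span_bound[of "B 0 \<union> B 1" S] S by (meson finite_UnI order_trans)
  also have "\<dots> \<le> total_dim A" unfolding total_dim_def B(4)[symmetric] by (rule card_Un_le)
  finally show ?thesis .
qed

section \<open>Homogeneous generators of the lower central series\<close>

text \<open>Subspaces of the carrier that contain the homogeneous components of their elements.\<close>

definition graded :: "'v set \<Rightarrow> bool" where
  "graded X \<longleftrightarrow> subspace X \<and> X \<subseteq> carr A \<and> (\<forall>x\<in>X. \<forall>\<alpha>. hcomp \<alpha> x \<in> X)"

lemma brk_span_hcomp:
  assumes X: "graded X" and Y: "graded Y" and x: "x \<in> brk_span A X Y"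
  shows "x \<in> carr A"
    and "hcomp \<mu> x \<in> span {brk A p q | \<alpha> \<beta> p q. \<alpha> + \<beta> = \<mu> \<and> p \<in> X \<inter> part A \<alpha> \<and> q \<in> Y \<inter> part A \<beta>}"
proof -
  let ?H = "\<lambda>\<mu>. span {brk A p q | \<alpha> \<beta> p q. \<alpha> + \<beta> = \<mu> \<and> p \<in> X \<inter> part A \<alpha> \<and> q \<in> Y \<inter> part A \<beta>}"
  let ?S = "{x \<in> carr A. hcomp \<mu> x \<in> ?H \<mu>}"
  have "subspace ?S"
    using subspace_carr
    by (auto simp: subspace_def hcomp_zero hcomp_add hcomp_scl intro: span_zero span_add span_scale)
  moreover have "{brk A p q | p q. p \<in> X \<and> q \<in> Y} \<subseteq> ?S"
  proof clarify
    fix p q assume p: "p \<in> X" and q: "q \<in> Y"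
    have pc: "p \<in> carr A" and qc: "q \<in> carr A" using p q X Y by (auto simp: graded_def)
    have "hcomp \<alpha> p \<in> X \<inter> part A \<alpha>" "hcomp \<alpha> q \<in> Y \<inter> part A \<alpha>" for \<alpha>
      using p q X Y hcomp_part[OF pc] hcomp_part[OF qc] by (auto simp: graded_def)
    moreover have "0 + \<mu> = \<mu>" "1 + (1 + \<mu>) = \<mu>" by (cases \<mu>; simp)+
    ultimately have "brk A (hcomp 0 p) (hcomp \<mu> q) \<in> ?H \<mu>"
      "brk A (hcomp 1 p) (hcomp (1 + \<mu>) q) \<in> ?H \<mu>"
      by (blast intro: span_base)+
    then show "brk A p q \<in> carr A \<and> hcomp \<mu> (brk A p q) \<in> ?H \<mu>"
      unfolding hcomp_brk[OF pc qc] using brk_carr[OF pc qc] by (blast intro: span_add)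
  qed
  ultimately have "brk_span A X Y \<subseteq> ?S" unfolding brk_span_def by (rule span_minimal[rotated])
  then show "x \<in> carr A" "hcomp \<mu> x \<in> ?H \<mu>" using x by blast+
qed

lemma graded_carr: "graded (carr A)"
  unfolding graded_def using subspace_carr hcomp_part part_carr by blast

lemma graded_brk_span: "graded X \<Longrightarrow> graded Y \<Longrightarrow> graded (brk_span A X Y)"
  unfolding graded_def[of "brk_span A X Y"]
proof (intro conjI ballI allI subsetI)
  assume XY: "graded X" "graded Y"
  show "subspace (brk_span A X Y)" unfolding brk_span_def by (rule subspace_span)
  fix x assume x: "x \<in> brk_span A X Y"
  show "x \<in> carr A" by (rule brk_span_hcomp(1)[OF XY x])
  fix \<alpha>
  have "{brk A p q | \<beta> \<gamma> p q. \<beta> + \<gamma> = \<alpha> \<and> p \<in> X \<inter> part A \<beta> \<and> q \<in> Y \<inter> part A \<gamma>}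
    \<subseteq> {brk A p q | p q. p \<in> X \<and> q \<in> Y}" by blast
  from span_mono[OF this] show "hcomp \<alpha> x \<in> brk_span A X Y"
    unfolding brk_span_def[of A X Y] using brk_span_hcomp(2)[OF XY x, of \<alpha>] by blast
qed

lemma graded_lower_central: "graded (lower_central A n)"
  by (induction n) (simp_all add: graded_carr graded_brk_span)

lemma lower_central_part_Suc:
  assumes "x \<in> part A \<mu>" "x \<in> lower_central A (Suc n)"
  shows "x \<in> span {brk A p q | \<alpha> \<beta> p q.
    \<alpha> + \<beta> = \<mu> \<and> p \<in> part A \<alpha> \<and> q \<in> lower_central A n \<inter> part A \<beta>}"
proof -
  have "x \<in> span {brk A p q | \<alpha> \<beta> p q. \<alpha> + \<beta> = \<mu> \<and> p \<in> carr A \<inter> part A \<alpha> \<and> q \<in> lower_central A n \<inter> part A \<beta>}"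
    using brk_span_hcomp(2)[OF graded_carr graded_lower_central[of n], of x \<mu>] assms
    by (simp add: hcomp_same)
  moreover have "carr A \<inter> part A \<alpha> = part A \<alpha>" for \<alpha> using part_carr by blast
  ultimately show ?thesis by simp
qed

lemma brk_lower_central:
  "\<lbrakk>x \<in> carr A; y \<in> lower_central A n\<rbrakk> \<Longrightarrow> brk A x y \<in> lower_central A (Suc n)"
  unfolding lower_central.simps brk_span_def by (blast intro: span_base)

lemma subspace_lower_central: "subspace (lower_central A n)"
  using graded_lower_central graded_def by blast

lemma brk_span_mono: "X \<subseteq> X' \<Longrightarrow> Y \<subseteq> Y' \<Longrightarrow> brk_span A X Y \<subseteq> brk_span A X' Y'"
  unfolding brk_span_def by (rule span_mono) blast

lemma lower_central_Suc_subset: "lower_central A (Suc n) \<subseteq> lower_central A n"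
proof (induction n)
  case 0
  then show ?case using graded_lower_central[of 1] by (simp add: graded_def)
next
  case (Suc n)
  then show ?case using brk_span_mono[OF order_refl Suc] by simp
qed

lemma lower_central_mono: "m \<le> n \<Longrightarrow> lower_central A n \<subseteq> lower_central A m"
  using lower_central_Suc_subset by (rule lift_Suc_antimono_le)

text \<open>A nilpotent algebra with \<open>L\<^sup>2 = L\<^sup>3\<close> is abelian, so in a non-abelian one some bracket of
  homogeneous elements lies outside \<open>L\<^sup>3\<close>, which is term \<open>2\<close> of the series counted from \<open>0\<close>.\<close>

lemma obtain_homogeneous_bracket:
  assumes "nilpotent A" "\<not> abelian A"
  obtains \<alpha> \<beta> a b where "a \<in> part A \<alpha>" "b \<in> part A \<beta>" "brk A a b \<notin> lower_central A 2"
proof (rule ccontr)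
  note obt = that
  assume "\<not> thesis"
  then have all: "brk A a b \<in> lower_central A 2" if "a \<in> part A \<alpha>" "b \<in> part A \<beta>" for \<alpha> \<beta> a b
    using obt that by blast
  have "brk A x y \<in> lower_central A 2" if "x \<in> carr A" "y \<in> carr A" for x y
  proof -
    have c: "hcomp \<alpha> x \<in> carr A" "hcomp \<alpha> y \<in> carr A" for \<alpha>
      using that hcomp_part part_carr by blast+
    have "brk A x y = brk A (hcomp 0 x + hcomp 1 x) (hcomp 0 y + hcomp 1 y)"
      using that hcomp_decomp by simp
    also have "\<dots> = brk A (hcomp 0 x) (hcomp 0 y) + brk A (hcomp 0 x) (hcomp 1 y)
       + (brk A (hcomp 1 x) (hcomp 0 y) + brk A (hcomp 1 x) (hcomp 1 y))"
      using c by (simp add: brk_add_left brk_add_right subspace_add[OF subspace_carr])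
    finally show ?thesis
      using that by (simp add: subspace_add[OF subspace_lower_central] all[OF hcomp_part hcomp_part])
  qed
  then have 1: "lower_central A 1 \<subseteq> lower_central A 2"
    unfolding One_nat_def lower_central.simps brk_span_def[of A "carr A" "carr A"]
    by (intro span_minimal subspace_lower_central) blast
  have "lower_central A 1 \<subseteq> lower_central A (Suc n)" for n
  proof (induction n)
    case (Suc n)
    have "lower_central A 2 \<subseteq> lower_central A (Suc (Suc n))"
      using brk_span_mono[OF order_refl Suc] by (simp add: numeral_2_eq_2)
    then show ?case using 1 by blast
  qed simp
  moreover obtain n where "lower_central A n = {0}" using assms(1) nilpotent_def by blast
  ultimately have "lower_central A 1 \<subseteq> {0}" using lower_central_Suc_subset[of n] by blast
  moreover have "brk A x y \<in> lower_central A 1" if "x \<in> carr A" "y \<in> carr A" for x y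
    using brk_lower_central[of x y 0] that by simp
  ultimately show False using assms(2) unfolding abelian_def by blast
qed

end

section \<open>The spanning set of the tensor square\<close>

lemma psign_simps [simp]: "psign 0 = 1" "psign 1 = - 1"
  by (simp_all add: psign_def)

text \<open>
  \<open>t \<mu> m \<nu> n\<close> stands for \<open>m \<otimes> n\<close>, where \<open>\<mu>\<close>, \<open>\<nu>\<close> are the degrees of \<open>m\<close>, \<open>n\<close>: a pairing on
  homogeneous elements of \<open>L\<close> that satisfies the defining relations of the tensor square and whose
  values span \<open>T\<close> as a vector space.
\<close>

locale tensor_pairing = L: lie_superalgebra L + T: lie_superalgebra T
  for L :: "('k::field, 'a::ab_group_add) superalg" and T :: "('k, 'b::ab_group_add) superalg" +
  fixes t :: "bit \<Rightarrow> 'a \<Rightarrow> bit \<Rightarrow> 'a \<Rightarrow> 'b"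
  assumes t_part: "\<lbrakk>m \<in> part L \<mu>; n \<in> part L \<nu>\<rbrakk> \<Longrightarrow> t \<mu> m \<nu> n \<in> part T (\<mu> + \<nu>)"
    and t_scl_left: "\<lbrakk>m \<in> part L \<mu>; n \<in> part L \<nu>\<rbrakk> \<Longrightarrow> t \<mu> (scl L c m) \<nu> n = scl T c (t \<mu> m \<nu> n)"
    and t_scl_right: "\<lbrakk>m \<in> part L \<mu>; n \<in> part L \<nu>\<rbrakk> \<Longrightarrow> t \<mu> m \<nu> (scl L c n) = scl T c (t \<mu> m \<nu> n)"
    and t_add_left: "\<lbrakk>m \<in> part L \<mu>; m' \<in> part L \<mu>; n \<in> part L \<nu>\<rbrakk> \<Longrightarrow>
      t \<mu> (m + m') \<nu> n = t \<mu> m \<nu> n + t \<mu> m' \<nu> n"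
    and t_add_right: "\<lbrakk>m \<in> part L \<mu>; n \<in> part L \<nu>; n' \<in> part L \<nu>\<rbrakk> \<Longrightarrow>
      t \<mu> m \<nu> (n + n') = t \<mu> m \<nu> n + t \<mu> m \<nu> n'"
    and t_brk_left: "\<lbrakk>m \<in> part L \<mu>; m' \<in> part L \<mu>'; n \<in> part L \<nu>\<rbrakk> \<Longrightarrow>
      t (\<mu> + \<mu>') (brk L m m') \<nu> n =
        t \<mu> m (\<mu>' + \<nu>) (brk L m' n) - scl T (psign (\<mu> * \<mu>')) (t \<mu>' m' (\<mu> + \<nu>) (brk L m n))"
    and t_brk_right: "\<lbrakk>m \<in> part L \<mu>; n \<in> part L \<nu>; n' \<in> part L \<nu>'\<rbrakk> \<Longrightarrow>
      t \<mu> m (\<nu> + \<nu>') (brk L n n') =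
        scl T (psign (\<nu>' * (\<mu> + \<nu>))) (t (\<nu>' + \<mu>) (brk L n' m) \<nu> n)
        - scl T (psign (\<mu> * \<nu>)) (t (\<nu> + \<mu>) (brk L n m) \<nu>' n')"
    and t_span: "carr T \<subseteq> T.span {t \<mu> m \<nu> n | \<mu> m \<nu> n. m \<in> part L \<mu> \<and> n \<in> part L \<nu>}"
begin

lemma t_zero_left: "n \<in> part L \<nu> \<Longrightarrow> t \<mu> 0 \<nu> n = 0"
  using t_scl_left[of 0 \<mu> n \<nu> 0] L.zero_part by simp

lemma t_zero_right: "m \<in> part L \<mu> \<Longrightarrow> t \<mu> m \<nu> 0 = 0"
  using t_scl_right[of m \<mu> 0 \<nu> 0] L.zero_part by simp

lemma t_left_mem:
  assumes S: "T.subspace S" and M: "M \<subseteq> part L \<mu>" and n: "n \<in> part L \<nu>" and m: "m \<in> L.span M"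
    and gen: "\<And>x. x \<in> M \<Longrightarrow> t \<mu> x \<nu> n \<in> S"
  shows "t \<mu> m \<nu> n \<in> S"
proof -
  have "L.subspace {m \<in> part L \<mu>. t \<mu> m \<nu> n \<in> S}"
    using n L.part_subspace[of \<mu>] S
    by (auto simp: L.subspace_def T.subspace_def t_zero_left t_add_left t_scl_left)
  moreover have "M \<subseteq> {m \<in> part L \<mu>. t \<mu> m \<nu> n \<in> S}" using M gen by blast
  ultimately show ?thesis using L.span_minimal m by blast
qed

lemma t_right_mem:
  assumes S: "T.subspace S" and N: "N \<subseteq> part L \<nu>" and m: "m \<in> part L \<mu>" and n: "n \<in> L.span N"
    and gen: "\<And>x. x \<in> N \<Longrightarrow> t \<mu> m \<nu> x \<in> S"
  shows "t \<mu> m \<nu> n \<in> S"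
proof -
  have "L.subspace {n \<in> part L \<nu>. t \<mu> m \<nu> n \<in> S}"
    using m L.part_subspace[of \<nu>] S
    by (auto simp: L.subspace_def T.subspace_def t_zero_right t_add_right t_scl_right)
  moreover have "N \<subseteq> {n \<in> part L \<nu>. t \<mu> m \<nu> n \<in> S}" using N gen by blast
  ultimately show ?thesis using L.span_minimal n by blast
qed

text \<open>
  The tensor of an element of \<open>L\<^sup>2\<close> with any element is skew in the graded sense.  Let \<open>f a b v\<close> be
  the sum of \<open>[a, b] \<otimes> v\<close> and \<open>(- 1)\<^bsup>|v|(|a| + |b|)\<^esup> v \<otimes> [a, b]\<close>.  Expanding both summands by the
  relations for brackets gives \<open>g a b v = g b v a + g v a b\<close>, where \<open>g a b v = (- 1)\<^bsup>|a||v|\<^esup> f a b v\<close>.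
  Two cyclic permutations of this identity, namely \<open>g b v a = g v a b + g a b v\<close> and
  \<open>g v a b = g a b v + g b v a\<close>, add up to \<open>2 g a b v = 0\<close>.
\<close>

lemma t_skew_bracket:
  assumes char: "(2::'k) \<noteq> 0" and a: "a \<in> part L \<alpha>" and b: "b \<in> part L \<beta>" and v: "v \<in> part L \<gamma>"
  shows "t \<gamma> v (\<alpha> + \<beta>) (brk L a b) = - scl T (psign (\<gamma> * (\<alpha> + \<beta>))) (t (\<alpha> + \<beta>) (brk L a b) \<gamma> v)"
proof -
  define f where "f \<alpha> a \<beta> b \<gamma> v = t (\<alpha> + \<beta>) (brk L a b) \<gamma> v
     + scl T (psign (\<gamma> * (\<alpha> + \<beta>))) (t \<gamma> v (\<alpha> + \<beta>) (brk L a b))" for \<alpha> a \<beta> b \<gamma> v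
  define g where "g \<alpha> a \<beta> b \<gamma> v = scl T (psign (\<alpha> * \<gamma>)) (f \<alpha> a \<beta> b \<gamma> v)" for \<alpha> a \<beta> b \<gamma> v
  have cyc: "g \<alpha> a \<beta> b \<gamma> v = g \<beta> b \<gamma> v \<alpha> a + g \<gamma> v \<alpha> a \<beta> b"
    if a: "a \<in> part L \<alpha>" and b: "b \<in> part L \<beta>" and v: "v \<in> part L \<gamma>" for \<alpha> a \<beta> b \<gamma> v
  proof -
    have av: "brk L a v = scl L (- psign (\<alpha> * \<gamma>)) (brk L v a)"
      using L.skew[OF a v] by simp
    have va: "brk L v a \<in> part L (\<alpha> + \<gamma>)" "brk L v a \<in> part L (\<gamma> + \<alpha>)"
      using L.brk_part[OF v a] by (simp_all only: add.commute[of \<gamma> \<alpha>])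
    have 1: "t (\<alpha> + \<beta>) (brk L a b) \<gamma> v = t \<alpha> a (\<beta> + \<gamma>) (brk L b v)
        + scl T (psign (\<alpha> * \<beta>) * psign (\<alpha> * \<gamma>)) (t \<beta> b (\<gamma> + \<alpha>) (brk L v a))"
      unfolding t_brk_left[OF a b v] av t_scl_right[OF b va(1)] add.commute[of \<gamma> \<alpha>] by simp
    have 2: "t \<gamma> v (\<alpha> + \<beta>) (brk L a b) =
        scl T (psign (\<beta> * (\<gamma> + \<alpha>))) (t (\<beta> + \<gamma>) (brk L b v) \<alpha> a)
        + scl T (psign (\<gamma> * \<alpha>) * psign (\<alpha> * \<gamma>)) (t (\<gamma> + \<alpha>) (brk L v a) \<beta> b)"
      unfolding t_brk_right[OF v a b] av t_scl_left[OF va(1) b] add.commute[of \<gamma> \<alpha>] by simp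
    show ?thesis
      unfolding g_def f_def 1 2
      by (cases \<alpha>; cases \<beta>; cases \<gamma>) (simp_all add: T.scale_right_distrib)
  qed
  have "g \<alpha> a \<beta> b \<gamma> v + g \<alpha> a \<beta> b \<gamma> v = 0"
    using cyc[OF b v a] cyc[OF v a b] by simp
  then have "scl T 2 (g \<alpha> a \<beta> b \<gamma> v) = 0"
    using T.scale_left_distrib[of 1 1 "g \<alpha> a \<beta> b \<gamma> v"] by simp
  then have "g \<alpha> a \<beta> b \<gamma> v = 0" using char by simp
  then have "f \<alpha> a \<beta> b \<gamma> v = 0" unfolding g_def by (simp add: psign_def split: if_splits)
  then have "scl T (psign (\<gamma> * (\<alpha> + \<beta>))) (f \<alpha> a \<beta> b \<gamma> v) = 0" by simp
  then show ?thesis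
    unfolding f_def by (cases \<alpha>; cases \<beta>; cases \<gamma>) (simp_all add: T.scale_right_distrib add_eq_0_iff)
qed

text \<open>
  \<open>V\<close> and \<open>L\<^sup>2\<close> together span \<open>L\<close>, and \<open>K\<close> and \<open>w = [a, b]\<close> together span \<open>L\<^sup>2\<close>, where the span of
  \<open>K\<close> contains \<open>L\<^sup>3\<close>.  Directness of these sums is not needed.  As \<^const>\<open>lower_central\<close> counts
  from \<open>0\<close>, the indices \<open>1\<close> and \<open>2\<close> stand for \<open>L\<^sup>2\<close> and \<open>L\<^sup>3\<close>.
\<close>

lemma spanning_set:
  fixes V K :: "bit \<Rightarrow> 'a set"
  assumes char: "(2::'k) \<noteq> 0" and nil: "lower_central L N = {0}"
    and a: "a \<in> part L \<alpha>" and b: "b \<in> part L \<beta>"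
    and V: "\<And>\<mu>. V \<mu> \<subseteq> part L \<mu>"
    and VD: "\<And>\<mu> x. x \<in> part L \<mu> \<Longrightarrow> \<exists>v \<in> L.span (V \<mu>). x - v \<in> lower_central L 1"
    and K: "\<And>\<mu>. K \<mu> \<subseteq> part L \<mu> \<inter> lower_central L 1"
    and KD: "\<And>\<mu> x. \<lbrakk>x \<in> part L \<mu>; x \<in> lower_central L 1\<rbrakk> \<Longrightarrow>
      \<exists>c. x - scl L c (brk L a b) \<in> L.span (K \<mu>) \<and> scl L c (brk L a b) \<in> part L \<mu>"
    and KE: "\<And>\<mu>. part L \<mu> \<inter> lower_central L 2 \<subseteq> L.span (K \<mu>)"
  shows "carr T \<subseteq> T.span ({t \<mu> v \<nu> u | \<mu> v \<nu> u. v \<in> V \<mu> \<and> u \<in> V \<nu> \<union> K \<nu>}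
    \<union> {t \<alpha> a (\<alpha> + \<beta>) (brk L a b), t \<beta> b (\<alpha> + \<beta>) (brk L a b)})"
    (is "_ \<subseteq> T.span ?G")
proof -
  define w where "w = brk L a b"
  have w: "w \<in> part L (\<alpha> + \<beta>)" unfolding w_def using a b by (rule L.brk_part)
  define S where "S = T.span ?G"
  have S: "T.subspace S" unfolding S_def by simp
  note S_add = T.subspace_add[OF S] and S_diff = T.subspace_diff[OF S]
    and S_scl = T.subspace_scale[OF S] and S_neg = T.subspace_neg[OF S]
  have GV: "t \<mu> v \<nu> u \<in> S" if "v \<in> V \<mu>" "u \<in> V \<nu> \<union> K \<nu>" for \<mu> v \<nu> u
    unfolding S_def using that by (intro T.span_base) blast
  have Ga: "t \<alpha> a (\<alpha> + \<beta>) w \<in> S" and Gb: "t \<beta> b (\<alpha> + \<beta>) w \<in> S"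
    unfolding S_def w_def by (auto intro: T.span_base)
  note part_diff = L.subspace_diff[OF L.part_subspace]
  have Kp: "K \<mu> \<subseteq> part L \<mu>" for \<mu> using K by blast
  have spanV: "L.span (V \<mu>) \<subseteq> part L \<mu>" for \<mu>
    using L.span_minimal[OF V L.part_subspace] .
  have spanK: "L.span (K \<mu>) \<subseteq> part L \<mu> \<inter> lower_central L 1" for \<mu>
    using L.span_minimal[OF K L.subspace_inter[OF L.part_subspace L.subspace_lower_central]] .
  \<comment> \<open>A property of left factors may be checked on \<open>V\<close> and on brackets.\<close>
  have left: "t \<mu> m \<nu> n \<in> S"
    if m: "m \<in> part L \<mu>" and n: "n \<in> part L \<nu>"
      and onV: "\<And>v. v \<in> V \<mu> \<Longrightarrow> t \<mu> v \<nu> n \<in> S"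
      and onB: "\<And>p q \<kappa> \<tau>. \<lbrakk>p \<in> part L \<kappa>; q \<in> part L \<tau>; \<kappa> + \<tau> = \<mu>\<rbrakk> \<Longrightarrow> t \<mu> (brk L p q) \<nu> n \<in> S"
    for \<mu> m \<nu> n
  proof -
    obtain v where v: "v \<in> L.span (V \<mu>)" "m - v \<in> lower_central L 1" using VD[OF m] by blast
    have vp: "v \<in> part L \<mu>" using v(1) spanV by blast
    have x: "m - v \<in> part L \<mu>" using part_diff[OF m vp] .
    have "t \<mu> v \<nu> n \<in> S" by (rule t_left_mem[OF S V n v(1) onV])
    moreover have "t \<mu> (m - v) \<nu> n \<in> S"
    proof (rule t_left_mem[OF S _ n])
      show "m - v \<in> L.span {brk L p q | \<kappa> \<tau> p q. \<kappa> + \<tau> = \<mu> \<and> p \<in> part L \<kappa> \<and> q \<in> lower_central L 0 \<inter> part L \<tau>}"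
        using L.lower_central_part_Suc[OF x, of 0] v(2) by simp
    qed (use L.brk_part onB in blast)+
    ultimately show ?thesis using S_add t_add_left[OF vp x n] by fastforce
  qed
  \<comment> \<open>\<open>L \<otimes> L\<^sup>i\<^sup>+\<^sup>1\<close> lies in \<open>S\<close> for \<open>i \<ge> 2\<close>, by descending induction on \<open>i\<close> from \<open>N\<close>.\<close>
  have "\<forall>i\<ge>2. N \<le> i + d \<longrightarrow> (\<forall>\<mu> m \<nu> n. m \<in> part L \<mu> \<longrightarrow> n \<in> part L \<nu> \<inter> lower_central L i \<longrightarrow>
      t \<mu> m \<nu> n \<in> S)" for d
  proof (induction d)
    case 0
    then show ?case
      using nil L.lower_central_mono t_zero_right T.subspace_0[OF S] by (metis IntD2 add_0_right singletonD subsetD)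
  next
    case (Suc d)
    show ?case
    proof (intro allI impI)
      fix i \<mu> m \<nu> n
      assume i: "2 \<le> i" "N \<le> i + Suc d" and m: "m \<in> part L \<mu>" and n: "n \<in> part L \<nu> \<inter> lower_central L i"
      have IH: "t \<mu> m \<nu> n \<in> S" if "m \<in> part L \<mu>" "n \<in> part L \<nu>" "n \<in> lower_central L (Suc i)" for \<mu> m \<nu> n
        using Suc.IH[rule_format, of "Suc i"] i that by simp
      have np: "n \<in> part L \<nu>" using n by blast
      show "t \<mu> m \<nu> n \<in> S"
      proof (rule left[OF m np])
        fix v assume v: "v \<in> V \<mu>"
        have "n \<in> L.span (K \<nu>)" using n KE L.lower_central_mono[OF i(1)] by blast
        then show "t \<mu> v \<nu> n \<in> S"
          by (rule t_right_mem[OF S Kp subsetD[OF V v] _ GV[OF v UnI2]])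
      next
        fix p q \<kappa> \<tau> assume pq: "p \<in> part L \<kappa>" "q \<in> part L \<tau>" "\<kappa> + \<tau> = \<mu>"
        have "t (\<kappa> + \<tau>) (brk L p q) \<nu> n \<in> S"
          unfolding t_brk_left[OF pq(1,2) np] using n L.part_carr[OF pq(1)] L.part_carr[OF pq(2)]
          by (intro S_diff S_scl IH L.brk_part L.brk_lower_central pq(1,2)) auto
        then show "t \<mu> (brk L p q) \<nu> n \<in> S" using pq(3) by simp
      qed
    qed
  qed
  from this[of N] have L3: "t \<mu> m \<nu> n \<in> S"
    if "m \<in> part L \<mu>" "n \<in> part L \<nu>" "n \<in> lower_central L 2" for \<mu> m \<nu> n
    using that by (metis IntI le_add2 order_refl)
  have LK: "t \<mu> m \<nu> n \<in> S" if m: "m \<in> part L \<mu>" and n: "n \<in> L.span (K \<nu>)" for \<mu> m \<nu> n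
  proof -
    have n1: "n \<in> part L \<nu>" "n \<in> lower_central L (Suc 0)" using n spanK by auto
    show ?thesis
    proof (rule left[OF m n1(1)])
      show "t \<mu> v \<nu> n \<in> S" if "v \<in> V \<mu>" for v
        by (rule t_right_mem[OF S Kp subsetD[OF V that] n GV[OF that UnI2]])
      fix p q \<kappa> \<tau> assume pq: "p \<in> part L \<kappa>" "q \<in> part L \<tau>" "\<kappa> + \<tau> = \<mu>"
      have "t (\<kappa> + \<tau>) (brk L p q) \<nu> n \<in> S"
        unfolding t_brk_left[OF pq(1,2) n1(1)] numeral_2_eq_2
        using L.part_carr[OF pq(1)] L.part_carr[OF pq(2)]
        by (intro S_diff S_scl L3[unfolded numeral_2_eq_2] L.brk_part L.brk_lower_central pq(1,2) n1)
      then show "t \<mu> (brk L p q) \<nu> n \<in> S" using pq(3) by simp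
    qed
  qed
  \<comment> \<open>\<open>L\<^sup>2\<close> is spanned by \<open>K\<close> and \<open>w\<close>, so \<open>m \<otimes> L\<^sup>2\<close> is in \<open>S\<close> as soon as \<open>m \<otimes> w\<close> is.\<close>
  have Lw': "t \<mu> m \<nu> n \<in> S"
    if m: "m \<in> part L \<mu>" and mw: "t \<mu> m (\<alpha> + \<beta>) w \<in> S" and n: "n \<in> part L \<nu>" "n \<in> lower_central L 1"
    for \<mu> m \<nu> n
  proof -
    obtain c where c: "n - scl L c w \<in> L.span (K \<nu>)" "scl L c w \<in> part L \<nu>"
      using KD[OF n] unfolding w_def by blast
    have "t \<mu> m \<nu> (scl L c w) \<in> S"
    proof (cases "scl L c w = 0")
      case True
      show ?thesis unfolding True using t_zero_right[OF m] T.subspace_0[OF S] by simp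
    next
      case False
      have "\<nu> = \<alpha> + \<beta>"
      proof (rule ccontr)
        assume "\<nu> \<noteq> \<alpha> + \<beta>"
        then have "L.hcomp \<nu> (scl L c w) = 0"
          using L.hcomp_other[OF L.subspace_scale[OF L.part_subspace w]] by metis
        then show False using L.hcomp_same[OF c(2)] False by simp
      qed
      then show ?thesis using t_scl_right[OF m w] mw S_scl by simp
    qed
    moreover have "t \<mu> m \<nu> (n - scl L c w) \<in> S" by (rule LK[OF m c(1)])
    moreover have "t \<mu> m \<nu> n = t \<mu> m \<nu> (n - scl L c w) + t \<mu> m \<nu> (scl L c w)"
      using t_add_right[OF m part_diff[OF n(1) c(2)] c(2)] by simp
    ultimately show ?thesis using S_add by simp
  qed
  have brk1: "brk L x y \<in> lower_central L 1" if "x \<in> carr L" "y \<in> carr L" for x y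
    using L.brk_lower_central[of x y 0] that by simp
  have wL: "t (\<alpha> + \<beta>) w \<nu> v \<in> S" if v: "v \<in> part L \<nu>" for \<nu> v
    unfolding w_def t_brk_left[OF a b v]
    by (intro S_diff S_scl Lw'[OF a Ga] Lw'[OF b Gb] L.brk_part brk1 L.part_carr[OF a]
        L.part_carr[OF b] L.part_carr[OF v] a b v)
  have Lw: "t \<nu> v (\<alpha> + \<beta>) w \<in> S" if v: "v \<in> part L \<nu>" for \<nu> v
    unfolding w_def t_skew_bracket[OF char a b v] using wL[OF v]
    unfolding w_def by (intro S_neg S_scl)
  have LD: "t \<mu> m \<nu> n \<in> S" if "m \<in> part L \<mu>" "n \<in> part L \<nu>" "n \<in> lower_central L 1" for \<mu> m \<nu> n
    using Lw' Lw that by blast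
  have "t \<mu> m \<nu> n \<in> S" if m: "m \<in> part L \<mu>" and n: "n \<in> part L \<nu>" for \<mu> m \<nu> n
  proof (rule left[OF m n])
    fix p q \<kappa> \<tau> assume pq: "p \<in> part L \<kappa>" "q \<in> part L \<tau>" "\<kappa> + \<tau> = \<mu>"
    have "t (\<kappa> + \<tau>) (brk L p q) \<nu> n \<in> S"
      unfolding t_brk_left[OF pq(1,2) n]
      using L.part_carr[OF pq(1)] L.part_carr[OF pq(2)] L.part_carr[OF n]
      by (intro S_diff S_scl LD L.brk_part brk1 pq(1,2) n)
    then show "t \<mu> (brk L p q) \<nu> n \<in> S" using pq(3) by simp
  next
    fix v assume v: "v \<in> V \<mu>"
    then have vp: "v \<in> part L \<mu>" using V by blast
    obtain u where u: "u \<in> L.span (V \<nu>)" "n - u \<in> lower_central L 1" using VD[OF n] by blast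
    have up: "u \<in> part L \<nu>" using u(1) spanV by blast
    have "t \<mu> v \<nu> u \<in> S" by (rule t_right_mem[OF S V vp u(1) GV[OF v UnI1]])
    moreover have "t \<mu> v \<nu> (n - u) \<in> S" by (rule LD[OF vp part_diff[OF n up] u(2)])
    ultimately show "t \<mu> v \<nu> n \<in> S"
      using S_add t_add_right[OF vp up part_diff[OF n up]] by fastforce
  qed
  then have "{t \<mu> m \<nu> n | \<mu> m \<nu> n. m \<in> part L \<mu> \<and> n \<in> part L \<nu>} \<subseteq> S" by blast
  from T.span_minimal[OF this S] t_span show ?thesis unfolding S_def by blast
qed

text \<open>
  The spanning set above for bases \<open>V\<close> and \<open>K\<close>: the first factor of the product counts \<open>V\<close>, the
  second counts \<open>V \<union> K\<close>, and the last summand counts \<open>a \<otimes> w\<close> and \<open>b \<otimes> w\<close>.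
\<close>

lemma total_dim_bound:
  assumes char: "(2::'k) \<noteq> 0" and nil: "nilpotent L"
    and dim: "has_superdim L k l" and ddim: "has_superdim (derived_subalgebra L) r s"
    and a: "a \<in> part L \<alpha>" and b: "b \<in> part L \<beta>" and w: "brk L a b \<notin> lower_central L 2"
  shows "finite_dim T" and "r \<le> k" and "s \<le> l"
    and "total_dim T \<le> (k - r + (l - s)) * (k + l - 1)
      + card ({t \<alpha> a (\<alpha> + \<beta>) (brk L a b), t \<beta> b (\<alpha> + \<beta>) (brk L a b)} - {0})"
proof -
  define w where "w = brk L a b"
  have wp: "w \<in> part L (\<alpha> + \<beta>)" unfolding w_def using a b by (rule L.brk_part)
  have w1: "w \<in> lower_central L 1"
    using L.brk_lower_central[of a b 0] L.part_carr[OF a] L.part_carr[OF b] by (simp add: w_def)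
  have w2: "w \<notin> lower_central L 2" using w by (simp add: w_def)
  have w0: "w \<noteq> 0" using w2 L.subspace_0[OF L.subspace_lower_central[of 2]] by metis
  have wdeg: "\<mu> = \<alpha> + \<beta>" if "w \<in> part L \<mu>" for \<mu>
  proof (rule ccontr)
    assume "\<mu> \<noteq> \<alpha> + \<beta>"
    then have "L.hcomp \<mu> w = 0" using L.hcomp_other[OF wp] by metis
    then show False using L.hcomp_same[OF that] w0 by simp
  qed
  have fd: "finite_dim L" using dim has_superdim_def by blast
  define D where "D \<mu> = part L \<mu> \<inter> lower_central L 1" for \<mu>
  have D_sub: "L.subspace (D \<mu>)" for \<mu>
    unfolding D_def by (intro L.subspace_inter L.part_subspace L.subspace_lower_central)
  have E_sub: "L.subspace (part L \<mu> \<inter> lower_central L 2)" for \<mu>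
    by (intro L.subspace_inter L.part_subspace L.subspace_lower_central)
  have ED: "part L \<mu> \<inter> lower_central L 2 \<subseteq> D \<mu>" for \<mu>
    unfolding D_def using L.lower_central_mono[of 1 2] by auto
  \<comment> \<open>Homogeneous bases of \<open>L\<^sup>2\<close> through \<open>w\<close> whose other elements span a space containing \<open>L\<^sup>3\<close>.\<close>
  have "\<exists>B. B \<subseteq> D \<mu> \<and> L.independent B \<and> D \<mu> \<subseteq> L.span B \<and> (w \<in> D \<mu> \<longrightarrow> w \<in> B) \<and>
      part L \<mu> \<inter> lower_central L 2 \<subseteq> L.span (B - {w})" for \<mu>
  proof -
    obtain C where C: "C \<subseteq> part L \<mu> \<inter> lower_central L 2" "L.independent C"
      "part L \<mu> \<inter> lower_central L 2 \<subseteq> L.span C"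
      using L.maximal_independent_subset by blast
    have wC: "w \<notin> L.span C" using L.span_minimal[OF C(1) E_sub] w2 by blast
    then have wC': "w \<notin> C" using L.span_base by blast
    let ?C = "if w \<in> D \<mu> then insert w C else C"
    have C': "?C \<subseteq> D \<mu>" "L.independent ?C"
      using C(1,2) ED[of \<mu>] L.independent_insertI[OF wC C(2)] by auto
    obtain B where B: "?C \<subseteq> B" "B \<subseteq> D \<mu>" "L.independent B" "D \<mu> \<subseteq> L.span B"
      using L.maximal_independent_subset_extend[OF C'] by blast
    have "C \<subseteq> B - {w}" using B(1) wC' by (auto split: if_splits)
    then have "part L \<mu> \<inter> lower_central L 2 \<subseteq> L.span (B - {w})" using C(3) L.span_mono by blast
    moreover have "w \<in> D \<mu> \<longrightarrow> w \<in> B" using B(1) by auto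
    ultimately show ?thesis using B by blast
  qed
  then obtain BD where BD: "\<And>\<mu>. BD \<mu> \<subseteq> D \<mu>" "\<And>\<mu>. L.independent (BD \<mu>)"
    "\<And>\<mu>. D \<mu> \<subseteq> L.span (BD \<mu>)" "\<And>\<mu>. w \<in> D \<mu> \<Longrightarrow> w \<in> BD \<mu>"
    "\<And>\<mu>. part L \<mu> \<inter> lower_central L 2 \<subseteq> L.span (BD \<mu> - {w})"
    by metis
  have BDp: "BD \<mu> \<subseteq> part L \<mu>" for \<mu> using BD(1) D_def by blast
  have "\<exists>B. BD \<mu> \<subseteq> B \<and> B \<subseteq> part L \<mu> \<and> L.independent B \<and> part L \<mu> \<subseteq> L.span B" for \<mu>
    using L.maximal_independent_subset_extend[OF BDp BD(2)] by metis
  then obtain BL where BL: "\<And>\<mu>. BD \<mu> \<subseteq> BL \<mu>" "\<And>\<mu>. BL \<mu> \<subseteq> part L \<mu>" "\<And>\<mu>. L.independent (BL \<mu>)"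
    "\<And>\<mu>. part L \<mu> \<subseteq> L.span (BL \<mu>)"
    by metis
  have finL: "finite (BL \<mu>)" for \<mu>
    using L.finite_dim_basis[OF fd BL(3)] BL(2) L.part_carr by blast
  have finD: "finite (BD \<mu>)" for \<mu> using finL BL(1) finite_subset by blast
  have cardL: "card (BL 0) = k" "card (BL 1) = l"
    using L.basis_card_eq_dim[OF BL(2,4,3)] dim by (auto simp: has_superdim_def)
  have "part (derived_subalgebra L) \<mu> = D \<mu>" for \<mu>
    by (simp add: derived_subalgebra_def D_def)
  then have cardD: "card (BD 0) = r" "card (BD 1) = s"
    using L.basis_card_eq_dim[OF BD(1,3,2)] ddim by (auto simp: has_superdim_def derived_subalgebra_def)
  show "r \<le> k" "s \<le> l" using card_mono[OF finL BL(1)] cardL cardD by metis+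
  define V where "V \<mu> = BL \<mu> - BD \<mu>" for \<mu>
  define K where "K \<mu> = BD \<mu> - {w}" for \<mu>
  have cardV: "card (V 0) = k - r" "card (V 1) = l - s"
    unfolding V_def using card_Diff_subset[OF finD BL(1)] cardL cardD by auto
  obtain N where N: "lower_central L N = {0}" using nil nilpotent_def by blast
  let ?w = "{t \<alpha> a (\<alpha> + \<beta>) w, t \<beta> b (\<alpha> + \<beta>) w}"
  let ?G = "{t \<mu> v \<nu> u | \<mu> v \<nu> u. v \<in> V \<mu> \<and> u \<in> V \<nu> \<union> K \<nu>} \<union> ?w"
  have sp: "carr T \<subseteq> T.span ?G"
    unfolding w_def
  proof (rule spanning_set[OF char N a b])
    show "V \<mu> \<subseteq> part L \<mu>" for \<mu> unfolding V_def using BL(2) by blast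
    show "K \<mu> \<subseteq> part L \<mu> \<inter> lower_central L 1" for \<mu> unfolding K_def using BD(1) D_def by blast
    show "part L \<mu> \<inter> lower_central L 2 \<subseteq> L.span (K \<mu>)" for \<mu> unfolding K_def by (rule BD(5))
    show "\<exists>v\<in>L.span (V \<mu>). x - v \<in> lower_central L 1" if "x \<in> part L \<mu>" for \<mu> x
    proof -
      have "BL \<mu> = V \<mu> \<union> BD \<mu>" unfolding V_def using BL(1) by blast
      then have "x \<in> L.span (V \<mu> \<union> BD \<mu>)" using subsetD[OF BL(4) that] by simp
      then obtain v d where "x = v + d" "v \<in> L.span (V \<mu>)" "d \<in> L.span (BD \<mu>)"
        unfolding L.span_Un by blast
      moreover from this have "d \<in> lower_central L 1"
        using L.span_minimal[OF BD(1) D_sub] D_def by blast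
      ultimately show ?thesis by (intro bexI[of _ v]) auto
    qed
    show "\<exists>c. x - scl L c (brk L a b) \<in> L.span (K \<mu>) \<and> scl L c (brk L a b) \<in> part L \<mu>"
      if "x \<in> part L \<mu>" "x \<in> lower_central L 1" for \<mu> x
      unfolding w_def[symmetric]
    proof (cases "w \<in> part L \<mu>")
      case True
      then have "BD \<mu> = insert w (K \<mu>)" unfolding K_def using BD(4)[of \<mu>] w1 D_def by blast
      then have "x \<in> L.span (insert w (K \<mu>))" using that BD(3)[of \<mu>] D_def by auto
      then show "\<exists>c. x - scl L c w \<in> L.span (K \<mu>) \<and> scl L c w \<in> part L \<mu>"
        unfolding L.span_breakdown_eq using L.subspace_scale[OF L.part_subspace True] by blast
    next
      case False
      then have "BD \<mu> = K \<mu>" unfolding K_def using BDp by blast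
      then show "\<exists>c. x - scl L c w \<in> L.span (K \<mu>) \<and> scl L c w \<in> part L \<mu>"
        using that BD(3)[of \<mu>] D_def L.zero_part by (intro exI[of _ 0]) auto
    qed
  qed
  define I where "I = ({0::bit} \<times> V 0 \<union> {1} \<times> V 1) \<times> ({0::bit} \<times> (BL 0 - {w}) \<union> {1} \<times> (BL 1 - {w}))"
  have finI: "finite I" unfolding I_def V_def using finL by simp
  have VK: "V \<nu> \<union> K \<nu> \<subseteq> BL \<nu> - {w}" for \<nu>
    unfolding V_def K_def using BL(1)[of \<nu>] BL(2)[of \<nu>] BD(4)[of \<nu>] w1 D_def by blast
  have GI: "?G \<subseteq> (\<lambda>((\<mu>, v), (\<nu>, u)). t \<mu> v \<nu> u) ` I \<union> ?w" (is "_ \<subseteq> ?H \<union> _")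
  proof (intro Un_mono order_refl subsetI)
    fix x assume "x \<in> {t \<mu> v \<nu> u | \<mu> v \<nu> u. v \<in> V \<mu> \<and> u \<in> V \<nu> \<union> K \<nu>}"
    then obtain \<mu> v \<nu> u where x: "x = t \<mu> v \<nu> u" "v \<in> V \<mu>" "u \<in> BL \<nu> - {w}" using VK by blast
    then have "((\<mu>, v), (\<nu>, u)) \<in> I" unfolding I_def by (cases \<mu>; cases \<nu>) auto
    then show "x \<in> ?H" using x(1) by force
  qed
  then have finG: "finite ?G" using finite_subset finI by (metis (no_types, lifting) finite.emptyI finite.insertI finite_UnI finite_imageI)
  have hom: "?G \<subseteq> part T 0 \<union> part T 1"
  proof -
    have "t \<mu> v \<nu> u \<in> part T 0 \<union> part T 1" if "v \<in> part L \<mu>" "u \<in> part L \<nu>" for \<mu> v \<nu> u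
      using t_part[OF that] by (cases "\<mu> + \<nu>") auto
    then show ?thesis using VK V_def BL(2) a b wp by blast
  qed
  show "finite_dim T" by (rule T.total_dim_le(1)[OF finG hom sp])
  have "card (BL 0 - {w}) + card (BL 1 - {w}) = k + l - 1"
  proof -
    have wBL: "w \<in> BL (\<alpha> + \<beta>)" using BL(1) BD(4) wp w1 D_def by blast
    have "w \<notin> BL \<mu>" if "\<mu> \<noteq> \<alpha> + \<beta>" for \<mu> using wdeg BL(2) that by blast
    then show ?thesis
      using wBL cardL finL card_gt_0_iff[of "BL (\<alpha> + \<beta>)"]
      by (cases "\<alpha> + \<beta>") auto
  qed
  moreover have "card ({0::bit} \<times> A \<union> {1} \<times> B) = card A + card B" if "finite A" "finite B" for A B :: "'a set"
    using that by (subst card_Un_disjoint) (auto simp: card_cartesian_product)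
  ultimately have cardI: "card I = (k - r + (l - s)) * (k + l - 1)"
    unfolding I_def card_cartesian_product using cardV finL V_def by simp
  have "total_dim T \<le> card (?G - {0})" by (rule T.total_dim_le(2)[OF finG hom sp])
  also have "\<dots> \<le> card (?H \<union> (?w - {0}))" 
  proof (rule card_mono)
    show "finite (?H \<union> (?w - {0}))" using finI by simp
    show "?G - {0} \<subseteq> ?H \<union> (?w - {0})" using GI by blast
  qed
  also have "\<dots> \<le> card ?H + card (?w - {0})" by (rule card_Un_le)
  also have "\<dots> \<le> card I + card (?w - {0})" using card_image_le[OF finI] by simp
  finally show "total_dim T \<le> (k - r + (l - s)) * (k + l - 1)
      + card ({t \<alpha> a (\<alpha> + \<beta>) (brk L a b), t \<beta> b (\<alpha> + \<beta>) (brk L a b)} - {0})"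
    unfolding cardI w_def .
qed

end

section \<open>From the presentation to linear algebra\<close>

lemma (in superalgebra) brk_zero: "x \<in> carr A \<Longrightarrow> brk A x 0 = 0" "x \<in> carr A \<Longrightarrow> brk A 0 x = 0"
  using brk_scl_right[of x 0 0] brk_scl_left[of 0 x 0] part_carr[OF zero_part[of 0]] by simp_all

text \<open>
  A bilinear form on \<open>L\<close> that respects the relations of the tensor square when all brackets of
  tensors are sent to \<open>0\<close>; the last clause comes from the relation for such a bracket.  These forms
  correspond to the linear functionals on the abelianised tensor square.
\<close>

definition tensor_form :: "('k::field, 'a::ab_group_add) superalg \<Rightarrow> ('a \<Rightarrow> 'a \<Rightarrow> 'k) \<Rightarrow> bool" where
  "tensor_form L \<phi> \<longleftrightarrow>
    (\<forall>m\<in>carr L. \<forall>n\<in>carr L. (\<forall>c. \<phi> (scl L c m) n = c * \<phi> m n \<and> \<phi> m (scl L c n) = c * \<phi> m n) \<and>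
      (\<forall>p\<in>carr L. \<phi> (m + p) n = \<phi> m n + \<phi> p n \<and> \<phi> m (n + p) = \<phi> m n + \<phi> m p)) \<and>
    (\<forall>\<mu> m \<nu> n \<kappa> p. m \<in> part L \<mu> \<longrightarrow> n \<in> part L \<nu> \<longrightarrow> p \<in> part L \<kappa> \<longrightarrow>
      \<phi> (brk L m n) p = \<phi> m (brk L n p) - psign (\<mu> * \<nu>) * \<phi> n (brk L m p) \<and>
      \<phi> m (brk L n p) = psign (\<kappa> * (\<mu> + \<nu>)) * \<phi> (brk L p m) n - psign (\<mu> * \<nu>) * \<phi> (brk L n m) p) \<and>
    (\<forall>m\<in>carr L. \<forall>n\<in>carr L. \<forall>p\<in>carr L. \<forall>q\<in>carr L. \<phi> (brk L m n) (brk L p q) = 0)"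

context
  fixes X :: "'x set" and d :: "'x \<Rightarrow> bit"
begin

lemma scl_free: "scl (free_superalg X d :: ('k::field, _) superalg) = pm_scale"
  by (simp add: free_superalg_def)

lemma pm_scale_single: "pm_scale c (Poly_Mapping.single s a) = Poly_Mapping.single s (c * a)"
  for c a :: "'k::field"
  by (rule poly_mapping_eqI) (simp add: lookup_single when_def)

lemma brk_free_single:
  "brk (free_superalg X d) (Poly_Mapping.single s a) (Poly_Mapping.single u b) =
    Poly_Mapping.single (Br s u) (a * b :: 'k::field)"
  by (cases "a = 0"; cases "b = 0") (simp_all add: free_superalg_def)

lemma single_free_carr:
  "set_monomial s \<subseteq> X \<Longrightarrow> Poly_Mapping.single s (c::'k::field) \<in> carr (free_superalg X d)"
  by (rule superalgebra.part_carr[OF superalgebra_free, of _ _ _ "monomial_deg d s"])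
    (auto simp: free_superalg_def)

lemma free_carr_keys:
  assumes "p \<in> carr (free_superalg X d :: ('k::field, _) superalg)"
  shows "Poly_Mapping.keys p \<subseteq> {s. set_monomial s \<subseteq> X}"
  using assms keys_add unfolding carr_def free_superalg_def by fastforce

lemma poly_mapping_sum_single: "p = (\<Sum>s\<in>Poly_Mapping.keys p. Poly_Mapping.single s (Poly_Mapping.lookup p s))"
  by (rule poly_mapping_eqI) (simp add: lookup_sum lookup_single when_def sum.delta in_keys_iff)

text \<open>The linear functional on the free superalgebra with prescribed values on generators that
  vanishes on all brackets.\<close>

definition gen_functional :: "('x \<Rightarrow> 'k::field) \<Rightarrow> ('x monomial \<Rightarrow>\<^sub>0 'k) \<Rightarrow> 'k" where
  "gen_functional h p = (\<Sum>s\<in>Poly_Mapping.keys p.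
     Poly_Mapping.lookup p s * (case s of Gen x \<Rightarrow> h x | Br _ _ \<Rightarrow> 0))"

lemma gen_functional_alt:
  assumes "finite S" "Poly_Mapping.keys p \<subseteq> S"
  shows "gen_functional h p = (\<Sum>s\<in>S. Poly_Mapping.lookup p s * (case s of Gen x \<Rightarrow> h x | Br _ _ \<Rightarrow> 0))"
  unfolding gen_functional_def using assms
  by (intro sum.mono_neutral_left) (auto simp: in_keys_iff)

lemma gen_functional_add: "gen_functional h (p + q) = gen_functional h p + gen_functional h q"
proof -
  let ?S = "Poly_Mapping.keys p \<union> Poly_Mapping.keys q"
  have "finite ?S" by simp
  then show ?thesis
    using gen_functional_alt[of ?S p h] gen_functional_alt[of ?S q h] gen_functional_alt[of ?S "p + q" h] keys_add[of p q]
    by (simp add: lookup_add distrib_right sum.distrib)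
qed

lemma gen_functional_scale: "gen_functional h (pm_scale c p) = c * gen_functional h p"
  using gen_functional_alt[of "Poly_Mapping.keys p" "pm_scale c p" h] keys_pm_scale[of c p]
  by (simp add: gen_functional_def sum_distrib_left mult.assoc)

lemma gen_functional_minus: "gen_functional h (- p) = - gen_functional h p"
proof -
  have "- p = pm_scale (- 1) p" by (rule poly_mapping_eqI) simp
  then show ?thesis by (simp add: gen_functional_scale)
qed

lemma gen_functional_diff: "gen_functional h (p - q) = gen_functional h p - gen_functional h q"
  using gen_functional_add[of h p "- q"] by (simp add: gen_functional_minus)

lemma gen_functional_gen: "gen_functional h (Poly_Mapping.single (Gen x) 1) = (h x :: 'k::field)"
  by (simp add: gen_functional_def)

lemma gen_functional_sum: "gen_functional h (sum f S) = (\<Sum>x\<in>S. gen_functional h (f x))"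
  by (induction S rule: infinite_finite_induct)
    (simp_all add: gen_functional_add gen_functional_def[of h 0])

lemma gen_functional_brk: "gen_functional h (brk (free_superalg X d) p q) = (0 :: 'k::field)"
proof -
  have "gen_functional h (Poly_Mapping.single (Br s u) c) = 0" for s u and c :: 'k
    by (simp add: gen_functional_def)
  then show ?thesis by (simp add: free_superalg_def gen_functional_sum)
qed

text \<open>The kernel of such a functional is an ideal that contains the Lie relators.\<close>

lemma gen_functional_ideal_gen:
  fixes h :: "'x \<Rightarrow> 'k::field"
  assumes R: "R \<subseteq> carr (free_superalg X d)" "\<And>p. p \<in> R \<Longrightarrow> gen_functional h p = 0"
    and p: "p \<in> ideal_gen (free_superalg X d) (lie_relators (free_superalg X d) \<union> R)"
  shows "gen_functional h p = 0"
proof -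
  let ?F = "free_superalg X d :: ('k, _) superalg"
  interpret F: superalgebra ?F by (rule superalgebra_free)
  let ?K = "{p \<in> carr ?F. gen_functional h p = 0}"
  have "is_ideal ?F ?K"
    unfolding is_ideal_def
  proof (intro conjI ballI)
    show "F.subspace ?K"
      using F.subspace_carr unfolding F.subspace_def
      by (auto simp: gen_functional_add gen_functional_scale scl_free gen_functional_def[of h 0])
  qed (auto simp: gen_functional_brk F.brk_carr)
  moreover have "lie_relators ?F \<subseteq> ?K"
  proof
    fix u :: "'x monomial \<Rightarrow>\<^sub>0 'k" assume u: "u \<in> lie_relators ?F"
    have "u \<in> carr ?F"
      using u F.part_carr unfolding lie_relators_def jacobiator_def
      by (auto intro!: F.subspace_add[OF F.subspace_carr] F.subspace_scale[OF F.subspace_carr] F.brk_carr)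
    moreover have "gen_functional h u = 0"
      using u unfolding lie_relators_def jacobiator_def
      by (auto simp: gen_functional_add gen_functional_scale scl_free gen_functional_brk)
    ultimately show "u \<in> ?K" by blast
  qed
  ultimately show ?thesis using p R unfolding ideal_gen_def by blast
qed

end

text \<open>
  The tensor square is spanned by tensors because the last defining relation rewrites a bracket of
  tensors as a tensor.  Forms that respect the relations induce linear functionals on it.
\<close>

lemma tensor_square_pairing:
  fixes L :: "('k::field, 'a::ab_group_add) superalg" and T :: "('k, 'b::ab_group_add) superalg"
  assumes L: "lie_superalgebra L" and LT: "is_tensor_square L T"
  obtains t where "tensor_pairing L T t"
    and "\<And>\<phi>. tensor_form L \<phi> \<Longrightarrow> \<exists>f.
      (\<forall>x\<in>carr T. \<forall>y\<in>carr T. f (x + y) = f x + f y) \<and> (\<forall>c. \<forall>x\<in>carr T. f (scl T c x) = c * f x) \<and>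
      (\<forall>\<mu> m \<nu> n. m \<in> part L \<mu> \<longrightarrow> n \<in> part L \<nu> \<longrightarrow> f (t \<mu> m \<nu> n) = \<phi> m n)"
proof -
  interpret L: lie_superalgebra L by (rule L)
  have "lie_superalgebra T" using LT unfolding is_tensor_square_def is_presented_def by blast
  then interpret T: lie_superalgebra T .
  let ?F = "tensor_free L :: ('k, _) superalg"
  interpret F: superalgebra ?F by (rule superalgebra_free)
  let ?R = "{u - v | u v. (u, v) \<in> tensor_relations L}"
  let ?I = "ideal_gen ?F (lie_relators ?F \<union> ?R)"
  obtain \<pi> where hom: "superalg_hom ?F T \<pi>" and surj: "\<pi> ` carr ?F = carr T"
    and ker: "{x \<in> carr ?F. \<pi> x = 0} = ?I"
    using LT unfolding is_tensor_square_def is_presented_def is_quotient_def by blast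
  have \<pi>_part: "\<And>x \<alpha>. x \<in> part ?F \<alpha> \<Longrightarrow> \<pi> x \<in> part T \<alpha>"
    and \<pi>_add: "\<And>x y. x \<in> carr ?F \<Longrightarrow> y \<in> carr ?F \<Longrightarrow> \<pi> (x + y) = \<pi> x + \<pi> y"
    and \<pi>_scl: "\<And>c x. x \<in> carr ?F \<Longrightarrow> \<pi> (pm_scale c x) = scl T c (\<pi> x)"
    and \<pi>_brk: "\<And>x y. x \<in> carr ?F \<Longrightarrow> y \<in> carr ?F \<Longrightarrow> \<pi> (brk ?F x y) = brk T (\<pi> x) (\<pi> y)"
    using hom unfolding superalg_hom_def scl_free by blast+
  have pre: "\<exists>p. p \<in> carr ?F \<and> y = \<pi> p" if "y \<in> carr T" for y
    using that unfolding surj[symmetric] by blast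
  have \<pi>_carr: "\<pi> p \<in> carr T" if "p \<in> carr ?F" for p
    using that unfolding surj[symmetric] by blast
  have carr_scl: "x \<in> carr ?F \<Longrightarrow> pm_scale c x \<in> carr ?F" for c x
    using F.subspace_scale[OF F.subspace_carr, of x c] by (simp add: scl_free)
  have pm_minus: "- p = pm_scale (- 1) p" for p :: "'a symbol monomial \<Rightarrow>\<^sub>0 'k"
    by (rule poly_mapping_eqI) simp
  have \<pi>_minus: "\<pi> (- x) = - \<pi> x" if "x \<in> carr ?F" for x
    unfolding pm_minus[of x] \<pi>_scl[OF that] by simp
  have \<pi>_diff: "\<pi> (x - y) = \<pi> x - \<pi> y" if "x \<in> carr ?F" "y \<in> carr ?F" for x y
    using \<pi>_add[of x "- y"] \<pi>_minus[of y] that F.subspace_neg[OF F.subspace_carr] by simp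
  have R_carr: "?R \<subseteq> carr ?F"
    using tensor_relations_part[OF L] F.part_carr by blast
  have \<pi>_rel: "\<pi> u = \<pi> v" if "(u, v) \<in> tensor_relations L" "v \<in> carr ?F" for u v
  proof -
    have uv: "u - v \<in> ?R" using that(1) by blast
    then have "u - v \<in> ?I" unfolding ideal_gen_def by blast
    then have "\<pi> (u - v) = 0" using ker by blast
    moreover have "\<pi> ((u - v) + v) = \<pi> (u - v) + \<pi> v"
      using \<pi>_add R_carr uv that(2) by blast
    ultimately show ?thesis by simp
  qed
  define t where "t \<mu> m \<nu> n = \<pi> (tens \<mu> m \<nu> n)" for \<mu> m \<nu> n
  have tens_carr: "tens \<mu> m \<nu> n \<in> carr ?F" if "m \<in> part L \<mu>" "n \<in> part L \<nu>" for \<mu> m \<nu> n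
    using tens_part[OF that] F.part_carr by blast
  note part_rules = L.brk_part L.subspace_scale[OF L.part_subspace] L.subspace_add[OF L.part_subspace]
  note carr_rules = tens_carr carr_scl F.subspace_add[OF F.subspace_carr]
    F.subspace_diff[OF F.subspace_carr] F.subspace_neg[OF F.subspace_carr]
  note \<pi>_simps = \<pi>_add \<pi>_scl \<pi>_diff \<pi>_minus
  have t_brk: "brk T (t \<mu> m \<nu> n) (t \<mu>' m' \<nu>' n') =
      - scl T (psign (\<mu> * \<nu>)) (t (\<nu> + \<mu>) (brk L n m) (\<mu>' + \<nu>') (brk L m' n'))"
    if "m \<in> part L \<mu>" "n \<in> part L \<nu>" "m' \<in> part L \<mu>'" "n' \<in> part L \<nu>'" for \<mu> m \<nu> n \<mu>' m' \<nu>' n'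
  proof -
    have "brk T (t \<mu> m \<nu> n) (t \<mu>' m' \<nu>' n') = \<pi> (brk ?F (tens \<mu> m \<nu> n) (tens \<mu>' m' \<nu>' n'))"
      unfolding t_def using that by (simp add: \<pi>_brk tens_carr)
    also have "\<dots> = \<pi> (- pm_scale (psign (\<mu> * \<nu>)) (tens (\<nu> + \<mu>) (brk L n m) (\<mu>' + \<nu>') (brk L m' n')))"
      by (rule \<pi>_rel[OF tensor_relations.brk_brk[OF that]]) (intro carr_rules part_rules that)
    finally show ?thesis
      unfolding t_def by (simp only: \<pi>_minus \<pi>_scl carr_rules part_rules that)
  qed
  define S where "S = T.span {t \<mu> m \<nu> n | \<mu> m \<nu> n. m \<in> part L \<mu> \<and> n \<in> part L \<nu>}"
  have S: "T.subspace S" unfolding S_def by simp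
  have t_S: "t \<mu> m \<nu> n \<in> S" if "m \<in> part L \<mu>" "n \<in> part L \<nu>" for \<mu> m \<nu> n
    unfolding S_def using that by (intro T.span_base) blast
  have t_carr: "t \<mu> m \<nu> n \<in> carr T" if "m \<in> part L \<mu>" "n \<in> part L \<nu>" for \<mu> m \<nu> n
    unfolding t_def using \<pi>_part[OF tens_part[OF that]] T.part_carr by blast
  have S_carr: "S \<subseteq> carr T"
    unfolding S_def using t_carr by (intro T.span_minimal T.subspace_carr) blast
  have brk_S: "brk T x y \<in> S" if x: "x \<in> S" and y: "y \<in> S" for x y
  proof -
    have 1: "brk T (t \<mu> m \<nu> n) y \<in> S" if mn: "m \<in> part L \<mu>" "n \<in> part L \<nu>" and y: "y \<in> S" for \<mu> m \<nu> n y
    proof -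
      have "T.subspace {y \<in> S. brk T (t \<mu> m \<nu> n) y \<in> S}"
        using S S_carr t_carr[OF mn] unfolding T.subspace_def
        by (auto simp: T.brk_zero T.brk_add_right T.brk_scl_right subset_iff)
      moreover have "{t \<mu> m \<nu> n | \<mu> m \<nu> n. m \<in> part L \<mu> \<and> n \<in> part L \<nu>} \<subseteq> {y \<in> S. brk T (t \<mu> m \<nu> n) y \<in> S}"
      proof clarify
        fix \<mu>' m' \<nu>' n' assume mn': "m' \<in> part L \<mu>'" "n' \<in> part L \<nu>'"
        show "t \<mu>' m' \<nu>' n' \<in> S \<and> brk T (t \<mu> m \<nu> n) (t \<mu>' m' \<nu>' n') \<in> S"
          unfolding t_brk[OF mn mn']
          by (intro conjI T.subspace_neg[OF S] T.subspace_scale[OF S] t_S L.brk_part mn mn')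
      qed
      ultimately have "S \<subseteq> {y \<in> S. brk T (t \<mu> m \<nu> n) y \<in> S}" unfolding S_def by (rule T.span_minimal[rotated])
      then show ?thesis using y by blast
    qed
    have "T.subspace {x \<in> S. brk T x y \<in> S}"
      using S S_carr y unfolding T.subspace_def
      by (auto simp: T.brk_zero T.brk_add_left T.brk_scl_left subset_iff)
    moreover have "{t \<mu> m \<nu> n | \<mu> m \<nu> n. m \<in> part L \<mu> \<and> n \<in> part L \<nu>} \<subseteq> {x \<in> S. brk T x y \<in> S}"
      using 1 y t_S by blast
    ultimately have "S \<subseteq> {x \<in> S. brk T x y \<in> S}" unfolding S_def by (rule T.span_minimal[rotated])
    then show ?thesis using x by blast
  qed
  have mono_S: "\<pi> (Poly_Mapping.single s 1) \<in> S" if "set_monomial s \<subseteq> tensor_symbols L" for s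
    using that
  proof (induction s)
    case (Gen x)
    then obtain \<mu> m \<nu> n where "x = Tens \<mu> m \<nu> n" "m \<in> part L \<mu>" "n \<in> part L \<nu>"
      unfolding tensor_symbols_def by auto
    then show ?case using t_S[of m \<mu> n \<nu>] unfolding t_def tens_def by simp
  next
    case (Br s u)
    have "Poly_Mapping.single (Br s u) 1 = brk ?F (Poly_Mapping.single s 1) (Poly_Mapping.single u 1)"
      by (simp add: brk_free_single)
    then show ?case using Br brk_S by (simp add: \<pi>_brk single_free_carr)
  qed
  have carr_S: "carr T \<subseteq> S"
  proof
    fix y assume "y \<in> carr T"
    then obtain p where p: "p \<in> carr ?F" "y = \<pi> p" using pre by blast
    have keys: "set_monomial s \<subseteq> tensor_symbols L" if "s \<in> Poly_Mapping.keys p" for s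
      using free_carr_keys[OF p(1)] that by blast
    have "A \<subseteq> Poly_Mapping.keys p \<Longrightarrow>
        (\<Sum>s\<in>A. Poly_Mapping.single s (Poly_Mapping.lookup p s)) \<in> carr ?F \<and>
        \<pi> (\<Sum>s\<in>A. Poly_Mapping.single s (Poly_Mapping.lookup p s)) \<in> S" if "finite A" for A
      using that
    proof induction
      case empty
      have "\<pi> 0 = 0" using \<pi>_scl[of 0 0] F.part_carr[OF F.zero_part[of 0]]
        by (metis F.scale_zero_right T.scale_zero_left scl_free)
      then show ?case using F.part_carr[OF F.zero_part[of 0]] T.subspace_0[OF S] by simp
    next
      case (insert s A)
      have s: "set_monomial s \<subseteq> tensor_symbols L" using insert.prems keys by blast
      have "Poly_Mapping.single s (Poly_Mapping.lookup p s) = pm_scale (Poly_Mapping.lookup p s) (Poly_Mapping.single s 1)"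
        by (simp add: pm_scale_single)
      then have "\<pi> (Poly_Mapping.single s (Poly_Mapping.lookup p s)) \<in> S"
        using mono_S[OF s] T.subspace_scale[OF S] by (simp add: \<pi>_scl single_free_carr[OF s])
      then show ?case
        using insert single_free_carr[OF s] by (auto simp: \<pi>_add intro!: T.subspace_add[OF S] carr_rules)
    qed
    from this[OF finite_keys order_refl] show "y \<in> S"
      unfolding p(2) using poly_mapping_sum_single[of p] by simp
  qed
  have "tensor_pairing L T t"
  proof
    show "t \<mu> m \<nu> n \<in> part T (\<mu> + \<nu>)" if "m \<in> part L \<mu>" "n \<in> part L \<nu>" for \<mu> m \<nu> n
      unfolding t_def using \<pi>_part[OF tens_part[OF that]] .
    show "t \<mu> (scl L c m) \<nu> n = scl T c (t \<mu> m \<nu> n)" if "m \<in> part L \<mu>" "n \<in> part L \<nu>" for \<mu> m \<nu> n c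
      using \<pi>_rel[OF tensor_relations.scl_left[OF that, of c]] that
      by (simp add: t_def \<pi>_simps carr_rules part_rules)
    show "t \<mu> m \<nu> (scl L c n) = scl T c (t \<mu> m \<nu> n)" if "m \<in> part L \<mu>" "n \<in> part L \<nu>" for \<mu> m \<nu> n c
      using \<pi>_rel[OF tensor_relations.scl_right[OF that, of c]] that
      by (simp add: t_def \<pi>_simps carr_rules part_rules)
    show "t \<mu> (m + m') \<nu> n = t \<mu> m \<nu> n + t \<mu> m' \<nu> n"
      if "m \<in> part L \<mu>" "m' \<in> part L \<mu>" "n \<in> part L \<nu>" for \<mu> m m' \<nu> n
      using \<pi>_rel[OF tensor_relations.add_left[OF that]] that
      by (simp add: t_def \<pi>_simps carr_rules part_rules)
    show "t \<mu> m \<nu> (n + n') = t \<mu> m \<nu> n + t \<mu> m \<nu> n'"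
      if "m \<in> part L \<mu>" "n \<in> part L \<nu>" "n' \<in> part L \<nu>" for \<mu> m n n' \<nu>
      using \<pi>_rel[OF tensor_relations.add_right[OF that]] that
      by (simp add: t_def \<pi>_simps carr_rules part_rules)
    show "t (\<mu> + \<mu>') (brk L m m') \<nu> n =
        t \<mu> m (\<mu>' + \<nu>) (brk L m' n) - scl T (psign (\<mu> * \<mu>')) (t \<mu>' m' (\<mu> + \<nu>) (brk L m n))"
      if "m \<in> part L \<mu>" "m' \<in> part L \<mu>'" "n \<in> part L \<nu>" for \<mu> m \<mu>' m' \<nu> n
      unfolding t_def by (rule trans[OF \<pi>_rel[OF tensor_relations.brk_left[OF that]]])
        (simp_all only: \<pi>_diff \<pi>_scl carr_rules part_rules that)
    show "t \<mu> m (\<nu> + \<nu>') (brk L n n') =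
        scl T (psign (\<nu>' * (\<mu> + \<nu>))) (t (\<nu>' + \<mu>) (brk L n' m) \<nu> n)
        - scl T (psign (\<mu> * \<nu>)) (t (\<nu> + \<mu>) (brk L n m) \<nu>' n')"
      if "m \<in> part L \<mu>" "n \<in> part L \<nu>" "n' \<in> part L \<nu>'" for \<mu> m \<nu> n \<nu>' n'
      unfolding t_def by (rule trans[OF \<pi>_rel[OF tensor_relations.brk_right[OF that]]])
        (simp_all only: \<pi>_diff \<pi>_scl carr_rules part_rules that)
    show "carr T \<subseteq> T.span {t \<mu> m \<nu> n | \<mu> m \<nu> n. m \<in> part L \<mu> \<and> n \<in> part L \<nu>}"
      using carr_S unfolding S_def .
  qed
  moreover have "\<exists>f.
      (\<forall>x\<in>carr T. \<forall>y\<in>carr T. f (x + y) = f x + f y) \<and> (\<forall>c. \<forall>x\<in>carr T. f (scl T c x) = c * f x) \<and>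
      (\<forall>\<mu> m \<nu> n. m \<in> part L \<mu> \<longrightarrow> n \<in> part L \<nu> \<longrightarrow> f (t \<mu> m \<nu> n) = \<phi> m n)"
    if \<phi>: "tensor_form L \<phi>" for \<phi>
  proof -
    have \<phi>_scl: "\<And>c m n. m \<in> carr L \<Longrightarrow> n \<in> carr L \<Longrightarrow> \<phi> (scl L c m) n = c * \<phi> m n"
        "\<And>c m n. m \<in> carr L \<Longrightarrow> n \<in> carr L \<Longrightarrow> \<phi> m (scl L c n) = c * \<phi> m n"
      and \<phi>_add: "\<And>m n p. m \<in> carr L \<Longrightarrow> n \<in> carr L \<Longrightarrow> p \<in> carr L \<Longrightarrow> \<phi> (m + p) n = \<phi> m n + \<phi> p n"
        "\<And>m n p. m \<in> carr L \<Longrightarrow> n \<in> carr L \<Longrightarrow> p \<in> carr L \<Longrightarrow> \<phi> m (n + p) = \<phi> m n + \<phi> m p"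
      and \<phi>_brk: "\<And>m n p q. m \<in> carr L \<Longrightarrow> n \<in> carr L \<Longrightarrow> p \<in> carr L \<Longrightarrow> q \<in> carr L \<Longrightarrow>
        \<phi> (brk L m n) (brk L p q) = 0"
      using \<phi> unfolding tensor_form_def by simp_all
    have \<phi>_left: "\<And>\<mu> m \<nu> n \<kappa> p. m \<in> part L \<mu> \<Longrightarrow> n \<in> part L \<nu> \<Longrightarrow> p \<in> part L \<kappa> \<Longrightarrow>
        \<phi> (brk L m n) p = \<phi> m (brk L n p) - psign (\<mu> * \<nu>) * \<phi> n (brk L m p)"
      and \<phi>_right: "\<And>\<mu> m \<nu> n \<kappa> p. m \<in> part L \<mu> \<Longrightarrow> n \<in> part L \<nu> \<Longrightarrow> p \<in> part L \<kappa> \<Longrightarrow>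
        \<phi> m (brk L n p) = psign (\<kappa> * (\<mu> + \<nu>)) * \<phi> (brk L p m) n - psign (\<mu> * \<nu>) * \<phi> (brk L n m) p"
      using \<phi> unfolding tensor_form_def by blast+
    define h where "h = (\<lambda>x. case x of Tens \<mu> m \<nu> n \<Rightarrow> \<phi> m n)"
    have h: "gen_functional h (tens \<mu> m \<nu> n) = \<phi> m n" for \<mu> m \<nu> n
      unfolding tens_def by (simp add: gen_functional_gen h_def)
    have rel: "gen_functional h p = 0" if "p \<in> ?R" for p
    proof -
      obtain u v where uv: "(u, v) \<in> tensor_relations L" "p = u - v" using \<open>p \<in> ?R\<close> by blast
      from uv(1) have "gen_functional h u = gen_functional h v"
      proof cases
        case (brk_left m \<mu> m' \<mu>' n \<nu>)
        show ?thesis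
          unfolding brk_left(1,2) gen_functional_diff gen_functional_scale h
          by (rule \<phi>_left[OF brk_left(3-5)])
      next
        case (brk_right m \<mu> n \<nu> n' \<nu>')
        show ?thesis
          unfolding brk_right(1,2) gen_functional_diff gen_functional_scale h
          by (rule \<phi>_right[OF brk_right(3-5)])
      next
        case (brk_brk m \<mu> n \<nu> m' \<mu>' n' \<nu>')
        show ?thesis
          unfolding brk_brk(1,2) gen_functional_minus gen_functional_scale gen_functional_brk h
          using \<phi>_brk[OF brk_brk(4,3,5,6)[THEN L.part_carr]] by simp
      qed (simp_all add: gen_functional_add gen_functional_scale h L.part_carr \<phi>_scl \<phi>_add)
      then show ?thesis unfolding uv(2) by (simp add: gen_functional_diff)
    qed
    have ker_h: "gen_functional h p = 0" if "p \<in> ?I" for p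
      using gen_functional_ideal_gen[OF R_carr rel that] .
    define s where "s y = (SOME p. p \<in> carr ?F \<and> \<pi> p = y)" for y
    have s: "s y \<in> carr ?F \<and> \<pi> (s y) = y" if y: "y \<in> carr T" for y
    proof -
      obtain p where p: "p \<in> carr ?F" "y = \<pi> p" using pre[OF y] by blast
      show ?thesis unfolding s_def by (rule someI[of _ p]) (simp add: p)
    qed
    define f where "f y = gen_functional h (s y)" for y
    have f: "f (\<pi> p) = gen_functional h p" if p: "p \<in> carr ?F" for p
    proof -
      have sp: "s (\<pi> p) \<in> carr ?F" "\<pi> (s (\<pi> p)) = \<pi> p" using s[OF \<pi>_carr[OF p]] by simp_all
      then have "s (\<pi> p) - p \<in> ?I"
        unfolding ker[symmetric] using p by (simp add: \<pi>_diff carr_rules)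
      from ker_h[OF this] show ?thesis unfolding f_def by (simp add: gen_functional_diff)
    qed
    have "f (x + y) = f x + f y" if xy: "x \<in> carr T" "y \<in> carr T" for x y
    proof -
      obtain p q where "p \<in> carr ?F" "x = \<pi> p" "q \<in> carr ?F" "y = \<pi> q"
        using pre[OF xy(1)] pre[OF xy(2)] by blast
      then show ?thesis using f[of "p + q"] by (simp add: f \<pi>_add carr_rules gen_functional_add)
    qed
    moreover have "f (scl T c x) = c * f x" if x: "x \<in> carr T" for c x
    proof -
      obtain p where "p \<in> carr ?F" "x = \<pi> p" using pre[OF x] by blast
      then show ?thesis using f[of "pm_scale c p"] by (simp add: f \<pi>_scl carr_rules gen_functional_scale)
    qed
    moreover have "f (t \<mu> m \<nu> n) = \<phi> m n" if "m \<in> part L \<mu>" "n \<in> part L \<nu>" for \<mu> m \<nu> n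
      unfolding t_def using f[OF tens_carr[OF that]] h by simp
    ultimately show ?thesis by blast
  qed
  ultimately show ?thesis by (rule that)
qed

section \<open>The model algebra\<close>

lemma carr_direct_sum: "carr (A \<oplus>\<^sub>s B) = carr A \<times> carr B"
  unfolding carr_def direct_sum_def by force

lemma direct_sum_simps:
  "scl (A \<oplus>\<^sub>s B) c (x, y) = (scl A c x, scl B c y)"
  "part (A \<oplus>\<^sub>s B) \<alpha> = part A \<alpha> \<times> part B \<alpha>"
  "brk (A \<oplus>\<^sub>s B) (x, y) (x', y') = (brk A x x', brk B y y')"
  by (simp_all add: direct_sum_def)

lemma superalgebra_direct_sum:
  assumes "superalgebra A" and "superalgebra B"
  shows "superalgebra (A \<oplus>\<^sub>s B)"
proof -
  interpret A: superalgebra A by fact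
  interpret B: superalgebra B by fact
  have vs: "vector_space (scl (A \<oplus>\<^sub>s B))"
    by unfold_locales (auto simp: direct_sum_def A.scale_right_distrib A.scale_left_distrib
        B.scale_right_distrib B.scale_left_distrib)
  interpret vector_space "scl (A \<oplus>\<^sub>s B)" by (rule vs)
  show ?thesis
  proof
    show "subspace (part (A \<oplus>\<^sub>s B) \<alpha>)" for \<alpha>
      using A.part_subspace[of \<alpha>] B.part_subspace[of \<alpha>]
      by (intro subspaceI) (auto simp: A.subspace_def B.subspace_def direct_sum_def zero_prod_def)
    show "part (A \<oplus>\<^sub>s B) 0 \<inter> part (A \<oplus>\<^sub>s B) 1 = {0}"
      using A.part_Int B.part_Int by (auto simp: direct_sum_def zero_prod_def)
    show "brk (A \<oplus>\<^sub>s B) x y \<in> part (A \<oplus>\<^sub>s B) (\<alpha> + \<beta>)"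
      if "x \<in> part (A \<oplus>\<^sub>s B) \<alpha>" "y \<in> part (A \<oplus>\<^sub>s B) \<beta>" for x y \<alpha> \<beta>
      using that A.brk_part[of "fst x" \<alpha> "fst y" \<beta>] B.brk_part[of "snd x" \<alpha> "snd y" \<beta>]
      by (cases x; cases y) (simp only: direct_sum_simps mem_Times_iff fst_conv snd_conv)
  qed (auto simp: carr_direct_sum direct_sum_simps A.brk_add_left A.brk_add_right A.brk_scl_left
      A.brk_scl_right B.brk_add_left B.brk_add_right B.brk_scl_left B.brk_scl_right)
qed

lemma superalgebra_heisenberg: "superalgebra (heisenberg_1_0 :: ('k::field, _) superalg)"
proof -
  let ?H = "heisenberg_1_0 :: ('k, _) superalg"
  have "vector_space (scl ?H)"
    by unfold_locales (auto simp: heisenberg_1_0_def algebra_simps)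
  then interpret vector_space "scl ?H" .
  show ?thesis
  proof
    show "subspace (part ?H \<alpha>)" for \<alpha>
      by (intro subspaceI) (auto simp: heisenberg_1_0_def zero_prod_def split: if_splits)
    show "part ?H 0 \<inter> part ?H 1 = {0}" by (auto simp: heisenberg_1_0_def)
    show "brk ?H x y \<in> part ?H (\<alpha> + \<beta>)" if "x \<in> part ?H \<alpha>" "y \<in> part ?H \<beta>" for x y \<alpha> \<beta>
      using that by (cases \<alpha>; cases \<beta>; cases x; cases y) (auto simp: heisenberg_1_0_def zero_prod_def)
  qed (auto simp: heisenberg_1_0_def algebra_simps)
qed

lemma pm_scale_zero: "pm_scale c 0 = 0"
  by (rule poly_mapping_eqI) simp

lemma superalgebra_abelian_superalg: "superalgebra (abelian_superalg m n :: ('k::field, _) superalg)"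
proof -
  let ?A = "abelian_superalg m n :: ('k, _) superalg"
  have "vector_space (scl ?A)"
    using vector_space_pm_scale by (simp add: abelian_superalg_def)
  then interpret vector_space "scl ?A" .
  show ?thesis
  proof
    show "subspace (part ?A \<alpha>)" for \<alpha>
    proof (rule subspaceI)
      show "x + y \<in> part ?A \<alpha>" if "x \<in> part ?A \<alpha>" "y \<in> part ?A \<alpha>" for x y
        using that keys_add[of x y] unfolding abelian_superalg_def superalg.simps mem_Collect_eq
        by blast
      show "scl ?A c x \<in> part ?A \<alpha>" if "x \<in> part ?A \<alpha>" for c x
        using that keys_pm_scale[of c x] unfolding abelian_superalg_def superalg.simps mem_Collect_eq
        by blast
    qed (simp add: abelian_superalg_def)
    have "p = 0" if "p \<in> part ?A 0" "p \<in> part ?A 1" for p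
    proof -
      have "Poly_Mapping.keys p = {}" using that unfolding abelian_superalg_def by fastforce
      then show ?thesis by simp
    qed
    then show "part ?A 0 \<inter> part ?A 1 = {0}" by (auto simp: abelian_superalg_def)
  qed (simp_all add: abelian_superalg_def pm_scale_zero)
qed

text \<open>An isomorphism is onto in each degree, so its inverse preserves degrees.\<close>

lemma superalg_iso_part:
  assumes A: "superalgebra A" and B: "superalgebra B"
    and hom: "superalg_hom A B f" and bij: "bij_betw f (carr A) (carr B)" and y: "y \<in> part B \<alpha>"
  obtains x where "x \<in> part A \<alpha>" "f x = y"
proof -
  interpret A: superalgebra A by fact
  interpret B: superalgebra B by fact
  have fp: "f x \<in> part B \<beta>" if "x \<in> part A \<beta>" for x \<beta>
    using hom that unfolding superalg_hom_def by blast
  obtain x where x: "x \<in> carr A" "f x = y"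
    using B.part_carr[OF y] unfolding bij_betw_imp_surj_on[OF bij, symmetric] by blast
  have c: "A.hcomp \<beta> x \<in> part A \<beta>" for \<beta> by (rule A.hcomp_part[OF x(1)])
  have "f (A.hcomp 0 x + A.hcomp 1 x) = f (A.hcomp 0 x) + f (A.hcomp 1 x)"
    using hom c A.part_carr unfolding superalg_hom_def by blast
  then have e: "y = f (A.hcomp 0 x) + f (A.hcomp 1 x)" using A.hcomp_decomp[OF x(1)] x(2) by simp
  have "B.hcomp \<alpha> y = f (A.hcomp \<alpha> x)"
    unfolding e using B.hcomp_sum[OF fp[OF c[of 0]] fp[OF c[of 1]]] by (cases \<alpha>) simp_all
  then have "f (A.hcomp \<alpha> x) = y" using B.hcomp_same[OF y] by simp
  then show ?thesis using that c by blast
qed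

lemma superalg_iso_sym:
  assumes A: "superalgebra A" and B: "superalgebra B" and iso: "A \<cong>\<^sub>s B"
  shows "B \<cong>\<^sub>s A"
proof -
  interpret A: superalgebra A by fact
  interpret B: superalgebra B by fact
  obtain f where hom: "superalg_hom A B f" and bij: "bij_betw f (carr A) (carr B)"
    using iso unfolding superalg_iso_def by blast
  define g where "g = inv_into (carr A) f"
  have gc: "g y \<in> carr A" and fg: "f (g y) = y" if "y \<in> carr B" for y
    using bij that unfolding g_def bij_betw_def by (auto intro: inv_into_into f_inv_into_f)
  have gf: "g y = x" if "x \<in> carr A" "f x = y" for x y
    using bij that unfolding g_def bij_betw_def by (auto intro: inv_into_f_f)
  have f_add: "f (x + y) = f x + f y" and f_brk: "f (brk A x y) = brk B (f x) (f y)"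
    and f_scl: "f (scl A c x) = scl B c (f x)" if "x \<in> carr A" "y \<in> carr A" for x y c
    using hom that unfolding superalg_hom_def by blast+
  have "superalg_hom B A g"
    unfolding superalg_hom_def
  proof (intro conjI ballI allI)
    show "g ` part B \<alpha> \<subseteq> part A \<alpha>" for \<alpha>
    proof
      fix x assume "x \<in> g ` part B \<alpha>"
      then obtain y where y: "y \<in> part B \<alpha>" "x = g y" by blast
      obtain x' where "x' \<in> part A \<alpha>" "f x' = y" using superalg_iso_part[OF A B hom bij y(1)] .
      then show "x \<in> part A \<alpha>" using gf[of x' y] A.part_carr y(2) by auto
    qed
    fix x y c assume x: "x \<in> carr B" and y: "y \<in> carr B"
    show "g (x + y) = g x + g y" "g (brk B x y) = brk A (g x) (g y)"
      using x y by (auto intro!: gf simp: gc fg f_add f_brk A.brk_carr A.subspace_add[OF A.subspace_carr])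
  next
    fix x c assume x: "x \<in> carr B"
    show "g (scl B c x) = scl A c (g x)"
      using x f_scl[of "g x" "g x"] by (auto intro!: gf simp: gc fg A.subspace_scale[OF A.subspace_carr])
  qed
  moreover have "bij_betw g (carr B) (carr A)" unfolding g_def using bij by (rule bij_betw_inv_into)
  ultimately show ?thesis unfolding superalg_iso_def by blast
qed

abbreviation (input) heisenberg_abelian ::
    "nat \<Rightarrow> nat \<Rightarrow> ('k::field, ('k \<times> 'k \<times> 'k) \<times> (bit \<times> nat \<Rightarrow>\<^sub>0 'k)) superalg" where
  "heisenberg_abelian m n \<equiv> heisenberg_1_0 \<oplus>\<^sub>s abelian_superalg m n"

lemma superalgebra_heisenberg_abelian: "superalgebra (heisenberg_abelian m n)"
  by (intro superalgebra_direct_sum superalgebra_heisenberg superalgebra_abelian_superalg)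

lemma heisenberg_abelian_simps:
  "scl (heisenberg_abelian m n) c ((x, y, z), p) = ((c * x, c * y, c * z), pm_scale c p)"
  "brk (heisenberg_abelian m n) ((x, y, z), p) ((x', y', z'), p') = ((0, 0, x * y' - y * x'), 0)"
  "((x, y, z), p) \<in> part (heisenberg_abelian m n) 0 \<longleftrightarrow> Poly_Mapping.keys p \<subseteq> {0} \<times> {..<m}"
  "((x, y, z), p) \<in> part (heisenberg_abelian m n) 1 \<longleftrightarrow>
     x = 0 \<and> y = 0 \<and> z = 0 \<and> Poly_Mapping.keys p \<subseteq> {1} \<times> {..<n}"
  by (auto simp: direct_sum_def heisenberg_1_0_def abelian_superalg_def zero_prod_def)

section \<open>The tensor square of the model algebra\<close>

text \<open>Vectors with a dual family of linear functionals are independent.\<close>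

lemma (in superalgebra) card_le_total_dim_dual:
  assumes fd: "finite_dim A" and fin: "finite P" and v: "\<And>p. p \<in> P \<Longrightarrow> v p \<in> carr A"
    and add: "\<And>p x y. \<lbrakk>p \<in> P; x \<in> carr A; y \<in> carr A\<rbrakk> \<Longrightarrow> f p (x + y) = f p x + f p y"
    and scl: "\<And>p c x. \<lbrakk>p \<in> P; x \<in> carr A\<rbrakk> \<Longrightarrow> f p (scl A c x) = c * f p x"
    and dual: "\<And>p q. \<lbrakk>p \<in> P; q \<in> P\<rbrakk> \<Longrightarrow> f p (v q) = (if q = p then 1 else 0)"
  shows "card P \<le> total_dim A"
proof -
  have ind: "c p = 0" if z: "(\<Sum>q\<in>P. scl A (c q) (v q)) = 0" and p: "p \<in> P" for c p
  proof -
    have 0: "f p 0 = 0" using scl[OF p, of 0 0] part_carr[OF zero_part[of 0]] by simp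
    have "Q \<subseteq> P \<Longrightarrow> (\<Sum>q\<in>Q. scl A (c q) (v q)) \<in> carr A \<and>
        f p (\<Sum>q\<in>Q. scl A (c q) (v q)) = (\<Sum>q\<in>Q. c q * f p (v q))" if "finite Q" for Q
      using that
    proof induction
      case (insert q Q)
      then have "scl A (c q) (v q) \<in> carr A" "f p (scl A (c q) (v q)) = c q * f p (v q)"
        using v scl[OF p] subspace_scale[OF subspace_carr] by auto
      then show ?case using insert add[OF p] subspace_add[OF subspace_carr] by auto
    qed (simp add: 0 part_carr[OF zero_part[of 0]])
    from this[OF fin order_refl] have "(\<Sum>q\<in>P. c q * f p (v q)) = 0" using z 0 by simp
    moreover have "(\<Sum>q\<in>P. c q * f p (v q)) = (\<Sum>q\<in>P. if q = p then c q else 0)"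
      using dual[OF p] by (intro sum.cong) auto
    ultimately show ?thesis using fin p by (simp add: sum.delta)
  qed
  have "inj_on v P" by (rule independent_family(1)[OF fin]) (rule ind)
  moreover have "independent (v ` P)" by (rule independent_family(2)[OF fin]) (rule ind)
  then have "card (v ` P) \<le> total_dim A" by (rule card_le_total_dim[OF fd]) (use v in auto)
  ultimately show ?thesis using card_image by fastforce
qed

text \<open>
  The homogeneous basis of \<open>H(1,0) \<oplus> A(m | n)\<close> is indexed by pairs of a degree and a number; the
  pairs \<open>(0, 0)\<close>, \<open>(0, 1)\<close>, \<open>(0, 2)\<close> belong to \<open>x\<^sub>1\<close>, \<open>x\<^sub>2\<close>, \<open>z\<close>.  For any other pair,
  \<open>drop_index\<close> gives the index of the basis vector within \<open>A(m | n)\<close>.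
\<close>

definition drop_index :: "bit \<times> nat \<Rightarrow> bit \<times> nat" where
  "drop_index j = (fst j, if fst j = 0 then snd j - 3 else snd j)"

text \<open>The coordinates and the basis vectors for this indexing.\<close>

definition coord :: "bit \<times> nat \<Rightarrow> ('k::field \<times> 'k \<times> 'k) \<times> (bit \<times> nat \<Rightarrow>\<^sub>0 'k) \<Rightarrow> 'k" where
  "coord j = (\<lambda>((x, y, z), p). if j = (0, 0) then x else if j = (0, 1) then y
     else if j = (0, 2) then z
     else Poly_Mapping.lookup p (drop_index j))"

definition basis_vec :: "bit \<times> nat \<Rightarrow> ('k::field \<times> 'k \<times> 'k) \<times> (bit \<times> nat \<Rightarrow>\<^sub>0 'k)" where
  "basis_vec j = (if j = (0, 0) then ((1, 0, 0), 0) else if j = (0, 1) then ((0, 1, 0), 0)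
     else if j = (0, 2) then ((0, 0, 1), 0)
     else ((0, 0, 0), Poly_Mapping.single (drop_index j) 1))"

text \<open>The indices of the basis of \<open>H(1,0) \<oplus> A(m | n)\<close>.\<close>

definition basis_index :: "nat \<Rightarrow> nat \<Rightarrow> (bit \<times> nat) set" where
  "basis_index m n = {0} \<times> {..<m + 3} \<union> {1} \<times> {..<n}"

lemma drop_index_inj:
  assumes "drop_index i = drop_index j" and i: "i \<notin> {(0, 0), (0, 1), (0, 2)}" and j: "j \<notin> {(0, 0), (0, 1), (0, 2)}"
  shows "i = j"
proof (rule prod_eqI)
  show f: "fst i = fst j" using assms(1) by (simp add: drop_index_def)
  have ge: "3 \<le> snd x" if "fst x = 0" "x \<notin> {(0, 0), (0, 1), (0, 2)}" for x :: "bit \<times> nat"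
  proof -
    have "snd x \<noteq> 0" "snd x \<noteq> 1" "snd x \<noteq> 2" using that by (metis insertCI prod.collapse)+
    then show ?thesis by arith
  qed
  show "snd i = snd j"
  proof (cases "fst i = 0")
    case True
    then have "snd i - 3 = snd j - 3" using assms(1) f by (simp add: drop_index_def)
    moreover have "3 \<le> snd i" using ge[OF True i] .
    moreover have "3 \<le> snd j" using ge[of j] True f j by simp
    ultimately show ?thesis by arith
  next
    case False
    then show ?thesis using assms(1) f by (auto simp: drop_index_def)
  qed
qed

lemma coord_basis_vec: "coord i (basis_vec j) = (if i = j then 1 else (0::'k::field))"
proof (cases "i \<in> {(0, 0), (0, 1), (0, 2)} \<or> j \<in> {(0, 0), (0, 1), (0, 2)}")
  case True
  then show ?thesis by (auto simp: coord_def basis_vec_def)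
next
  case False
  then have "coord i (basis_vec j :: ('k \<times> 'k \<times> 'k) \<times> _) = (if drop_index i = drop_index j then 1 else 0)"
    by (auto simp: coord_def basis_vec_def lookup_single when_def)
  also have "\<dots> = (if i = j then 1 else 0)" using drop_index_inj False by auto
  finally show ?thesis .
qed

lemma basis_vec_part: "j \<in> basis_index m n \<Longrightarrow> basis_vec j \<in> part (heisenberg_abelian m n) (fst j)"
  unfolding basis_index_def basis_vec_def by (auto simp: heisenberg_abelian_simps drop_index_def)

lemma coord_add: "coord j (x + y) = coord j x + coord j y"
  by (cases x; cases y) (auto simp: coord_def lookup_add)

lemma coord_scl: "coord j (scl (heisenberg_abelian m n) c x) = c * coord j x"
  by (cases x) (auto simp: coord_def heisenberg_abelian_simps)

lemma coord_brk: "coord j (brk (heisenberg_abelian m n) x y) =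
  (if j = (0, 2) then coord (0, 0) x * coord (0, 1) y - coord (0, 1) x * coord (0, 0) y else 0)"
  by (cases x; cases y) (auto simp: coord_def heisenberg_abelian_simps)

lemma coord_odd:
  assumes "x \<in> part (heisenberg_abelian m n) 1" and "j \<in> {(0, 0), (0, 1), (0, 2)}"
  shows "coord j x = 0"
  using assms by (cases x) (auto simp: coord_def heisenberg_abelian_simps)

text \<open>
  With \<open>\<xi>\<^sub>j\<close> the coordinates and \<open>\<zeta>\<close> the coordinate of \<open>z\<close>, the forms \<open>\<xi>\<^sub>i \<otimes> \<xi>\<^sub>j\<close> for \<open>i\<close>, \<open>j\<close> not
  belonging to \<open>z\<close> and the forms \<open>\<xi> \<otimes> \<zeta> - \<zeta> \<otimes> \<xi>\<close> for \<open>\<xi>\<close> belonging to \<open>x\<^sub>1\<close> or \<open>x\<^sub>2\<close> respect the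
  relations of the tensor square.  They are dual to the tensors \<open>e\<^sub>i \<otimes> e\<^sub>j\<close> of the basis vectors
  other than \<open>z\<close>, together with \<open>x\<^sub>1 \<otimes> z\<close> and \<open>x\<^sub>2 \<otimes> z\<close>.
\<close>

lemma total_dim_heisenberg_abelian:
  fixes L :: "('k::field, 'a::ab_group_add) superalg" and T :: "('k, 'b::ab_group_add) superalg"
  assumes L: "lie_superalgebra L" and LT: "is_tensor_square L T" and fd: "finite_dim T"
    and iso: "L \<cong>\<^sub>s heisenberg_abelian m n"
  shows "(m + n + 2) * (m + n + 2) + 2 \<le> total_dim T"
proof -
  let ?M = "heisenberg_abelian m n :: ('k, _) superalg"
  interpret L: lie_superalgebra L by (rule L)
  interpret M: superalgebra ?M by (rule superalgebra_heisenberg_abelian)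
  obtain f where hom: "superalg_hom L ?M f" and bij: "bij_betw f (carr L) (carr ?M)"
    using iso unfolding superalg_iso_def by blast
  obtain t where t: "tensor_pairing L T t"
    and functional: "\<And>\<phi>. tensor_form L \<phi> \<Longrightarrow> \<exists>f.
      (\<forall>x\<in>carr T. \<forall>y\<in>carr T. f (x + y) = f x + f y) \<and> (\<forall>c. \<forall>x\<in>carr T. f (scl T c x) = c * f x) \<and>
      (\<forall>\<mu> m \<nu> n. m \<in> part L \<mu> \<longrightarrow> n \<in> part L \<nu> \<longrightarrow> f (t \<mu> m \<nu> n) = \<phi> m n)"
    using tensor_square_pairing[OF L LT] by metis
  interpret tensor_pairing L T t by (rule t)
  define \<xi> where "\<xi> j x = coord j (f x)" for j x
  have \<xi>_add: "\<xi> j (x + y) = \<xi> j x + \<xi> j y" and \<xi>_scl: "\<xi> j (scl L c x) = c * \<xi> j x"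
    and \<xi>_brk: "\<xi> j (brk L x y) = (if j = (0, 2) then \<xi> (0, 0) x * \<xi> (0, 1) y - \<xi> (0, 1) x * \<xi> (0, 0) y else 0)"
    if "x \<in> carr L" "y \<in> carr L" for j x y c
    using hom that unfolding superalg_hom_def \<xi>_def by (simp_all add: coord_add coord_scl coord_brk)
  have \<xi>_odd: "\<xi> (0, 0) x = 0" "\<xi> (0, 1) x = 0" "\<xi> (0, 2) x = 0" if "x \<in> part L 1" for x
    using hom that unfolding superalg_hom_def \<xi>_def by (auto intro!: coord_odd)
  have "\<exists>e. e \<in> part L (fst j) \<and> f e = basis_vec j" if "j \<in> basis_index m n" for j
    using superalg_iso_part[OF L.superalgebra_axioms M.superalgebra_axioms hom bij basis_vec_part[OF that]] by metis
  then obtain e where e: "\<And>j. j \<in> basis_index m n \<Longrightarrow> e j \<in> part L (fst j) \<and> f (e j) = basis_vec j"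
    by metis
  define J where "J = basis_index m n - {(0, 2)}"
  define P where "P = J \<times> J \<union> {((0, 0), (0, 2)), ((0, 1), (0, 2))}"
  have finI: "finite (basis_index m n)" by (simp add: basis_index_def)
  have J: "J \<subseteq> basis_index m n" "(0, 0) \<in> J" "(0, 1) \<in> J" "(0, 2) \<notin> J" "(0, 2) \<in> basis_index m n"
    unfolding J_def basis_index_def by auto
  have "card (basis_index m n) = m + 3 + n"
    unfolding basis_index_def by (subst card_Un_disjoint) (auto simp: card_cartesian_product)
  then have "card J = m + n + 2" unfolding J_def using J(5) finI by simp
  moreover have "card P = card J * card J + 2"
    unfolding P_def using J finI finite_subset[OF J(1) finI]
    by (subst card_Un_disjoint) (auto simp: card_cartesian_product)
  ultimately have cardP: "card P = (m + n + 2) * (m + n + 2) + 2" by simp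
  have finP: "finite P" unfolding P_def using finite_subset[OF J(1) finI] by simp
  have P: "fst p \<in> basis_index m n" "snd p \<in> basis_index m n" if "p \<in> P" for p
    using that J unfolding P_def by auto
  define x where "x p = t (fst (fst p)) (e (fst p)) (fst (snd p)) (e (snd p))" for p
  define \<phi> where "\<phi> p u v = (if snd p = (0, 2) then \<xi> (fst p) u * \<xi> (0, 2) v - \<xi> (0, 2) u * \<xi> (fst p) v
    else \<xi> (fst p) u * \<xi> (snd p) v)" for p u v
  have form: "tensor_form L (\<phi> p)" if p: "p \<in> P" for p
  proof (cases "snd p = (0, 2)")
    case False
    then have "fst p \<noteq> (0, 2)" using p J unfolding P_def by auto
    then show ?thesis
      unfolding tensor_form_def \<phi>_def using False
      by (auto simp: \<xi>_add \<xi>_scl \<xi>_brk L.brk_carr L.part_carr algebra_simps)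
  next
    case True
    then have i: "fst p = (0, 0) \<or> fst p = (0, 1)" using p J unfolding P_def by auto
    show ?thesis
      unfolding tensor_form_def
    proof (intro conjI allI impI ballI)
      fix \<mu> u \<nu> v \<kappa> w assume uvw: "u \<in> part L \<mu>" "v \<in> part L \<nu>" "w \<in> part L \<kappa>"
      note s = \<xi>_brk \<xi>_odd \<xi>_odd(2)[unfolded One_nat_def] L.part_carr L.brk_carr True
      show "\<phi> p (brk L u v) w = \<phi> p u (brk L v w) - psign (\<mu> * \<nu>) * \<phi> p v (brk L u w)"
        using i uvw unfolding \<phi>_def by (cases \<mu>; cases \<nu>; cases \<kappa>) (auto simp: s algebra_simps)
      show "\<phi> p u (brk L v w) = psign (\<kappa> * (\<mu> + \<nu>)) * \<phi> p (brk L w u) v - psign (\<mu> * \<nu>) * \<phi> p (brk L v u) w"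
        using i uvw unfolding \<phi>_def by (cases \<mu>; cases \<nu>; cases \<kappa>) (auto simp: s algebra_simps)
    qed (use i True in \<open>auto simp: \<phi>_def \<xi>_add \<xi>_scl \<xi>_brk L.brk_carr algebra_simps\<close>)
  qed
  have "\<forall>p\<in>P. \<exists>f.
      (\<forall>x\<in>carr T. \<forall>y\<in>carr T. f (x + y) = f x + f y) \<and> (\<forall>c. \<forall>x\<in>carr T. f (scl T c x) = c * f x) \<and>
      (\<forall>\<mu> m \<nu> n. m \<in> part L \<mu> \<longrightarrow> n \<in> part L \<nu> \<longrightarrow> f (t \<mu> m \<nu> n) = \<phi> p m n)"
    by (intro ballI functional form)
  from bchoice[OF this] obtain F where F: "\<forall>p\<in>P.
      (\<forall>x\<in>carr T. \<forall>y\<in>carr T. F p (x + y) = F p x + F p y) \<and> (\<forall>c. \<forall>x\<in>carr T. F p (scl T c x) = c * F p x) \<and>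
      (\<forall>\<mu> m \<nu> n. m \<in> part L \<mu> \<longrightarrow> n \<in> part L \<nu> \<longrightarrow> F p (t \<mu> m \<nu> n) = \<phi> p m n)"
    by (rule exE)
  have F_add: "\<And>p x y. \<lbrakk>p \<in> P; x \<in> carr T; y \<in> carr T\<rbrakk> \<Longrightarrow> F p (x + y) = F p x + F p y"
    and F_scl: "\<And>p c x. \<lbrakk>p \<in> P; x \<in> carr T\<rbrakk> \<Longrightarrow> F p (scl T c x) = c * F p x"
    and F_t: "\<And>p \<mu> u \<nu> v. \<lbrakk>p \<in> P; u \<in> part L \<mu>; v \<in> part L \<nu>\<rbrakk> \<Longrightarrow> F p (t \<mu> u \<nu> v) = \<phi> p u v"
    using F by simp_all
  have "card P \<le> total_dim T"
  proof (rule T.card_le_total_dim_dual[OF fd finP _ F_add F_scl])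
    show "x p \<in> carr T" if "p \<in> P" for p
      unfolding x_def using t_part e P[OF that] T.part_carr by blast
    fix p q assume p: "p \<in> P" and q: "q \<in> P"
    have \<xi>e: "\<xi> i (e j) = (if i = j then 1 else 0)" if "j \<in> basis_index m n" for i j
      unfolding \<xi>_def using e[OF that] by (simp add: coord_basis_vec)
    have "F p (x q) = \<phi> p (e (fst q)) (e (snd q))"
      unfolding x_def using F_t[OF p] e[OF P(1)[OF q]] e[OF P(2)[OF q]] by simp
    also have "\<dots> = (if q = p then 1 else 0)"
    proof -
      \<comment> \<open>The left index is never that of \<open>z\<close>, so the second product of an alternating form is \<open>0\<close>.\<close>
      have "fst q \<noteq> (0, 2)" using q J unfolding P_def by auto
      then have "\<phi> p (e (fst q)) (e (snd q)) = (if fst p = fst q \<and> snd p = snd q then 1 else 0)"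
        unfolding \<phi>_def \<xi>e[OF P(1)[OF q]] \<xi>e[OF P(2)[OF q]] by auto
      then show ?thesis by (simp add: prod_eq_iff eq_commute)
    qed
    finally show "F p (x q) = (if q = p then 1 else 0)" .
  qed
  then show ?thesis using cardP by simp
qed

section \<open>Recognising the model algebra\<close>

lemma (in vector_space) independent_image_sum_zero:
  assumes ind: "independent (e ` I)" and inj: "inj_on e I" and fin: "finite I"
    and sum: "(\<Sum>i\<in>I. scale (c i) (e i)) = 0" and i: "i \<in> I"
  shows "c i = 0"
proof (rule ccontr)
  assume nz: "c i \<noteq> 0"
  let ?u = "\<lambda>v. c (inv_into I e v)"
  have "(\<Sum>v\<in>e ` I. scale (?u v) v) = (\<Sum>i\<in>I. scale (c i) (e i))"
    unfolding sum.reindex[OF inj] comp_def by (intro sum.cong) (auto simp: inj)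
  moreover have "?u (e i) \<noteq> 0" using nz inj i by simp
  ultimately have "dependent (e ` I)"
    unfolding dependent_finite[OF finite_imageI[OF fin]]
    using sum i by (intro exI[of _ ?u] conjI bexI[of _ "e i"]) auto
  then show False using ind by contradiction
qed

context lie_superalgebra
begin

lemma skew_even: "\<lbrakk>x \<in> part A 0; y \<in> part A 0\<rbrakk> \<Longrightarrow> brk A x y = - brk A y x"
  using skew[of x 0 y 0] by simp

lemma brk_self_even:
  assumes "(2::'a) \<noteq> 0" and "x \<in> part A 0"
  shows "brk A x x = 0"
proof -
  have "scl A 2 (brk A x x) = brk A x x + brk A x x" using scale_left_distrib[of 1 1] by simp
  also have "\<dots> = 0" using skew_even[OF assms(2,2)] by (simp add: eq_neg_iff_add_eq_0)
  finally show ?thesis using assms(1) by simp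
qed

text \<open>
  If \<open>L\<^sup>2\<close> is spanned by \<open>w = [a, b]\<close> with \<open>a\<close>, \<open>b\<close> even, if \<open>w\<close> and the odd part are central, and if
  the even elements commuting with \<open>a\<close> and \<open>b\<close> commute with each other, then \<open>a\<close>, \<open>b\<close>, \<open>w\<close> span
  a copy of \<open>H(1,0)\<close> with an abelian direct complement.
\<close>

lemma heisenberg_abelian_iso:
  assumes char: "(2::'a) \<noteq> 0" and dim: "has_superdim A k l"
    and a: "a \<in> part A 0" and b: "b \<in> part A 0" and w0: "brk A a b \<noteq> 0"
    and sq: "\<And>x y. \<lbrakk>x \<in> part A 0; y \<in> part A 0\<rbrakk> \<Longrightarrow> \<exists>c. brk A x y = scl A c (brk A a b)"
    and odd: "\<And>x y. \<lbrakk>x \<in> part A 1; y \<in> carr A\<rbrakk> \<Longrightarrow> brk A x y = 0 \<and> brk A y x = 0"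
    and w: "\<And>y. y \<in> part A 0 \<Longrightarrow> brk A (brk A a b) y = 0"
    and comm: "\<And>x y. \<lbrakk>x \<in> part A 0; y \<in> part A 0; brk A a x = 0; brk A b x = 0; brk A a y = 0;
      brk A b y = 0\<rbrakk> \<Longrightarrow> brk A x y = 0"
  shows "A \<cong>\<^sub>s heisenberg_abelian (k - 3) l"
proof -
  define w where "w = brk A a b"
  define U where "U = {x \<in> part A 0. brk A a x = 0 \<and> brk A b x = 0}"
  let ?M = "heisenberg_abelian (k - 3) l :: ('a, _) superalg"
  interpret M: superalgebra ?M by (rule superalgebra_heisenberg_abelian)
  note pc = part_carr
  have fd: "finite_dim A" using dim has_superdim_def by blast
  have wp: "w \<in> part A 0" unfolding w_def using brk_part[OF a b] by simp
  have aa: "brk A a a = 0" and bb: "brk A b b = 0" and ab: "brk A a b = w" and ba: "brk A b a = - w"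
    using brk_self_even[OF char] a b skew_even[OF b a] by (simp_all add: w_def)
  have w_nz: "w \<noteq> 0" using w0 by (simp add: w_def)
  have U_sub: "subspace U"
    using subspace_0[OF part_subspace] subspace_add[OF part_subspace] subspace_scale[OF part_subspace] a b
    by (auto simp: subspace_def U_def brk_zero brk_add_right brk_scl_right pc)
  have wU: "w \<in> U"
    using w[OF a] w[OF b] skew_even[OF a wp] skew_even[OF b wp] wp unfolding U_def w_def by auto
  have decomp: "\<exists>\<beta> \<gamma>. x - (scl A \<beta> a + scl A \<gamma> b) \<in> U" if x: "x \<in> part A 0" for x
  proof -
    obtain \<beta> \<gamma> where bx: "brk A b x = scl A \<beta> w" and ax: "brk A a x = scl A \<gamma> w"
      using sq[OF b x] sq[OF a x] unfolding w_def by blast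
    have s: "scl A c a \<in> part A 0" "scl A c b \<in> part A 0" for c
      using subspace_scale[OF part_subspace] a b by blast+
    define u where "u = x + (scl A \<beta> a + scl A (- \<gamma>) b)"
    have u: "u \<in> part A 0"
      unfolding u_def using s x subspace_add[OF part_subspace] by blast
    have "brk A a u = brk A a x + (scl A \<beta> (brk A a a) + scl A (- \<gamma>) (brk A a b))"
      unfolding u_def using pc[OF a] pc[OF b] pc[OF x] s[THEN pc]
      by (simp only: brk_add_right brk_scl_right subspace_add[OF subspace_carr])
    then have "brk A a u = 0" by (simp add: ax aa ab)
    moreover have "brk A b u = brk A b x + (scl A \<beta> (brk A b a) + scl A (- \<gamma>) (brk A b b))"
      unfolding u_def using pc[OF a] pc[OF b] pc[OF x] s[THEN pc]
      by (simp only: brk_add_right brk_scl_right subspace_add[OF subspace_carr])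
    then have "brk A b u = 0" by (simp add: bx bb ba)
    ultimately have "u \<in> U" using u U_def by blast
    moreover have "u = x - (scl A (- \<beta>) a + scl A \<gamma> b)" unfolding u_def by simp
    ultimately show ?thesis by metis
  qed
  have U_carr: "U \<subseteq> carr A" using U_def pc by blast
  have central: "brk A u y = 0" "brk A y u = 0" if u: "u \<in> U" and y: "y \<in> carr A" for u y
  proof -
    have up: "u \<in> part A 0" using u U_def by blast
    have yp: "hcomp \<alpha> y \<in> part A \<alpha>" for \<alpha> by (rule hcomp_part[OF y])
    obtain \<beta> \<gamma> where v: "hcomp 0 y - (scl A \<beta> a + scl A \<gamma> b) \<in> U" (is "?v \<in> U") using decomp[OF yp] by blast
    have c: "scl A \<beta> a \<in> carr A" "scl A \<gamma> b \<in> carr A" "?v \<in> carr A"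
      using subspace_scale[OF subspace_carr] pc a b U_carr v by auto
    have "brk A ?v u = 0" using v u comm unfolding U_def by blast
    moreover have "brk A a u = 0" "brk A b u = 0" using u U_def by auto
    moreover have "brk A (hcomp 0 y) u = brk A (scl A \<beta> a + scl A \<gamma> b + ?v) u" by simp
    then have "brk A (hcomp 0 y) u = scl A \<beta> (brk A a u) + scl A \<gamma> (brk A b u) + brk A ?v u"
      using c a b pc up by (simp only: brk_add_left brk_scl_left subspace_add[OF subspace_carr])
    ultimately have 0: "brk A (hcomp 0 y) u = 0" by simp
    then have 1: "brk A u (hcomp 0 y) = 0" using skew_even[OF up yp] by simp
    have "brk A u (hcomp 0 y + hcomp 1 y) = 0" "brk A (hcomp 0 y + hcomp 1 y) u = 0"
      using 0 1 odd[OF yp pc[OF up]] pc[OF up] pc[OF yp] by (simp_all add: brk_add_left brk_add_right)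
    then show "brk A u y = 0" "brk A y u = 0" by (simp_all add: hcomp_decomp[OF y])
  qed
  \<comment> \<open>Bases of \<open>U\<close> and of the odd part.\<close>
  have "independent {w}" "{w} \<subseteq> U" using w_nz wU by simp_all
  then obtain C0 where C0: "{w} \<subseteq> C0" "C0 \<subseteq> U" "independent C0" "U \<subseteq> span C0"
    using maximal_independent_subset_extend by metis
  have fC0: "finite C0" using finite_dim_basis[OF fd C0(3)] C0(2) U_carr by blast
  have spC0: "span C0 = U" using span_minimal[OF C0(2) U_sub] C0(4) by blast
  have b_nin: "b \<notin> span C0" using ab w_nz unfolding spC0 U_def by auto
  have a_nin: "a \<notin> span (insert b C0)"
  proof
    assume "a \<in> span (insert b C0)"
    then obtain c where "a - scl A c b \<in> U" unfolding span_breakdown_eq spC0 by blast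
    then have "brk A b (a + scl A (- c) b) = 0" unfolding U_def by simp
    moreover have "brk A b (a + scl A (- c) b) = brk A b a + scl A (- c) (brk A b b)"
      using a b pc by (simp only: brk_add_right brk_scl_right subspace_scale[OF subspace_carr])
    ultimately show False using w_nz by (simp add: ba bb)
  qed
  have "card (insert a (insert b C0)) = dim (part A 0)"
  proof (rule basis_card_eq_dim)
    show "insert a (insert b C0) \<subseteq> part A 0" using a b C0(2) U_def by blast
    show "independent (insert a (insert b C0))"
      using independent_insertI[OF a_nin independent_insertI[OF b_nin C0(3)]] .
    show "part A 0 \<subseteq> span (insert a (insert b C0))"
    proof
      fix x assume "x \<in> part A 0"
      then obtain \<beta> \<gamma> where "x - (scl A \<beta> a + scl A \<gamma> b) \<in> U" using decomp by blast
      then have "x - scl A \<beta> a - scl A \<gamma> b \<in> span C0" unfolding spC0 by (simp add: diff_diff_add)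
      then show "x \<in> span (insert a (insert b C0))" unfolding span_breakdown_eq by blast
    qed
  qed
  moreover have "a \<notin> insert b C0" "b \<notin> C0" using a_nin b_nin span_base by blast+
  ultimately have "card (C0 - {w}) = k - 3"
    using dim fC0 C0(1) by (simp add: has_superdim_def)
  then obtain e0 where e0: "bij_betw e0 {0..<k - 3} (C0 - {w})"
    using ex_bij_betw_nat_finite[of "C0 - {w}"] fC0 by auto
  obtain B1 where B1: "B1 \<subseteq> part A 1" "independent B1" "part A 1 \<subseteq> span B1" "card B1 = dim (part A 1)"
    using basis_exists by blast
  have fB1: "finite B1" using finite_dim_basis[OF fd B1(2)] B1(1) pc by blast
  obtain e1 where e1: "bij_betw e1 {0..<l} B1"
    using ex_bij_betw_nat_finite[OF fB1] B1(4) dim by (auto simp: has_superdim_def)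
  have e0_img: "e0 ` {..<k - 3} = C0 - {w}" and e0_inj: "inj_on e0 {..<k - 3}"
    and e1_img: "e1 ` {..<l} = B1" and e1_inj: "inj_on e1 {..<l}"
    using e0 e1 by (simp_all add: bij_betw_def lessThan_atLeast0)
  \<comment> \<open>The parts of a vector of \<open>A(k - 3 | l)\<close> in the two degrees, carried over to \<open>U\<close> and the odd part.\<close>
  define s0 where "s0 p = (\<Sum>i<k - 3. scl A (Poly_Mapping.lookup p (0, i)) (e0 i))" for p :: "bit \<times> nat \<Rightarrow>\<^sub>0 'a"
  define s1 where "s1 p = (\<Sum>i<l. scl A (Poly_Mapping.lookup p (1, i)) (e1 i))" for p :: "bit \<times> nat \<Rightarrow>\<^sub>0 'a"
  have s_add: "s0 (p + q) = s0 p + s0 q" "s1 (p + q) = s1 p + s1 q" for p q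
    unfolding s0_def s1_def by (simp_all add: lookup_add scale_left_distrib sum.distrib)
  have s_scl: "s0 (pm_scale c p) = scl A c (s0 p)" "s1 (pm_scale c p) = scl A c (s1 p)" for c p
    unfolding s0_def s1_def by (simp_all add: scale_sum_right)
  have s_zero: "s0 0 = 0" "s1 0 = 0" unfolding s0_def s1_def by simp_all
  have s0_U: "s0 p \<in> U" for p
    unfolding s0_def using e0_img C0(2) by (intro subspace_sum[OF U_sub] subspace_scale[OF U_sub]) blast
  have s1_part: "s1 p \<in> part A 1" for p
    unfolding s1_def using e1_img B1(1)
    by (intro subspace_sum[OF part_subspace] subspace_scale[OF part_subspace]) blast
  define g where "g = (\<lambda>((x, y, z), p). scl A x a + scl A y b + (scl A z w + s0 p + s1 p))"
  have g: "g ((x, y, z), p) = scl A x a + scl A y b + (scl A z w + s0 p + s1 p)" for x y z p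
    by (simp add: g_def)
  have g_add: "g (X + Y) = g X + g Y" for X Y
    by (cases X; cases Y) (auto simp: g s_add scale_left_distrib)
  have g_scl: "g (scl ?M c X) = scl A c (g X)" for c X
    by (cases X) (auto simp: g s_scl heisenberg_abelian_simps scale_right_distrib)
  \<comment> \<open>The centre.\<close>
  define Q where "Q = {q \<in> carr A. \<forall>y\<in>carr A. brk A q y = 0 \<and> brk A y q = 0}"
  have qQ: "scl A z w + s0 p + s1 p \<in> Q" for z p
  proof -
    have "scl A z w + s0 p \<in> U" using s0_U wU subspace_add[OF U_sub] subspace_scale[OF U_sub] by blast
    then show ?thesis
      unfolding Q_def using U_carr pc[OF s1_part] odd[OF s1_part] central
      by (auto simp: brk_add_left brk_add_right subset_iff intro: subspace_add[OF subspace_carr])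
  qed
  have g_brk: "g (brk ?M X Y) = brk A (g X) (g Y)" for X Y
  proof -
    obtain x y z p where X: "X = ((x, y, z), p)" by (metis prod.exhaust)
    obtain x' y' z' p' where Y: "Y = ((x', y', z'), p')" by (metis prod.exhaust)
    obtain q where q: "q \<in> Q" "g X = scl A x a + scl A y b + q" using qQ g X by metis
    obtain q' where q': "q' \<in> Q" "g Y = scl A x' a + scl A y' b + q'" using qQ g Y by metis
    have c: "scl A x a \<in> carr A" "scl A y b \<in> carr A" "scl A x' a \<in> carr A" "scl A y' b \<in> carr A"
      "q \<in> carr A" "q' \<in> carr A"
      using subspace_scale[OF subspace_carr] pc[OF a] pc[OF b] q q' Q_def by auto
    note add = subspace_add[OF subspace_carr]
    have "brk A (g X) (g Y) = brk A (scl A x a + scl A y b) (scl A x' a + scl A y' b + q') + brk A q (g Y)"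
      unfolding q(2) q'(2) using c add by (simp add: brk_add_left)
    also have "brk A q (g Y) = 0" using q q' c add Q_def by auto
    also have "brk A (scl A x a + scl A y b) (scl A x' a + scl A y' b + q') =
        brk A (scl A x a + scl A y b) (scl A x' a + scl A y' b) + brk A (scl A x a + scl A y b) q'"
      using c add by (simp add: brk_add_right)
    also have "brk A (scl A x a + scl A y b) q' = 0" using q' c add Q_def by auto
    also have "brk A (scl A x a + scl A y b) (scl A x' a + scl A y' b) = scl A (x * y' - y * x') w"
      using c add pc[OF a] pc[OF b]
      by (simp add: brk_add_left brk_add_right brk_scl_left brk_scl_right aa bb ab ba
          scale_left_diff_distrib mult.commute)
    finally show ?thesis by (simp add: X Y heisenberg_abelian_simps g s_zero)
  qed
  have s_part: "s1 p = 0" if "Poly_Mapping.keys p \<subseteq> {0} \<times> {..<m}" for p m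
    unfolding s1_def using that by (intro sum.neutral ballI) (force simp: in_keys_iff)
  have s_part': "s0 p = 0" if "Poly_Mapping.keys p \<subseteq> {1} \<times> {..<m}" for p m
    unfolding s0_def using that by (intro sum.neutral ballI) (force simp: in_keys_iff)
  have g_part: "g ` part ?M \<alpha> \<subseteq> part A \<alpha>" for \<alpha>
  proof
    fix Y assume "Y \<in> g ` part ?M \<alpha>"
    then obtain x y z p where X: "((x, y, z), p) \<in> part ?M \<alpha>" "Y = g ((x, y, z), p)"
      by (auto elim!: imageE)
    show "Y \<in> part A \<alpha>"
    proof (cases "\<alpha> = 0")
      case True
      then have "s1 p = 0" using X(1) s_part[of p "k - 3"] by (simp add: heisenberg_abelian_simps)
      moreover have "s0 p \<in> part A 0" using s0_U U_def by blast
      ultimately show ?thesis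
        unfolding X(2) g True using a b wp
        by (simp add: subspace_add[OF part_subspace] subspace_scale[OF part_subspace])
    next
      case False
      then have \<alpha>: "\<alpha> = 1" by simp
      then have "s0 p = 0" "x = 0" "y = 0" "z = 0"
        using X(1) s_part'[of p l] by (simp_all add: heisenberg_abelian_simps)
      then show ?thesis unfolding X(2) g \<alpha> using s1_part by simp
    qed
  qed
  have carrM: "((x, y, z), p) \<in> carr ?M \<longleftrightarrow> p \<in> carr (abelian_superalg (k - 3) l)" for x y z p
  proof -
    have "(x, y, z) \<in> carr heisenberg_1_0"
      by (rule superalgebra.part_carr[OF superalgebra_heisenberg, of _ 0]) (simp add: heisenberg_1_0_def)
    then show ?thesis by (simp add: carr_direct_sum)
  qed
  have ab_keys: "Poly_Mapping.keys p \<subseteq> {0} \<times> {..<k - 3} \<union> {1} \<times> {..<l}"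
    if "p \<in> carr (abelian_superalg (k - 3) l :: ('a, _) superalg)" for p
    using that keys_add unfolding carr_def abelian_superalg_def by fastforce
  have bij: "bij_betw g (carr ?M) (carr A)"
    unfolding bij_betw_def
  proof
    show "inj_on g (carr ?M)"
    proof (rule inj_onI)
      fix X Y assume XY: "X \<in> carr ?M" "Y \<in> carr ?M" "g X = g Y"
      have "X - Y \<in> carr ?M" using XY M.subspace_diff[OF M.subspace_carr] by blast
      moreover have "g (X - Y) + g Y = g Y" using g_add[of "X - Y" Y] XY(3) by simp
      then have "g (X - Y) = 0" by simp
      moreover obtain x y z p where d: "X - Y = ((x, y, z), p)" by (metis prod.exhaust)
      ultimately have p: "p \<in> carr (abelian_superalg (k - 3) l)" and 0: "g ((x, y, z), p) = 0"
        using carrM by simp_all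
      have v: "((x, y, z), p) \<in> carr ?M" using p carrM by simp
      have a1: "((1, 0, 0), 0) \<in> part ?M 0" "((0, 1, 0), 0) \<in> part ?M 0"
        by (simp_all add: heisenberg_abelian_simps)
      have "y = 0"
      proof -
        have "g (brk ?M ((1, 0, 0), 0) ((x, y, z), p)) = 0"
          unfolding g_brk using 0 brk_zero(1) g_part[of 0] a1 pc by auto
        then show ?thesis using w_nz by (simp add: heisenberg_abelian_simps g s_zero)
      qed
      moreover have "x = 0"
      proof -
        have "g (brk ?M ((0, 1, 0), 0) ((x, y, z), p)) = 0"
          unfolding g_brk using 0 brk_zero(1) g_part[of 0] a1 pc by auto
        then show ?thesis using w_nz by (simp add: heisenberg_abelian_simps g s_zero)
      qed
      ultimately have e: "(scl A z w + s0 p) + s1 p = 0" using 0 by (simp add: g)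
      have "scl A z w + s0 p \<in> part A 0"
        using s0_U U_def wp subspace_add[OF part_subspace] subspace_scale[OF part_subspace] by blast
      from hcomp_sum[OF this s1_part[of p]] e have e0': "scl A z w + s0 p = 0" and e1': "s1 p = 0"
        by (simp_all add: hcomp_zero)
      have p1: "Poly_Mapping.lookup p (1, i) = 0" if "i < l" for i
        using independent_image_sum_zero[OF B1(2)[folded e1_img] e1_inj] e1' that unfolding s1_def by simp
      have p0: "z = 0 \<and> (\<forall>i<k - 3. Poly_Mapping.lookup p (0, i) = 0)"
      proof -
        \<comment> \<open>The basis \<open>C0\<close> of \<open>U\<close> is indexed here by \<open>None\<close>, for \<open>w\<close>, and by \<open>Some i\<close>.\<close>
        let ?e = "\<lambda>j. case j of None \<Rightarrow> w | Some i \<Rightarrow> e0 i"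
        let ?c = "\<lambda>j. case j of None \<Rightarrow> z | Some i \<Rightarrow> Poly_Mapping.lookup p (0, i)"
        let ?I = "insert None (Some ` {..<k - 3})"
        have "?e ` ?I = insert w (e0 ` {..<k - 3})" by (simp add: image_image)
        then have img: "?e ` ?I = C0" using e0_img C0(1) by auto
        have "w \<notin> e0 ` {..<k - 3}" using e0_img by simp
        then have inj: "inj_on ?e ?I" using e0_inj by (auto simp: inj_on_def)
        have "(\<Sum>j\<in>?I. scl A (?c j) (?e j)) = scl A z w + s0 p"
          unfolding s0_def by (subst sum.insert) (auto simp: sum.reindex)
        then have sum: "(\<Sum>j\<in>?I. scl A (?c j) (?e j)) = 0" using e0' by simp
        have c0: "?c j = 0" if "j \<in> ?I" for j
          by (rule independent_image_sum_zero[OF C0(3)[folded img] inj _ sum that]) simp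
        show ?thesis
        proof (intro conjI allI impI)
          show "z = 0" using c0[of None] by simp
          show "Poly_Mapping.lookup p (0, i) = 0" if "i < k - 3" for i using c0[of "Some i"] that by simp
        qed
      qed
      have "i \<notin> Poly_Mapping.keys p" for i
        using ab_keys[OF p] p0 p1 by (cases i) (auto simp: in_keys_iff)
      then have "Poly_Mapping.keys p = {}" by blast
      then have "X - Y = 0" using \<open>x = 0\<close> \<open>y = 0\<close> p0 d by (simp add: zero_prod_def)
      then show "X = Y" by simp
    qed
    show "g ` carr ?M = carr A"
    proof (rule antisym)
      show "g ` carr ?M \<subseteq> carr A"
      proof
        fix Y assume "Y \<in> g ` carr ?M"
        then obtain X0 X1 where "X0 \<in> part ?M 0" "X1 \<in> part ?M 1" "Y = g (X0 + X1)"
          unfolding carr_def[of ?M] by blast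
        then show "Y \<in> carr A" using g_part g_add by (auto intro!: carrI)
      qed
      show "carr A \<subseteq> g ` carr ?M"
      proof
        fix Y assume Y: "Y \<in> carr A"
        have Yp: "hcomp \<alpha> Y \<in> part A \<alpha>" for \<alpha> by (rule hcomp_part[OF Y])
        obtain x y where xy: "hcomp 0 Y - (scl A x a + scl A y b) \<in> U" using decomp[OF Yp] by blast
        have "insert w (e0 ` {..<k - 3}) = C0" using e0_img C0(1) by blast
        then have "hcomp 0 Y - (scl A x a + scl A y b) \<in> span (insert w (e0 ` {..<k - 3}))"
          using xy spC0 by simp
        then obtain z where "hcomp 0 Y - (scl A x a + scl A y b) - scl A z w \<in> span (e0 ` {..<k - 3})"
          unfolding span_breakdown_eq by blast
        then obtain c where c: "hcomp 0 Y - (scl A x a + scl A y b) - scl A z w = (\<Sum>i<k - 3. scl A (c i) (e0 i))"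
          using span_image_finite by blast
        obtain d where d: "hcomp 1 Y = (\<Sum>i<l. scl A (d i) (e1 i))"
          using span_image_finite[of "{..<l}" "hcomp 1 Y" e1] Yp[of 1] B1(3) e1_img by blast
        define p0 where "p0 = (\<Sum>i<k - 3. Poly_Mapping.single (0 :: bit, i) (c i))"
        define p1 where "p1 = (\<Sum>i<l. Poly_Mapping.single (1 :: bit, i) (d i))"
        have l0: "Poly_Mapping.lookup p0 (0, i) = c i" if "i < k - 3" for i
          unfolding p0_def using that by (simp add: lookup_sum lookup_single when_def sum.delta)
        have l1: "Poly_Mapping.lookup p1 (1, i) = d i" if "i < l" for i
          unfolding p1_def using that by (simp add: lookup_sum lookup_single when_def sum.delta)
        have k0: "Poly_Mapping.keys p0 \<subseteq> {0} \<times> {..<k - 3}"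
          unfolding p0_def by (rule order_trans[OF keys_sum]) (auto split: if_splits)
        have k1: "Poly_Mapping.keys p1 \<subseteq> {1} \<times> {..<l}"
          unfolding p1_def by (rule order_trans[OF keys_sum]) (auto split: if_splits)
        have "s0 p0 = hcomp 0 Y - (scl A x a + scl A y b) - scl A z w"
          unfolding c s0_def by (intro sum.cong) (simp_all add: l0)
        moreover have "s1 p1 = hcomp 1 Y" unfolding d s1_def by (intro sum.cong) (simp_all add: l1)
        ultimately have "g (((x, y, z), p0) + ((0, 0, 0), p1)) = hcomp 0 Y + hcomp 1 Y"
          unfolding g_add g using s_part[OF k0] s_part'[OF k1] by (simp add: algebra_simps)
        then have "Y = g (((x, y, z), p0) + ((0, 0, 0), p1))" by (simp add: hcomp_decomp[OF Y])
        moreover have "((x, y, z), p0) \<in> part ?M 0" "((0, 0, 0), p1) \<in> part ?M 1"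
          using k0 k1 by (simp_all add: heisenberg_abelian_simps)
        then have "((x, y, z), p0) + ((0, 0, 0), p1) \<in> carr ?M" by (rule M.carrI)
        ultimately show "Y \<in> g ` carr ?M" by blast
      qed
    qed
  qed
  have "superalg_hom ?M A g"
    unfolding superalg_hom_def using g_part g_add g_scl g_brk by blast
  then have "?M \<cong>\<^sub>s A" using bij unfolding superalg_iso_def by blast
  then show ?thesis by (rule superalg_iso_sym[OF M.superalgebra_axioms superalgebra_axioms])
qed

end

section \<open>The case of equality\<close>

text \<open>
  If the bound is attained then \<open>a \<otimes> w\<close> and \<open>b \<otimes> w\<close> are distinct and nonzero for any two homogeneous
  \<open>a\<close>, \<open>b\<close> with \<open>w = [a, b] \<noteq> 0\<close>.  The choice \<open>a = b\<close> shows that odd elements have square \<open>0\<close>.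
  If even \<open>x\<close>, \<open>y\<close> commute with \<open>a\<close> and \<open>b\<close>, then \<open>[x, y] \<otimes> a = x \<otimes> [y, a] - y \<otimes> [x, a] = 0\<close>.  Here
  \<open>[x, y]\<close> is a multiple of \<open>w\<close>, and it is \<open>0\<close> because otherwise \<open>w \<otimes> a\<close>, and with it \<open>a \<otimes> w\<close>, would
  vanish.
\<close>

lemma (in tensor_pairing) heisenberg_abelian_if_bound_attained:
  assumes char: "(2::'k) \<noteq> 0" and nil: "nilpotent L" and nab: "\<not> abelian L"
    and dim: "has_superdim L k l" and ddim: "has_superdim (derived_subalgebra L) 1 0"
    and eq: "total_dim T = (k - 1 + l) * (k + l - 1) + 2"
  shows "L \<cong>\<^sub>s heisenberg_abelian (k - 3) l"
proof -
  have fd: "finite_dim L" using dim has_superdim_def by blast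
  have dd: "L.dim (part L 0 \<inter> lower_central L 1) = 1" "L.dim (part L 1 \<inter> lower_central L 1) = 0"
    using ddim by (simp_all add: has_superdim_def derived_subalgebra_def)
  have "part L \<alpha> \<inter> lower_central L 1 \<subseteq> carr L" for \<alpha> using L.part_carr by blast
  then have fin: "finite B" if "L.independent B" "B \<subseteq> part L \<alpha> \<inter> lower_central L 1" for B \<alpha>
    using L.finite_dim_basis[OF fd that(1)] that(2) by blast
  obtain B0 where B0: "B0 \<subseteq> part L 0 \<inter> lower_central L 1" "L.independent B0"
    "part L 0 \<inter> lower_central L 1 \<subseteq> L.span B0" "card B0 = 1"
    using L.basis_exists[of "part L 0 \<inter> lower_central L 1"] dd(1) by metis
  obtain B1 where B1: "B1 \<subseteq> part L 1 \<inter> lower_central L 1" "L.independent B1"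
    "part L 1 \<inter> lower_central L 1 \<subseteq> L.span B1" "card B1 = 0"
    using L.basis_exists[of "part L 1 \<inter> lower_central L 1"] dd(2) by metis
  obtain w0 where w0: "B0 = {w0}" using B0(4) by (rule card_1_singletonE)
  have "B1 = {}" using B1(4) fin[OF B1(2,1)] by simp
  then have D1: "x = 0" if "x \<in> part L 1" "x \<in> lower_central L 1" for x
    using B1(3) that by auto
  have D: "\<exists>c. x = scl L c w0" if x: "x \<in> lower_central L 1" for x
  proof -
    have xc: "x \<in> carr L" and h: "L.hcomp \<alpha> x \<in> lower_central L 1" for \<alpha>
      using L.graded_lower_central[of 1] x by (auto simp: L.graded_def)
    have "L.hcomp 1 x = 0" using D1[OF L.hcomp_part[OF xc] h] .
    then have "x = L.hcomp 0 x" using L.hcomp_decomp[OF xc] by simp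
    then have "x \<in> L.span {w0}" using B0(3) w0 h[of 0] L.hcomp_part[OF xc, of 0] by auto
    then show ?thesis unfolding L.span_singleton by blast
  qed
  obtain \<alpha>' \<beta>' a' b' where ab': "a' \<in> part L \<alpha>'" "b' \<in> part L \<beta>'" "brk L a' b' \<notin> lower_central L 2"
    using L.obtain_homogeneous_bracket[OF nil nab] .
  have brk1: "brk L x y \<in> lower_central L 1" if "x \<in> carr L" "y \<in> carr L" for x y
    using L.brk_lower_central[of x y 0] that by simp
  have lc2: "x = 0" if x: "x \<in> lower_central L 2" for x
  proof (rule ccontr)
    assume "x \<noteq> 0"
    have "x \<in> lower_central L 1" using L.lower_central_mono[of 1 2] x by auto
    then obtain c where c: "x = scl L c w0" using D by blast
    then have "c \<noteq> 0" using \<open>x \<noteq> 0\<close> by auto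
    then have "w0 = scl L (inverse c) x" using c by simp
    then have w02: "w0 \<in> lower_central L 2" using x L.subspace_scale[OF L.subspace_lower_central] by metis
    obtain d where "brk L a' b' = scl L d w0" using D brk1 ab' L.part_carr by blast
    then show False using ab'(3) w02 L.subspace_scale[OF L.subspace_lower_central] by metis
  qed
  have attained: "t \<alpha> a (\<alpha> + \<beta>) (brk L a b) \<noteq> 0 \<and> t \<alpha> a (\<alpha> + \<beta>) (brk L a b) \<noteq> t \<beta> b (\<alpha> + \<beta>) (brk L a b)"
    if ab: "a \<in> part L \<alpha>" "b \<in> part L \<beta>" "brk L a b \<noteq> 0" for \<alpha> \<beta> a b
  proof -
    let ?W = "{t \<alpha> a (\<alpha> + \<beta>) (brk L a b), t \<beta> b (\<alpha> + \<beta>) (brk L a b)}"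
    have "brk L a b \<notin> lower_central L 2" using lc2 ab(3) by blast
    from total_dim_bound(4)[OF char nil dim ddim ab(1,2) this] eq have "2 \<le> card (?W - {0})" by simp
    moreover have "card (?W - {0}) \<le> 1" if "?W - {0} \<subseteq> {z}" for z
      using card_mono[OF _ that] by simp
    ultimately show ?thesis by fastforce
  qed
  have odd_sq: "brk L x x = 0" if "x \<in> part L 1" for x
    using attained[OF that that] by blast
  have odd_odd: "brk L x y = 0" if x: "x \<in> part L 1" and y: "y \<in> part L 1" for x y
  proof -
    note c = L.part_carr[OF x] L.part_carr[OF y]
    have "x + y \<in> part L 1" using x y L.subspace_add[OF L.part_subspace] by blast
    from odd_sq[OF this] have "brk L x y + brk L y x = 0"
      using c odd_sq[OF x] odd_sq[OF y]
      by (simp add: L.brk_add_left L.brk_add_right L.subspace_add[OF L.subspace_carr] add.commute)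
    moreover have "brk L y x = brk L x y" using L.skew[OF y x] by simp
    ultimately have "scl L 2 (brk L x y) = 0"
      using L.scale_left_distrib[of 1 1 "brk L x y"] by simp
    then show ?thesis using char by simp
  qed
  have mixed: "brk L x y = 0" "brk L y x = 0" if x: "x \<in> part L 1" and y: "y \<in> part L 0" for x y
    using L.brk_part[OF x y] L.brk_part[OF y x] brk1 D1 L.part_carr[OF x] L.part_carr[OF y] by auto
  have odd: "brk L x y = 0 \<and> brk L y x = 0" if x: "x \<in> part L 1" and y: "y \<in> carr L" for x y
  proof -
    have h: "L.hcomp \<alpha> y \<in> part L \<alpha>" for \<alpha> by (rule L.hcomp_part[OF y])
    have "brk L x (L.hcomp 0 y + L.hcomp 1 y) = 0" "brk L (L.hcomp 0 y + L.hcomp 1 y) x = 0"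
      using mixed[OF x h] odd_odd[OF x h] odd_odd[OF h x] L.part_carr[OF x] L.part_carr[OF h]
      by (simp_all add: L.brk_add_left L.brk_add_right)
    then show ?thesis by (simp add: L.hcomp_decomp[OF y])
  qed
  have nz': "brk L a' b' \<noteq> 0" using ab'(3) L.subspace_0[OF L.subspace_lower_central] by metis
  have "\<alpha>' = 0"
    using odd[OF _ L.part_carr[OF ab'(2)], of a'] ab'(1) nz' by (cases \<alpha>') auto
  moreover have "\<beta>' = 0"
    using odd[OF _ L.part_carr[OF ab'(1)], of b'] ab'(2) nz' by (cases \<beta>') auto
  ultimately have a: "a' \<in> part L 0" and b: "b' \<in> part L 0" using ab' by simp_all
  define w where "w = brk L a' b'"
  have wp: "w \<in> part L 0" unfolding w_def using L.brk_part[OF a b] by simp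
  have w1: "w \<in> lower_central L 1" unfolding w_def using brk1 a b L.part_carr by blast
  have Dw: "\<exists>c. x = scl L c w" if "x \<in> lower_central L 1" for x
  proof -
    obtain d where d: "w = scl L d w0" using D[OF w1] by blast
    then have "d \<noteq> 0" using nz' w_def by auto
    then have "w0 = scl L (inverse d) w" using d by simp
    then show ?thesis using D[OF that] by (metis L.scale_scale)
  qed
  show ?thesis
  proof (rule L.heisenberg_abelian_iso[OF char dim a b nz' _ odd])
    show "\<exists>c. brk L x y = scl L c (brk L a' b')" if "x \<in> part L 0" "y \<in> part L 0" for x y
      using Dw brk1 that L.part_carr unfolding w_def by blast
    show "brk L (brk L a' b') y = 0" if y: "y \<in> part L 0" for y
    proof -
      have "brk L y w \<in> lower_central L 2"
        using L.brk_lower_central[OF L.part_carr[OF y] w1] by (simp add: numeral_2_eq_2)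
      then have "brk L y w = 0" by (rule lc2)
      then show ?thesis using L.skew_even[OF wp y] by (simp add: w_def)
    qed
    show "brk L x y = 0"
      if x: "x \<in> part L 0" and y: "y \<in> part L 0" and comm: "brk L a' x = 0" "brk L b' x = 0" "brk L a' y = 0" "brk L b' y = 0"
      for x y
    proof (rule ccontr)
      assume nz: "brk L x y \<noteq> 0"
      obtain c where c: "brk L x y = scl L c w" using Dw brk1 x y L.part_carr by blast
      have "brk L x a' = 0" "brk L y a' = 0"
        using L.skew_even[OF x a] L.skew_even[OF y a] comm by simp_all
      then have "t 0 (brk L x y) 0 a' = 0"
        using t_brk_left[OF x y a] t_zero_right[OF x] t_zero_right[OF y] by simp
      then have "scl T c (t 0 w 0 a') = 0" using t_scl_left[OF wp a] c by simp
      moreover have "c \<noteq> 0" using nz c by auto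
      ultimately have "t 0 w 0 a' = 0" by simp
      then have "t 0 a' 0 w = 0" using t_skew_bracket[OF char a b a] by (simp add: w_def)
      then show False using attained[OF a b nz'] by (simp add: w_def)
    qed
  qed
qed

theorem theorem4p6:
  fixes L :: "('k::field, 'a::ab_group_add) superalg"
    and T :: "('k, 'b::ab_group_add) superalg"
    and k l r s :: nat
  assumes "CHAR('k) \<noteq> 2" and "CHAR('k) \<noteq> 3"
    and "lie_superalgebra L" and "nilpotent L" and "\<not> abelian L"
    and "has_superdim L k l"
    and "has_superdim (derived_subalgebra L) r s"
    and "is_tensor_square L T"
  shows "finite_dim T \<and>
    int (total_dim T) \<le> (int (k + l) - int (r + s)) * (int (k + l) - 1) + 2 \<and>
    (r = 1 \<and> s = 0 \<longrightarrow>
      (int (total_dim T) = (int (k + l) - int (r + s)) * (int (k + l) - 1) + 2 \<longleftrightarrow>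
       L \<cong>\<^sub>s (heisenberg_1_0 \<oplus>\<^sub>s abelian_superalg (k - 3) l)))"
proof -
  note lie = assms(3) and nil = assms(4) and nab = assms(5) and dim = assms(6) and ddim = assms(7)
    and square = assms(8)
  interpret L: lie_superalgebra L by (rule lie)
  have char: "(2::'k) \<noteq> 0"
  proof
    assume "(2::'k) = 0"
    then have "of_nat 2 = (0::'k)" by simp
    then have "CHAR('k) dvd 2" by (simp only: of_nat_eq_0_iff_char_dvd)
    then have "CHAR('k) \<le> 2" "CHAR('k) \<noteq> 0"
      using dvd_imp_le[of "CHAR('k)" 2] by (simp, metis dvd_0_left_iff zero_neq_numeral)
    moreover have "CHAR('k) \<noteq> 1" by simp
    ultimately show False using assms(1) by arith
  qed
  obtain t where "tensor_pairing L T t" using tensor_square_pairing[OF lie square] by metis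
  then interpret tensor_pairing L T t .
  obtain \<alpha> \<beta> a b where a: "a \<in> part L \<alpha>" and b: "b \<in> part L \<beta>" and w: "brk L a b \<notin> lower_central L 2"
    using L.obtain_homogeneous_bracket[OF nil nab] .
  note bound = total_dim_bound[OF char nil dim ddim a b w]
  let ?N = "(k - r + (l - s)) * (k + l - 1)"
  have "card ({t \<alpha> a (\<alpha> + \<beta>) (brk L a b), t \<beta> b (\<alpha> + \<beta>) (brk L a b)} - {0})
      \<le> card {t \<alpha> a (\<alpha> + \<beta>) (brk L a b), t \<beta> b (\<alpha> + \<beta>) (brk L a b)}"
    by (intro card_mono) auto
  also have "\<dots> \<le> 2" by (simp add: card_insert_if)
  finally have le: "total_dim T \<le> ?N + 2" using bound(4) by linarith
  have N: "(int (k + l) - int (r + s)) * (int (k + l) - 1) + 2 = int (?N + 2)"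
  proof (cases "k + l = 0")
    case True
    then show ?thesis using bound(2,3) by simp
  next
    case False
    then have "int (k + l - 1) = int (k + l) - 1" by linarith
    moreover have "int (k - r + (l - s)) = int (k + l) - int (r + s)"
      using bound(2,3) by linarith
    ultimately show ?thesis by (simp only: of_nat_add of_nat_mult of_nat_numeral)
  qed
  have "total_dim T = ?N + 2 \<longleftrightarrow> L \<cong>\<^sub>s heisenberg_abelian (k - 3) l" if rs: "r = 1" "s = 0"
  proof
    assume "total_dim T = ?N + 2"
    then show "L \<cong>\<^sub>s heisenberg_abelian (k - 3) l"
      using heisenberg_abelian_if_bound_attained[OF char nil nab dim] ddim rs by simp
  next
    assume "L \<cong>\<^sub>s heisenberg_abelian (k - 3) l"
    from total_dim_heisenberg_abelian[OF lie square bound(1) this]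
    have "(k - 3 + l + 2) * (k - 3 + l + 2) + 2 \<le> total_dim T" .
    \<comment> \<open>If \<open>k < 3\<close> then \<open>k - 3 = 0\<close>, and the estimate still holds.\<close>
    moreover have "(k - 1 + l) * (k + l - 1) \<le> (k - 3 + l + 2) * (k - 3 + l + 2)"
      by (intro mult_mono) auto
    ultimately show "total_dim T = ?N + 2" using le rs by simp
  qed
  then show ?thesis using bound(1) le unfolding N of_nat_eq_iff of_nat_le_iff by blast
qed

end
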